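(* Let $d\ge 3$. For every integer $N\ge 1$ there exists a coupling $\mathbb Q_N$ of the zero-average Gaussian free field $\Psi_{\mathbb T^d_N}$ on $\mathbb T^d_N$ and the Gaussian free field $\varphi_{\mathbb Z^d}$ on $\mathbb Z^d$ (i.e. a probability measure carrying both fields with the correct marginal laws) such that the following holds. For every $\delta\in(\tfrac12,1)$ and $\varepsilon>0$ there are constants $c_\delta,c'_\delta>0$, depending only on $\delta$ and $d$ (not on $N$ or $\varepsilon$), such that for all $N \geq 1$ $$\mathbb Q_N\Big[\sup_{x\in B_N^\delta}\big|\Psi_{\mathbb T^d_N}(x)-\varphi_{\mathbb Z^d}(\widehat x)\big|>\varepsilon\Big]\le 4N^d\exp\big(-c_\delta\,\varepsilon^2N^{c'_\delta}\big).$$ In particular, for all $\delta\in(\tfrac12,1)$ and $\varepsilon>0$, $$\lim_{N\to\infty}\mathbb Q_N\Big[\sup_{x\in B_N^\delta}\big|\Psi_{\mathbb T^d_N}(x)-\varphi_{\mathbb Z^d}(\widehat x)\big|>\varepsilon\Big]=0.$$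
   Context: $\mathbb T^d_N=(\mathbb Z/N\mathbb Z)^d$ is the discrete torus and $\mathbb Z^d$ the integer lattice, both with nearest-neighbour graph structure, $d\ge3$ fixed. $\pi_N:\mathbb Z^d\to\mathbb T^d_N$ is the canonical projection; for $x\in\mathbb T^d_N$, $\widehat x$ is the unique element of $\pi_N^{-1}(\{x\})\cap(-\frac N2,\frac N2]^d$. Simple random walk moves at each step to $x\pm e_i$ (modulo $N$ on the torus) with probability $\frac1{2d}$ each; $P_x^{\mathbb T^d_N}$, $P_x^{\mathbb Z^d}$ are its laws started at $x$; $(X_k)_{k\ge0}$ is the discrete-time walk and $(\overline X_t)_{t\ge0}$ the continuous-time walk with i.i.d. Exp(1) holding times. Zero-average Green function: $G_{\mathbb T^d_N}(x,y)=\int_0^\infty\big(P_x^{\mathbb T^d_N}[\overline X_t=y]-\frac1{N^d}\big)dt$, $x,y\in\mathbb T^d_N$. The zero-average Gaussian free field $(\Psi_{\mathbb T^d_N}(x))_{x\in\mathbb T^d_N}$ is the centered Gaussian field with covariance $G_{\mathbb T^d_N}(\cdot,\cdot)$. Green function on $\mathbb Z^d$: $g_{\mathbb Z^d}(x,y)=\sum_{k\ge0}P_x^{\mathbb Z^d}[X_k=y]$. The Gaussian free field $(\varphi_{\mathbb Z^d}(x))_{x\in\mathbb Z^d}$ is the centered Gaussian field with covariance $g_{\mathbb Z^d}(\cdot,\cdot)$. Boxes: $\mathcal B_N^\delta=\big(-\frac{N-N^\delta-2}2,\frac{N-N^\delta-2}2\big]^d\cap\mathbb Z^d$ and $B_N^\delta=\pi_N(\mathcal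 B_N^\delta)\subseteq\mathbb T^d_N$ (possibly empty for small $N$, in which case the supremum over $B_N^\delta$ is taken to be $0$). *)

theory Defs
  imports "HOL-Probability.Probability"
begin

section \<open>Lattice and discrete torus\<close>

text \<open>
  The lattice \<open>\<int>\<^sup>d\<close> is the type \<open>int ^ 'd\<close> with \<open>d = CARD('d)\<close>. The torus \<open>(\<int>/N\<int>)\<^sup>d\<close> is
  represented by the residues in \<open>{0..<N}\<^sup>d\<close>, and \<open>proj N\<close> is the canonical projection
  \<open>\<pi>\<^sub>N\<close> onto it.
\<close>

definition proj :: "nat \<Rightarrow> int ^ 'd \<Rightarrow> int ^ 'd::finite" where
  "proj N x = (\<chi> i. x $ i mod int N)"

definition torus :: "nat \<Rightarrow> (int ^ 'd::finite) set" where
  "torus N = {x. \<forall>i. 0 \<le> x $ i \<and> x $ i < int N}"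

definition lift :: "nat \<Rightarrow> int ^ 'd \<Rightarrow> int ^ 'd::finite" where
  "lift N x = (THE y. proj N y = x \<and>
     (\<forall>i. - (real N / 2) < real_of_int (y $ i) \<and> real_of_int (y $ i) \<le> real N / 2))"

definition lattice_box :: "nat \<Rightarrow> real \<Rightarrow> (int ^ 'd::finite) set" where
  "lattice_box N \<delta> = {x. \<forall>i. - ((real N - real N powr \<delta> - 2) / 2) < real_of_int (x $ i) \<and>
                            real_of_int (x $ i) \<le> (real N - real N powr \<delta> - 2) / 2}"

definition torus_box :: "nat \<Rightarrow> real \<Rightarrow> (int ^ 'd::finite) set" where
  "torus_box N \<delta> = proj N ` lattice_box N \<delta>"


section \<open>Simple random walk\<close>

text \<open>
  A sample point is a sequence of i.i.d. pairs: a uniform direction in \<open>{+, -} \<times> {1..d}\<close> and an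
  independent Exp(1) holding time. All walks, whatever the starting point, live on this space.
\<close>

type_synonym 'd walk_sample = "nat \<Rightarrow> ('d \<times> bool) \<times> real"

definition walk_space :: "'d::finite walk_sample measure" where
  "walk_space = PiM UNIV (\<lambda>_. measure_pmf (pmf_of_set UNIV) \<Otimes>\<^sub>M
                               density lborel (exponential_density 1))"

definition unit_step :: "'d \<times> bool \<Rightarrow> int ^ 'd::finite" where
  "unit_step u = (if snd u then axis (fst u) 1 else - axis (fst u) 1)"

text \<open>
  The parameter \<open>p\<close> reduces every position to the state space: \<open>p = id\<close> gives the walk on
  \<open>\<int>\<^sup>d\<close>, \<open>p = proj N\<close> the walk on the torus.
\<close>

primrec walk :: "(int ^ 'd \<Rightarrow> int ^ 'd) \<Rightarrow> int ^ 'd \<Rightarrow> 'd::finite walk_sample \<Rightarrow> nat \<Rightarrow> int ^ 'd" where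
  "walk p x \<omega> 0 = x"
| "walk p x \<omega> (Suc k) = p (walk p x \<omega> k + unit_step (fst (\<omega> k)))"

definition jump_time :: "'d walk_sample \<Rightarrow> nat \<Rightarrow> real" where
  "jump_time \<omega> k = (\<Sum>i<k. snd (\<omega> i))"

text \<open>
  The least index below exists for all \<open>t\<close> almost surely, since the jump times tend to infinity.
\<close>

definition cts_walk ::
    "(int ^ 'd \<Rightarrow> int ^ 'd) \<Rightarrow> int ^ 'd \<Rightarrow> 'd::finite walk_sample \<Rightarrow> real \<Rightarrow> int ^ 'd" where
  "cts_walk p x \<omega> t = walk p x \<omega> (LEAST k. t < jump_time \<omega> (Suc k))"


section \<open>Green functions\<close>

definition green_torus :: "nat \<Rightarrow> int ^ 'd \<Rightarrow> int ^ 'd::finite \<Rightarrow> real" where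
  "green_torus N x y =
     (LINT t:{0..}|lborel.
        \<P>(\<omega> in walk_space. cts_walk (proj N) x \<omega> t = y) - 1 / real N ^ CARD('d))"

definition green_lattice :: "int ^ 'd \<Rightarrow> int ^ 'd::finite \<Rightarrow> real" where
  "green_lattice x y = (\<Sum>k. \<P>(\<omega> in walk_space. walk id x \<omega> k = y))"


section \<open>Gaussian fields and couplings\<close>

text \<open>
  The case \<open>\<sigma> = 0\<close>, a point mass at 0, has to be included: the zero-average field sums to 0
  over the torus.
\<close>

definition centered_normal :: "real \<Rightarrow> real measure" where
  "centered_normal \<sigma> = (if \<sigma> = 0 then return borel 0 else density lborel (normal_density 0 \<sigma>))"

text \<open>
  A family is a centered Gaussian field if all its finite linear combinations are centered normal;
  as all means vanish, the covariance is the expectation of the product.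
\<close>

definition centered_gaussian_field ::
    "'w measure \<Rightarrow> 'i set \<Rightarrow> ('i \<Rightarrow> 'w \<Rightarrow> real) \<Rightarrow> ('i \<Rightarrow> 'i \<Rightarrow> real) \<Rightarrow> bool" where
  "centered_gaussian_field M I X C \<longleftrightarrow>
     (\<forall>x\<in>I. X x \<in> borel_measurable M) \<and>
     (\<forall>J a. finite J \<longrightarrow> J \<subseteq> I \<longrightarrow>
        (\<exists>\<sigma>\<ge>0. distr M borel (\<lambda>\<omega>. \<Sum>x\<in>J. a x * X x \<omega>) = centered_normal \<sigma>)) \<and>
     (\<forall>x\<in>I. \<forall>y\<in>I. (LINT \<omega>|M. X x \<omega> * X y \<omega>) = C x y)"

text \<open>
  A coupling is a joint law of the two fields: a probability measure on the product of the two
  configuration spaces, whose coordinate processes have the prescribed laws.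
\<close>

type_synonym 'd field_pair = "(int ^ 'd \<Rightarrow> real) \<times> (int ^ 'd \<Rightarrow> real)"

definition gff_coupling :: "nat \<Rightarrow> 'd::finite field_pair measure \<Rightarrow> bool" where
  "gff_coupling N Q \<longleftrightarrow>
     prob_space Q \<and>
     sets Q = sets (PiM (torus N) (\<lambda>_. borel) \<Otimes>\<^sub>M PiM UNIV (\<lambda>_. borel)) \<and>
     centered_gaussian_field Q (torus N) (\<lambda>x \<omega>. fst \<omega> x) (green_torus N) \<and>
     centered_gaussian_field Q UNIV (\<lambda>x \<omega>. snd \<omega> x) green_lattice"

definition sup_deviation :: "nat \<Rightarrow> real \<Rightarrow> 'd::finite field_pair \<Rightarrow> real" where
  "sup_deviation N \<delta> \<omega> =
     (if (torus_box N \<delta> :: (int ^ 'd) set) = {} then 0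
      else (SUP x\<in>torus_box N \<delta>. \<bar>fst \<omega> x - snd \<omega> (lift N x)\<bar>))"

end

theory Submission
  imports Defs "HOL-Real_Asymp.Real_Asymp"
begin

text \<open>
  Let \<open>P\<close> be the transition operator of simple random walk, on the lattice or on the torus. In both
  cases the Green function inverts \<open>I - P\<close> (on the torus: on functions of mean zero), and for every
  \<open>R\<close> the geometric series gives
  \<open>(I - P)\<^sup>-\<^sup>1 = (\<Sum>k<R. P\<^sup>2\<^sup>k (I + P)) + P\<^sup>2\<^sup>R (I - P)\<^sup>-\<^sup>1\<close>.

  The terms of the sum have finite range and are Gram matrices: \<open>I + P\<close> is \<open>1/(2d)\<close> times the sum over
  all edges \<open>e\<close> of the rank one operators \<open>1\<^sub>e \<otimes> 1\<^sub>e\<close>, so a field with covariance \<open>P\<^sup>2\<^sup>k (I + P)\<close> arises by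
  spreading independent Gaussian noise on the edges with \<open>P\<^sup>k\<close> (lemma \<open>torus_edge_gram\<close>). The value
  of this field at \<open>x\<close> uses only the noise within distance \<open>k + 1\<close> of \<open>x\<close>.

  The coupling takes \<open>R\<close> equal to \<open>\<surd>N / 2\<close>, rounded up, identifies the torus with the centered box
  \<open>(-N/2, N/2]\<^sup>d\<close> of the lattice and uses the same edge noise in this box for both fields, for all
  \<open>k < R\<close>. As \<open>\<delta> > 1/2\<close>, points of the box of the statement are at distance more than \<open>\<surd>N / 2\<close> from the
  place where the torus closes up. There the two short-range fields see the same noise with the same
  coefficients, and they differ only by the spatial mean that the zero-average field has to
  subtract, of variance \<open>2 R / N\<^sup>d\<close>. The remaining parts of the fields are taken independent; at points
  of the box they have the covariances \<open>P\<^sup>2\<^sup>R (I - P)\<^sup>-\<^sup>1\<close>. Since return probabilities after \<open>m\<close> steps are at most of order \<open>m\<^sup>-\<^sup>3\<^sup>/\<^sup>2\<close> for \<open>d \<ge> 3\<close> and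
  \<open>1 \<le> m \<le> N\<^sup>2\<close>, and since the spectral gap of the torus is of order \<open>N\<^sup>-\<^sup>2\<close>, their variances are
  at most of order \<open>R\<^sup>-\<^sup>1\<^sup>/\<^sup>2\<close>. So \<open>\<Psi> - \<phi>\<close> is, at every point of the box, centered Gaussian with variance at most of
  order \<open>N\<^sup>-\<^sup>1\<^sup>/\<^sup>4\<close> (lemma \<open>field_error_le\<close>), and a union bound over at most \<open>N\<^sup>d\<close> points yields the estimate.
  The construction does not involve \<open>\<delta>\<close>.

  On the technical side, the joint covariance is a positive semidefinite kernel on the disjoint union
  of torus and lattice, and such a kernel on a countable set is realised by a Cholesky factorization
  and i.i.d. standard normal variables (lemma \<open>ex_gaussian_field\<close>). Torus quantities are finite Fourier
  sums. Lattice quantities are read off from a torus so large that the walk cannot wrap around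
  (lemma \<open>torus_kernel_eq_lattice_kernel\<close>), so that no Fourier integrals are needed.
\<close>


section \<open>Positive semidefinite kernels\<close>

definition psd :: "('i \<Rightarrow> 'i \<Rightarrow> real) \<Rightarrow> bool" where
  "psd K \<longleftrightarrow> (\<forall>J a. finite J \<longrightarrow> 0 \<le> (\<Sum>i\<in>J. \<Sum>j\<in>J. a i * a j * K i j))"

lemma psdI:
  assumes "\<And>J a. finite J \<Longrightarrow> 0 \<le> (\<Sum>i\<in>J. \<Sum>j\<in>J. a i * a j * K i j)"
  shows "psd K"
  using assms by (auto simp: psd_def)

lemma psdD: "psd K \<Longrightarrow> finite J \<Longrightarrow> 0 \<le> (\<Sum>i\<in>J. \<Sum>j\<in>J. a i * a j * K i j)"
  by (auto simp: psd_def)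

lemma psd_diag: "psd K \<Longrightarrow> 0 \<le> K i i"
  using psdD[of K "{i}" "\<lambda>_. 1"] by simp

lemma psd_add: "psd K \<Longrightarrow> psd L \<Longrightarrow> psd (\<lambda>i j. K i j + L i j)"
  by (rule psdI) (simp add: distrib_left sum.distrib psdD)

lemma psd_zero: "psd (\<lambda>i j. 0)"
  by (rule psdI) simp

lemma psd_sum:
  assumes "finite S" "\<And>s. s \<in> S \<Longrightarrow> psd (K s)"
  shows "psd (\<lambda>i j. \<Sum>s\<in>S. K s i j)"
  using assms by (induction S rule: finite_induct) (auto intro: psd_add psd_zero)

lemma psd_product: "psd (\<lambda>i j. v i * v j)"
proof (rule psdI)
  fix J :: "'a set" and a
  have "(\<Sum>i\<in>J. \<Sum>j\<in>J. a i * a j * (v i * v j)) = (\<Sum>i\<in>J. a i * v i)\<^sup>2"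
    by (simp add: power2_eq_square sum_product mult_ac)
  then show "0 \<le> (\<Sum>i\<in>J. \<Sum>j\<in>J. a i * a j * (v i * v j))" by simp
qed

lemma psd_scale: "psd K \<Longrightarrow> 0 \<le> c \<Longrightarrow> psd (\<lambda>i j. c * K i j)"
proof (rule psdI)
  fix J a assume K: "psd K" "0 \<le> c" "finite (J :: 'a set)"
  have "(\<Sum>i\<in>J. \<Sum>j\<in>J. a i * a j * (c * K i j)) = c * (\<Sum>i\<in>J. \<Sum>j\<in>J. a i * a j * K i j)"
    by (simp add: sum_distrib_left mult_ac)
  then show "0 \<le> (\<Sum>i\<in>J. \<Sum>j\<in>J. a i * a j * (c * K i j))"
    using K by (simp add: psdD)
qed

lemma psd_limit:
  fixes L :: "'i \<Rightarrow> 'i \<Rightarrow> real"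
  assumes "\<And>n. psd (K n)" "\<And>i j. (\<lambda>n. K n i j) \<longlonglongrightarrow> L i j"
  shows "psd L"
proof (rule psdI)
  fix J :: "'i set" and a assume "finite J"
  have "(\<lambda>n. \<Sum>i\<in>J. \<Sum>j\<in>J. a i * a j * K n i j) \<longlonglongrightarrow> (\<Sum>i\<in>J. \<Sum>j\<in>J. a i * a j * L i j)"
    by (intro tendsto_intros assms)
  then show "0 \<le> (\<Sum>i\<in>J. \<Sum>j\<in>J. a i * a j * L i j)"
    by (rule LIMSEQ_le_const) (use assms \<open>finite J\<close> in \<open>auto intro: psdD\<close>)
qed

text \<open>
  The map \<open>f\<close> need not be injective: coefficients with the same image are added up.
\<close>

lemma psd_pullback:
  fixes f :: "'i \<Rightarrow> 'j"
  assumes "psd K"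
  shows "psd (\<lambda>i j. K (f i) (f j))"
proof (rule psdI)
  fix J :: "'i set" and a :: "'i \<Rightarrow> real" assume J: "finite J"
  let ?A = "\<lambda>p. \<Sum>i | i \<in> J \<and> f i = p. a i"
  have group: "(\<Sum>i\<in>J. a i * g (f i)) = (\<Sum>p\<in>f ` J. ?A p * g p)" for g :: "'j \<Rightarrow> real"
  proof -
    have "(\<Sum>i\<in>J. a i * g (f i)) = (\<Sum>p\<in>f ` J. \<Sum>i | i \<in> J \<and> f i = p. a i * g (f i))"
      by (rule sum.image_gen[OF J])
    also have "\<dots> = (\<Sum>p\<in>f ` J. ?A p * g p)"
      by (intro sum.cong refl) (auto simp: sum_distrib_right intro!: sum.cong)
    finally show ?thesis .
  qed
  have "(\<Sum>i\<in>J. \<Sum>j\<in>J. a i * a j * K (f i) (f j)) = (\<Sum>i\<in>J. a i * (\<Sum>q\<in>f ` J. ?A q * K (f i) q))"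
  proof (intro sum.cong refl)
    fix i
    show "(\<Sum>j\<in>J. a i * a j * K (f i) (f j)) = a i * (\<Sum>q\<in>f ` J. ?A q * K (f i) q)"
      unfolding group[of "K (f i)", symmetric] by (simp add: sum_distrib_left mult_ac)
  qed
  also have "\<dots> = (\<Sum>p\<in>f ` J. \<Sum>q\<in>f ` J. ?A p * ?A q * K p q)"
    by (subst group) (simp add: sum_distrib_left mult_ac)
  also have "\<dots> \<ge> 0" using assms J by (intro psdD) auto
  finally show "0 \<le> (\<Sum>i\<in>J. \<Sum>j\<in>J. a i * a j * K (f i) (f j))" .
qed

lemma psd_extend:
  fixes g :: "'i \<Rightarrow> 's"
  assumes "psd (\<lambda>i j. K (g i) (g j))" "inj g" "\<And>s t. s \<notin> range g \<or> t \<notin> range g \<Longrightarrow> K s t = 0"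
  shows "psd K"
proof (rule psdI)
  fix J :: "'s set" and a assume J: "finite J"
  have fin: "finite (g -` J)" using assms(2) J by (simp add: finite_vimageI)
  have restrict: "(\<Sum>s\<in>J. h s) = (\<Sum>i\<in>g -` J. h (g i))"
    if "\<And>s. s \<notin> range g \<Longrightarrow> h s = 0" for h :: "'s \<Rightarrow> real"
  proof -
    have "(\<Sum>i\<in>g -` J. h (g i)) = (\<Sum>s\<in>g ` (g -` J). h s)"
      by (subst sum.reindex) (auto intro: inj_on_subset[OF assms(2)])
    also have "\<dots> = (\<Sum>s\<in>J. h s)"
      by (rule sum.mono_neutral_left) (use J that in auto)
    finally show ?thesis ..
  qed
  have "(\<Sum>s\<in>J. \<Sum>t\<in>J. a s * a t * K s t) =
      (\<Sum>i\<in>g -` J. \<Sum>j\<in>g -` J. a (g i) * a (g j) * K (g i) (g j))"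
    by (subst restrict, simp add: assms(3), intro sum.cong refl, subst restrict) (auto simp: assms(3))
  also have "\<dots> \<ge> 0" using psdD[OF assms(1) fin, of "\<lambda>i. a (g i)"] .
  finally show "0 \<le> (\<Sum>s\<in>J. \<Sum>t\<in>J. a s * a t * K s t)" .
qed

text \<open>
  The quadratic form of the coefficient family \<open>a + t e\<^sub>k\<close>, as a polynomial in \<open>t\<close>. Minimising over
  \<open>t\<close> gives positivity of Schur complements.
\<close>

lemma psd_shift:
  assumes K: "psd K" and sym: "\<And>i j. K i j = K j i" and J: "finite J"
  shows "0 \<le> (\<Sum>i\<in>J. \<Sum>j\<in>J. a i * a j * K i j) + 2 * t * (\<Sum>i\<in>J. a i * K i k) + t\<^sup>2 * K k k"
proof -
  let ?b = "\<lambda>i. (if i \<in> J then a i else 0) + (if i = k then t else 0)"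
  have S: "(\<Sum>i\<in>insert k J. ?b i * f i) = (\<Sum>i\<in>J. a i * f i) + t * f k" for f :: "'a \<Rightarrow> real"
  proof -
    have "(\<Sum>i\<in>insert k J. ?b i * f i) =
        (\<Sum>i\<in>insert k J. if i \<in> J then a i * f i else 0) + (\<Sum>i\<in>insert k J. if i = k then t * f i else 0)"
      by (subst sum.distrib[symmetric], intro sum.cong) (auto simp: algebra_simps)
    also have "(\<Sum>i\<in>insert k J. if i \<in> J then a i * f i else 0) = (\<Sum>i\<in>J. a i * f i)"
      using J by (intro sum.mono_neutral_cong_right) auto
    also have "(\<Sum>i\<in>insert k J. if i = k then t * f i else 0) = t * f k"
      using J by (subst sum.delta) auto
    finally show ?thesis .
  qed
  have swap: "(\<Sum>j\<in>J. t * (a j * K k j)) = (\<Sum>j\<in>J. t * (a j * K j k))"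
    by (intro sum.cong refl arg_cong2[where f = "(*)"] sym)
  have "0 \<le> (\<Sum>i\<in>insert k J. \<Sum>j\<in>insert k J. ?b i * ?b j * K i j)"
    using K J by (intro psdD) auto
  also have "\<dots> = (\<Sum>i\<in>insert k J. ?b i * (\<Sum>j\<in>insert k J. ?b j * K i j))"
    by (simp only: sum_distrib_left mult.assoc)
  also have "\<dots> = (\<Sum>i\<in>J. a i * ((\<Sum>j\<in>J. a j * K i j) + t * K i k)) + t * ((\<Sum>j\<in>J. a j * K k j) + t * K k k)"
    by (simp only: S)
  also have "\<dots> = (\<Sum>i\<in>J. \<Sum>j\<in>J. a i * a j * K i j) + 2 * t * (\<Sum>i\<in>J. a i * K i k) + t\<^sup>2 * K k k"
    by (simp add: distrib_left sum.distrib sum_distrib_left power2_eq_square mult_ac swap)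
  finally show ?thesis .
qed

lemma psd_zero_diag:
  assumes K: "psd K" and sym: "\<And>i j. K i j = K j i" and 0: "K k k = 0"
  shows "K i k = 0"
proof (rule ccontr)
  assume ne: "K i k \<noteq> 0"
  have "0 \<le> K i i + 2 * t * K i k" for t
    using psd_shift[OF K sym, of "{i}" "\<lambda>_. 1" t k] 0 by simp
  \<comment> \<open>an affine function of \<open>t\<close> that is bounded below has slope 0; this \<open>t\<close> gives the value \<open>-1\<close>\<close>
  from this[of "- (K i i + 1) / (2 * K i k)"] ne show False by (simp add: field_simps)
qed


section \<open>Cholesky factorization\<close>

text \<open>
  The Schur complement is the covariance that remains after regression on the \<open>k\<close>-th variable. If
  \<open>K k k = 0\<close>, the division by zero makes it equal to \<open>K\<close>, which is right because then row \<open>k\<close> of a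
  positive semidefinite kernel vanishes.
\<close>

definition schur :: "'i \<Rightarrow> ('i \<Rightarrow> 'i \<Rightarrow> real) \<Rightarrow> 'i \<Rightarrow> 'i \<Rightarrow> real" where
  "schur k K i j = K i j - K i k * K k j / K k k"

lemma psd_schur:
  assumes K: "psd K" and sym: "\<And>i j. K i j = K j i"
  shows "psd (schur k K)"
proof (cases "K k k = 0")
  case True
  then have "schur k K = K" by (simp add: schur_def fun_eq_iff)
  then show ?thesis using K by simp
next
  case False
  then have pos: "K k k > 0" using psd_diag[OF K, of k] by simp
  show ?thesis
  proof (rule psdI)
    fix J a assume J: "finite (J :: 'a set)"
    let ?B = "\<Sum>i\<in>J. a i * K i k"
    \<comment> \<open>the minimum over \<open>t\<close> is attained at \<open>- ?B / K k k\<close>\<close>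
    have "0 \<le> (\<Sum>i\<in>J. \<Sum>j\<in>J. a i * a j * K i j) + 2 * (- ?B / K k k) * ?B + (- ?B / K k k)\<^sup>2 * K k k"
      by (rule psd_shift[OF K sym J])
    also have "\<dots> = (\<Sum>i\<in>J. \<Sum>j\<in>J. a i * a j * K i j) - ?B * ?B / K k k"
      using pos by (simp add: field_simps power2_eq_square)
    also have "?B * ?B / K k k = (\<Sum>i\<in>J. \<Sum>j\<in>J. a i * a j * (K i k * K k j / K k k))"
    proof -
      have "?B * ?B = ?B * (\<Sum>j\<in>J. a j * K k j)"
        by (intro arg_cong2[where f = "(*)"] sum.cong refl sym)
      then show ?thesis by (simp add: sum_product sum_divide_distrib mult_ac)
    qed
    finally show "0 \<le> (\<Sum>i\<in>J. \<Sum>j\<in>J. a i * a j * schur k K i j)"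
      by (simp add: schur_def right_diff_distrib sum_subtractf)
  qed
qed

primrec residual :: "(nat \<Rightarrow> nat \<Rightarrow> real) \<Rightarrow> nat \<Rightarrow> nat \<Rightarrow> nat \<Rightarrow> real" where
  "residual K 0 = K"
| "residual K (Suc n) = schur n (residual K n)"

definition cholesky :: "(nat \<Rightarrow> nat \<Rightarrow> real) \<Rightarrow> nat \<Rightarrow> nat \<Rightarrow> real" where
  "cholesky K i k = residual K k i k / sqrt (residual K k k k)"

context
  fixes K :: "nat \<Rightarrow> nat \<Rightarrow> real"
  assumes K: "psd K" and sym: "\<And>i j. K i j = K j i"
begin

lemma residual_psd: "psd (residual K n) \<and> (\<forall>i j. residual K n i j = residual K n j i)"
proof (induction n)
  case 0
  then show ?case using K sym by auto
next
  case (Suc n)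
  then have "psd (residual K n)" "\<And>i j. residual K n i j = residual K n j i" by blast+
  note * = this
  have "schur n (residual K n) i j = schur n (residual K n) j i" for i j
    using *(2)[of i j] *(2)[of n i] *(2)[of n j] by (simp add: schur_def)
  then show ?case using psd_schur[OF *, of n] by simp
qed

text \<open>
  Regression on a variable makes all other variables uncorrelated with it, so that step \<open>n\<close>
  eliminates row and column \<open>n\<close>.
\<close>

lemma residual_eq_0:
  "i < n \<or> j < n \<Longrightarrow> residual K n i j = 0"
proof (induction n arbitrary: i j)
  case (Suc n)
  have sym': "residual K n i j = residual K n j i" for i j using residual_psd by blast
  have zero: "residual K n i n = 0" if "residual K n n n = 0" for i
    using psd_zero_diag[of "residual K n" n i] residual_psd that by blast
  consider "i < n \<or> j < n" | "i = n" | "j = n" using Suc.prems by linarith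
  then show ?case
  proof cases
    case 1
    then show ?thesis using Suc.IH[of i j] Suc.IH[of i n] Suc.IH[of n j] by (auto simp: schur_def)
  next
    case 2
    then show ?thesis using zero[of j] sym'[of n j] by (cases "residual K n n n = 0") (auto simp: schur_def)
  next
    case 3
    then show ?thesis using zero[of i] by (cases "residual K n n n = 0") (auto simp: schur_def)
  qed
qed simp

lemma cholesky_eq_0: "i < k \<Longrightarrow> cholesky K i k = 0"
  by (simp add: cholesky_def residual_eq_0)

lemma cholesky_residual:
  "K i j = (\<Sum>k<n. cholesky K i k * cholesky K j k) + residual K n i j"
proof (induction n)
  case (Suc n)
  have "residual K n n n \<ge> 0" "residual K n n j = residual K n j n"
    using psd_diag[of "residual K n" n] residual_psd by (blast, blast)
  then have "residual K n i j = cholesky K i n * cholesky K j n + residual K (Suc n) i j"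
    by (simp add: cholesky_def schur_def)
  then show ?case using Suc by simp
qed simp

lemma cholesky_factorization:
  assumes "i < n"
  shows "K i j = (\<Sum>k<n. cholesky K i k * cholesky K j k)"
  using cholesky_residual[of i j n] residual_eq_0[of i n j] assms by simp

end


section \<open>Gaussian fields from white noise\<close>

definition white_noise :: "(nat \<Rightarrow> real) measure" where
  "white_noise = PiM UNIV (\<lambda>_. density lborel std_normal_density)"

lemma prob_space_white_noise: "prob_space white_noise"
  unfolding white_noise_def by (intro prob_space_PiM prob_space_normal_density) simp

lemma sets_white_noise: "sets white_noise = sets (PiM UNIV (\<lambda>_. borel))"
  unfolding white_noise_def by (intro sets_PiM_cong) auto

lemma measurable_white_noise_component [measurable]:
  "(\<lambda>\<omega>. \<omega> k) \<in> borel_measurable white_noise"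
  unfolding measurable_cong_sets[OF sets_white_noise refl] by simp

lemma distr_white_noise_component:
  "distr white_noise borel (\<lambda>\<omega>. \<omega> k) = density lborel std_normal_density"
proof -
  interpret product_prob_space "\<lambda>_::nat. density lborel std_normal_density" UNIV
    by (simp add: product_prob_spaceI prob_space_normal_density)
  have "distr white_noise (density lborel std_normal_density) (\<lambda>\<omega>. \<omega> k) = density lborel std_normal_density"
    unfolding white_noise_def by (rule PiM_component) simp
  then show ?thesis by (metis distr_cong sets_density sets_lborel)
qed

lemma indep_white_noise: "prob_space.indep_vars white_noise (\<lambda>_. borel) (\<lambda>k \<omega>. \<omega> k) UNIV"
proof -
  interpret prob_space white_noise by (rule prob_space_white_noise)
  have "distr white_noise (PiM UNIV (\<lambda>_. borel)) (\<lambda>\<omega>. \<lambda>i\<in>UNIV. \<omega> i) = distr white_noise white_noise (\<lambda>\<omega>. \<omega>)"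
    by (intro distr_cong) (auto simp: sets_white_noise)
  also have "\<dots> = PiM UNIV (\<lambda>i. distr white_noise borel (\<lambda>\<omega>. \<omega> i))"
    unfolding distr_white_noise_component by (simp add: distr_id) (simp add: white_noise_def)
  finally show ?thesis by (subst indep_vars_iff_distr_eq_PiM) auto
qed

text \<open>
  Vanishing coefficients are dropped first, because a sum of independent normal variables is treated
  in terms of densities, which a point mass does not have.
\<close>

lemma linear_combination_white_noise:
  "distr white_noise borel (\<lambda>\<omega>. \<Sum>k<n. c k * \<omega> k) = centered_normal (sqrt (\<Sum>k<n. (c k)\<^sup>2))"
proof -
  interpret prob_space white_noise by (rule prob_space_white_noise)
  define I where "I = {k. k < n \<and> c k \<noteq> 0}"
  have fin: "finite I" by (simp add: I_def)
  have eq: "(\<Sum>k<n. c k * \<omega> k) = (\<Sum>k\<in>I. c k * \<omega> k)" "(\<Sum>k<n. (c k)\<^sup>2) = (\<Sum>k\<in>I. \<bar>c k\<bar>\<^sup>2)" for \<omega> :: "nat \<Rightarrow> real"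
    by (intro sum.mono_neutral_cong_right; auto simp: I_def)+
  show ?thesis
  proof (cases "I = {}")
    case True
    have "distr white_noise borel (\<lambda>_. 0 :: real) = return borel 0"
      by (intro measure_eqI) (auto simp: emeasure_distr emeasure_space_1 indicator_def)
    then show ?thesis by (simp add: eq True centered_normal_def)
  next
    case False
    have "distributed white_noise lborel (\<lambda>\<omega>. \<Sum>k\<in>I. c k * \<omega> k)
        (normal_density (\<Sum>k\<in>I. 0) (sqrt (\<Sum>k\<in>I. \<bar>c k\<bar>\<^sup>2)))"
    proof (rule sum_indep_normal[OF fin False])
      show "indep_vars (\<lambda>i. borel) (\<lambda>k \<omega>. c k * \<omega> k) I"
        by (rule indep_vars_subset[OF indep_vars_compose2[OF indep_white_noise]]) auto
      fix k assume k: "k \<in> I"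
      then show "0 < \<bar>c k\<bar>" by (simp add: I_def)
      have "distributed white_noise lborel (\<lambda>\<omega>. \<omega> k) std_normal_density"
      proof -
        have "distr white_noise lborel (\<lambda>\<omega>. \<omega> k) = distr white_noise borel (\<lambda>\<omega>. \<omega> k)"
          by (rule distr_cong) auto
        then show ?thesis by (simp add: distributed_def distr_white_noise_component)
      qed
      from normal_density_affine[OF this, of "c k" 0] k
      show "distributed white_noise lborel (\<lambda>\<omega>. c k * \<omega> k) (normal_density 0 \<bar>c k\<bar>)"
        by (simp add: I_def)
    qed
    then have "distr white_noise lborel (\<lambda>\<omega>. \<Sum>k\<in>I. c k * \<omega> k) = density lborel (normal_density 0 (sqrt (\<Sum>k\<in>I. \<bar>c k\<bar>\<^sup>2)))"
      by (simp add: distributed_def)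
    moreover have "(\<Sum>k\<in>I. \<bar>c k\<bar>\<^sup>2) > 0"
      using fin False by (intro sum_pos) (auto simp: I_def)
    ultimately show ?thesis unfolding eq centered_normal_def
      by (auto simp: cong: distr_cong)
  qed
qed

lemma centered_normal_second_moment:
  assumes "0 \<le> \<sigma>"
  shows "has_bochner_integral (centered_normal \<sigma>) (\<lambda>x. x\<^sup>2) (\<sigma>\<^sup>2)"
proof (cases "\<sigma> = 0")
  case True
  have "AE x in return borel (0::real). x\<^sup>2 = 0" by (subst AE_return) auto
  then have "has_bochner_integral (return borel (0::real)) (\<lambda>x. x\<^sup>2) 0
      \<longleftrightarrow> has_bochner_integral (return borel (0::real)) (\<lambda>x. 0) (0::real)"
    by (intro has_bochner_integral_cong_AE) auto
  then show ?thesis using True by (simp add: centered_normal_def has_bochner_integral_zero)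
next
  case False
  then have "\<sigma> > 0" using assms by simp
  from normal_moment_even[OF this, of 0 1] this show ?thesis
    unfolding centered_normal_def by (simp add: has_bochner_integral_density fact_numeral)
qed

text \<open>
  Shifting the density to mean \<open>\<plusminus>\<epsilon>\<close> costs a factor \<open>exp (- \<epsilon>\<^sup>2 / (2 \<sigma>\<^sup>2))\<close> on the corresponding half-line,
  because \<open>x\<^sup>2 \<ge> \<epsilon>\<^sup>2 + (x \<mp> \<epsilon>)\<^sup>2\<close> there. The shifted density has total mass 1.
\<close>

lemma centered_normal_tail:
  assumes "0 \<le> \<sigma>" "0 < \<epsilon>" and v: "\<sigma>\<^sup>2 \<le> v"
  shows "measure (centered_normal \<sigma>) {x. \<epsilon> < \<bar>x\<bar>} \<le> 2 * exp (- (\<epsilon>\<^sup>2 / (2 * v)))"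
proof (cases "\<sigma> = 0")
  case True
  then show ?thesis using assms(2) by (simp add: centered_normal_def measure_return)
next
  case False
  then have pos: "\<sigma> > 0" using assms by simp
  define E where "E = exp (- (\<epsilon>\<^sup>2 / (2 * \<sigma>\<^sup>2)))"
  interpret prob_space "density lborel (normal_density \<mu> \<sigma>)" for \<mu>
    by (rule prob_space_normal_density[OF pos])
  have key: "normal_density 0 \<sigma> x \<le> E * normal_density \<mu> \<sigma> x" if "\<bar>\<mu>\<bar> = \<epsilon>" "\<mu> * x \<ge> \<epsilon>\<^sup>2" for x \<mu>
  proof -
    have "\<mu>\<^sup>2 = \<epsilon>\<^sup>2" using that(1) by (metis power2_abs)
    then have "(x - 0)\<^sup>2 \<ge> \<epsilon>\<^sup>2 + (x - \<mu>)\<^sup>2" using that(2)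
      by (simp add: power2_eq_square algebra_simps)
    then have "- (x - 0)\<^sup>2 / (2 * \<sigma>\<^sup>2) \<le> - (\<epsilon>\<^sup>2 / (2 * \<sigma>\<^sup>2)) + - (x - \<mu>)\<^sup>2 / (2 * \<sigma>\<^sup>2)"
      using pos by (simp add: field_simps)
    then have "exp (- (x - 0)\<^sup>2 / (2 * \<sigma>\<^sup>2)) \<le> E * exp (- (x - \<mu>)\<^sup>2 / (2 * \<sigma>\<^sup>2))"
      unfolding E_def exp_add[symmetric] by simp
    then have "1 / sqrt (2 * pi * \<sigma>\<^sup>2) * exp (- (x - 0)\<^sup>2 / (2 * \<sigma>\<^sup>2))
        \<le> 1 / sqrt (2 * pi * \<sigma>\<^sup>2) * (E * exp (- (x - \<mu>)\<^sup>2 / (2 * \<sigma>\<^sup>2)))"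
      by (rule mult_left_mono) simp
    then show ?thesis by (simp add: normal_density_def mult_ac)
  qed
  have half: "measure (density lborel (normal_density 0 \<sigma>)) A \<le> E"
    if A: "A \<in> sets borel" "\<bar>\<mu>\<bar> = \<epsilon>" "\<And>x. x \<in> A \<Longrightarrow> \<mu> * x \<ge> \<epsilon>\<^sup>2" for A \<mu>
  proof -
    have "emeasure (density lborel (normal_density 0 \<sigma>)) A = (\<integral>\<^sup>+x\<in>A. normal_density 0 \<sigma> x \<partial>lborel)"
      using A by (simp add: emeasure_density)
    also have "\<dots> \<le> (\<integral>\<^sup>+x. ennreal E * normal_density \<mu> \<sigma> x \<partial>lborel)"
    proof (rule nn_integral_mono)
      fix x
      have "0 \<le> E" by (simp add: E_def)
      then show "ennreal (normal_density 0 \<sigma> x) * indicator A x \<le> ennreal E * normal_density \<mu> \<sigma> x"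
        using key[of \<mu> x] A by (auto simp: indicator_def ennreal_mult[symmetric] intro!: ennreal_leI)
    qed
    also have "\<dots> = ennreal E * emeasure (density lborel (normal_density \<mu> \<sigma>)) UNIV"
      by (simp add: emeasure_density nn_integral_cmult)
    also have "\<dots> = ennreal E" using emeasure_space_1 by simp
    finally show ?thesis by (simp add: emeasure_eq_measure E_def)
  qed
  have "measure (density lborel (normal_density 0 \<sigma>)) {x. \<epsilon> < \<bar>x\<bar>}
      \<le> measure (density lborel (normal_density 0 \<sigma>)) ({\<epsilon><..} \<union> {..<-\<epsilon>})"
    by (rule finite_measure_mono) auto
  also have "\<dots> \<le> measure (density lborel (normal_density 0 \<sigma>)) {\<epsilon><..} + measure (density lborel (normal_density 0 \<sigma>)) {..<-\<epsilon>}"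
    by (rule measure_Un_le) auto
  also have "\<dots> \<le> E + E"
  proof (rule add_mono)
    show "measure (density lborel (normal_density 0 \<sigma>)) {\<epsilon><..} \<le> E"
      using assms(2) by (intro half[of _ \<epsilon>]) (auto simp: power2_eq_square)
    show "measure (density lborel (normal_density 0 \<sigma>)) {..<-\<epsilon>} \<le> E"
    proof (rule half[of _ "-\<epsilon>"])
    fix x assume "x \<in> {..<-\<epsilon>}"
    then show "- \<epsilon> * x \<ge> \<epsilon>\<^sup>2"
      using mult_left_mono[of \<epsilon> "- x" \<epsilon>] assms(2) by (simp add: power2_eq_square)
    qed (use assms(2) in auto)
  qed
  also have "\<dots> \<le> 2 * exp (- (\<epsilon>\<^sup>2 / (2 * v)))"
    using v pos by (simp add: E_def frac_le)
  finally show ?thesis using False by (simp add: centered_normal_def)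
qed

text \<open>
  A Cholesky factor has finite rows, so each value of the field is a finite linear combination of the
  noise variables and no limit of random variables is needed.
\<close>

lemma ex_gaussian_field:
  fixes K :: "'i::countable \<Rightarrow> 'i \<Rightarrow> real"
  assumes K: "psd K" and sym: "\<And>i j. K i j = K j i"
  shows "\<exists>X :: 'i \<Rightarrow> (nat \<Rightarrow> real) \<Rightarrow> real. (\<forall>i. X i \<in> borel_measurable white_noise) \<and>
    (\<forall>J a. finite J \<longrightarrow> distr white_noise borel (\<lambda>\<omega>. \<Sum>i\<in>J. a i * X i \<omega>)
        = centered_normal (sqrt (\<Sum>i\<in>J. \<Sum>j\<in>J. a i * a j * K i j)))"
proof -
  define K' where "K' = (\<lambda>m n. K (from_nat m) (from_nat n))"
  have K': "psd K'" "\<And>i j. K' i j = K' j i"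
    unfolding K'_def using psd_pullback[OF K] sym by auto
  define L where "L = (\<lambda>i. cholesky K' (to_nat (i::'i)))"
  define X where "X = (\<lambda>i (\<omega>::nat \<Rightarrow> real). \<Sum>k\<le>to_nat (i::'i). L i k * \<omega> k)"
  have X_eq: "X i \<omega> = (\<Sum>k<n. L i k * \<omega> k)" if "to_nat i < n" for i n \<omega>
    unfolding X_def using that
    by (intro sum.mono_neutral_left) (auto simp: L_def not_le intro: cholesky_eq_0[OF K'])
  have "distr white_noise borel (\<lambda>\<omega>. \<Sum>i\<in>J. a i * X i \<omega>)
        = centered_normal (sqrt (\<Sum>i\<in>J. \<Sum>j\<in>J. a i * a j * K i j))" if J: "finite J" for J a
  proof -
    define n where "n = Suc (Max (to_nat ` J))"
    have n: "to_nat i < n" if "i \<in> J" for i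
      unfolding n_def using J that by (simp add: less_Suc_eq_le)
    have "(\<Sum>i\<in>J. a i * X i \<omega>) = (\<Sum>k<n. (\<Sum>i\<in>J. a i * L i k) * \<omega> k)" for \<omega>
    proof -
      have "(\<Sum>i\<in>J. a i * X i \<omega>) = (\<Sum>i\<in>J. \<Sum>k<n. a i * L i k * \<omega> k)"
        by (intro sum.cong refl) (simp add: X_eq[OF n] sum_distrib_left mult_ac)
      then show ?thesis by (subst (asm) sum.swap) (simp add: sum_distrib_right)
    qed
    moreover have "(\<Sum>k<n. (\<Sum>i\<in>J. a i * L i k)\<^sup>2) = (\<Sum>i\<in>J. \<Sum>j\<in>J. a i * a j * K i j)"
    proof -
      have "(\<Sum>k<n. (\<Sum>i\<in>J. a i * L i k)\<^sup>2) = (\<Sum>k<n. \<Sum>i\<in>J. \<Sum>j\<in>J. a i * a j * (L i k * L j k))"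
        by (simp add: power2_eq_square sum_product mult_ac)
      also have "\<dots> = (\<Sum>i\<in>J. \<Sum>j\<in>J. \<Sum>k<n. a i * a j * (L i k * L j k))"
        by (subst sum.swap, intro sum.cong refl, subst sum.swap) simp
      also have "\<dots> = (\<Sum>i\<in>J. \<Sum>j\<in>J. a i * a j * K i j)"
      proof (intro sum.cong refl)
        fix i j assume "i \<in> J"
        have "K i j = K' (to_nat i) (to_nat j)" by (simp add: K'_def)
        also have "\<dots> = (\<Sum>k<n. L i k * L j k)"
          unfolding L_def using n[OF \<open>i \<in> J\<close>] by (rule cholesky_factorization[OF K'])
        finally show "(\<Sum>k<n. a i * a j * (L i k * L j k)) = a i * a j * K i j"
          by (simp add: sum_distrib_left)
      qed
      finally show ?thesis .
    qed
    ultimately show ?thesis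
      using linear_combination_white_noise[of "\<lambda>k. \<Sum>i\<in>J. a i * L i k" n] by simp
  qed
  moreover have "X i \<in> borel_measurable white_noise" for i
    unfolding X_def by measurable
  ultimately show ?thesis by blast
qed


section \<open>Transition probabilities of the two walks\<close>

text \<open>
  The recursion decomposes at the first step, since shifting the sample sequence by one step
  preserves the law of the walk.
\<close>

primrec walk_kernel :: "(int ^ 'd \<Rightarrow> int ^ 'd) \<Rightarrow> nat \<Rightarrow> int ^ 'd \<Rightarrow> int ^ 'd::finite \<Rightarrow> real" where
  "walk_kernel p 0 x y = of_bool (x = y)"
| "walk_kernel p (Suc k) x y =
     (\<Sum>u\<in>UNIV. walk_kernel p k (p (x + unit_step u)) y) / (2 * real CARD('d))"

lemma walk_kernel_nonneg: "0 \<le> walk_kernel p k x y"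
  by (induction k arbitrary: x) (auto intro!: divide_nonneg_nonneg sum_nonneg)

definition poisson_weight :: "real \<Rightarrow> nat \<Rightarrow> real" where
  "poisson_weight t k = (if t < 0 then 0 else exp (- t) * t ^ k / fact k)"

lemma poisson_weight_nonneg: "0 \<le> poisson_weight t k"
  by (simp add: poisson_weight_def)

lemma poisson_weight_sums_1: "0 \<le> t \<Longrightarrow> poisson_weight t sums 1"
  using sums_mult[OF exp_converges[of t], of "exp (- t)"]
  by (simp add: poisson_weight_def[abs_def] divide_inverse mult_ac exp_minus_inverse scaleR_conv_of_real)

abbreviation step_measure :: "('d::finite \<times> bool) measure" where
  "step_measure \<equiv> measure_pmf (pmf_of_set UNIV)"

abbreviation holding_measure :: "real measure" where
  "holding_measure \<equiv> density lborel (exponential_density 1)"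

lemma prob_space_holding: "prob_space holding_measure"
  by (rule prob_space_exponential_density) simp

lemma sequence_space_walk:
  "sequence_space ((step_measure :: ('d::finite \<times> bool) measure) \<Otimes>\<^sub>M holding_measure)"
proof -
  interpret A: prob_space "step_measure :: ('d \<times> bool) measure" by (rule prob_space_measure_pmf)
  interpret B: prob_space holding_measure by (rule prob_space_holding)
  interpret pair_prob_space "step_measure :: ('d \<times> bool) measure" holding_measure ..
  show ?thesis unfolding sequence_space_def
    by (rule product_prob_spaceI) (rule prob_space_axioms)
qed

lemma prob_space_walk_space: "prob_space (walk_space :: 'd::finite walk_sample measure)"
proof -
  interpret sequence_space "(step_measure :: ('d \<times> bool) measure) \<Otimes>\<^sub>M holding_measure"
    by (rule sequence_space_walk)
  show ?thesis unfolding walk_space_def by (rule prob_space_axioms)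
qed

lemma space_walk_space [simp]: "space walk_space = UNIV"
  by (simp add: walk_space_def space_PiM space_pair_measure)

lemma sets_walk_space:
  "sets (walk_space :: 'd::finite walk_sample measure) = sets (PiM UNIV (\<lambda>_. count_space UNIV \<Otimes>\<^sub>M borel))"
  unfolding walk_space_def by (intro sets_PiM_cong sets_pair_measure_cong) auto

lemma measurable_direction [measurable]: "(\<lambda>\<omega>. fst (\<omega> k)) \<in> measurable walk_space (count_space UNIV)"
  unfolding measurable_cong_sets[OF sets_walk_space refl] by measurable

lemma measurable_holding [measurable]: "(\<lambda>\<omega>. snd (\<omega> k)) \<in> borel_measurable walk_space"
  unfolding measurable_cong_sets[OF sets_walk_space refl] by measurable

lemma measurable_jump_time [measurable]: "(\<lambda>\<omega>. jump_time \<omega> k) \<in> borel_measurable walk_space"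
  unfolding jump_time_def by measurable

lemma measurable_walk [measurable]: "(\<lambda>\<omega>. walk p x \<omega> k) \<in> measurable walk_space (count_space UNIV)"
proof (induction k)
  case (Suc k)
  have "(\<lambda>\<omega>. p (z + unit_step (fst (\<omega> k)))) \<in> measurable walk_space (count_space UNIV)" for z
    by (rule measurable_compose[OF measurable_direction]) simp
  from measurable_compose_countable[OF this Suc] show ?case by simp
qed simp

lemma walk_shift:
  "walk p x (case_nat s \<omega>) (Suc k) = walk p (p (x + unit_step (fst s))) \<omega> k"
  by (induction k) auto

lemma jump_time_shift: "jump_time (case_nat s \<omega>) (Suc k) = snd s + jump_time \<omega> k"
  unfolding jump_time_def by (subst sum.lessThan_Suc_shift) simp

text \<open>
  Independence of the first step from the later ones, the only form in which independence enters.
\<close>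

lemma emeasure_walk_space_shift:
  fixes A :: "'d::finite walk_sample set"
  assumes A: "A \<in> sets walk_space"
  shows "emeasure walk_space A = (\<Sum>u\<in>UNIV.
    \<integral>\<^sup>+ \<tau>. emeasure walk_space {\<omega>. case_nat (u, \<tau>) \<omega> \<in> A} \<partial>holding_measure) / (2 * CARD('d))"
proof -
  let ?D = "step_measure :: ('d \<times> bool) measure"
  interpret sequence_space "?D \<Otimes>\<^sub>M holding_measure"
    by (rule sequence_space_walk)
  interpret W: prob_space "walk_space :: 'd walk_sample measure" by (rule prob_space_walk_space)
  interpret H: prob_space holding_measure by (rule prob_space_holding)
  have W: "walk_space = S" by (simp add: walk_space_def)
  have [measurable]: "A \<in> sets S" using A by (simp add: W)
  define B where "B = (\<lambda>(s, \<omega>). case_nat s \<omega>) -` A \<inter> space ((?D \<Otimes>\<^sub>M holding_measure) \<Otimes>\<^sub>M S)"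
  have B [measurable]: "B \<in> sets ((?D \<Otimes>\<^sub>M holding_measure) \<Otimes>\<^sub>M S)"
    unfolding B_def by measurable
  have sec: "Pair s -` B = {\<omega>. case_nat s \<omega> \<in> A}" for s
    by (auto simp: B_def space_pair_measure space_PiM)
  have meas: "(\<lambda>s. emeasure S (Pair s -` B)) \<in> borel_measurable (?D \<Otimes>\<^sub>M holding_measure)"
    using W.measurable_emeasure_Pair[unfolded W, OF B] .
  have "emeasure walk_space A = emeasure (distr ((?D \<Otimes>\<^sub>M holding_measure) \<Otimes>\<^sub>M S) S (\<lambda>(s, \<omega>). case_nat s \<omega>)) A"
    unfolding PiM_iter W ..
  also have "\<dots> = emeasure ((?D \<Otimes>\<^sub>M holding_measure) \<Otimes>\<^sub>M S) B"
    unfolding B_def by (rule emeasure_distr) auto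
  also have "\<dots> = (\<integral>\<^sup>+ s. emeasure S (Pair s -` B) \<partial>(?D \<Otimes>\<^sub>M holding_measure))"
    using W.emeasure_pair_measure_alt[unfolded W, OF B] .
  also have "\<dots> = (\<integral>\<^sup>+ u. \<integral>\<^sup>+ \<tau>. emeasure S (Pair (u, \<tau>) -` B) \<partial>holding_measure \<partial>?D)"
    by (rule H.nn_integral_fst[symmetric, OF meas])
  also have "\<dots> = (\<Sum>u\<in>UNIV. \<integral>\<^sup>+ \<tau>. emeasure S (Pair (u, \<tau>) -` B) \<partial>holding_measure) / (2 * CARD('d))"
    by (subst nn_integral_pmf_of_set) (auto simp: card_cartesian_product UNIV_Times_UNIV[symmetric]
        mult.commute simp del: UNIV_Times_UNIV)
  finally show ?thesis by (simp add: sec W)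
qed

lemma sum_divide_ennreal:
  assumes "\<And>u. u \<in> A \<Longrightarrow> f u = ennreal (g u)" "\<And>u. u \<in> A \<Longrightarrow> 0 \<le> g u" "c > 0"
  shows "(\<Sum>u\<in>A. f u) / of_nat c = ennreal ((\<Sum>u\<in>A. g u) / real c)"
proof -
  have "(\<Sum>u\<in>A. f u) = ennreal (\<Sum>u\<in>A. g u)"
    using assms by (simp add: sum_ennreal)
  then show ?thesis
    using assms by (simp add: divide_ennreal sum_nonneg ennreal_of_nat_eq_real_of_nat)
qed

lemma emeasure_walk:
  fixes x :: "int ^ 'd::finite"
  shows "emeasure walk_space {\<omega>. walk p x \<omega> k = y} = ennreal (walk_kernel p k x y)"
proof (induction k arbitrary: x)
  case 0
  interpret prob_space "walk_space :: 'd walk_sample measure" by (rule prob_space_walk_space)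
  show ?case using emeasure_space_1 by simp
next
  case (Suc k)
  interpret H: prob_space holding_measure by (rule prob_space_holding)
  have "{\<omega>. walk p x \<omega> (Suc k) = y} = {\<omega>\<in>space walk_space. walk p x \<omega> (Suc k) = y}" by simp
  also have "\<dots> \<in> sets walk_space" by measurable
  finally have S: "{\<omega>. walk p x \<omega> (Suc k) = y} \<in> sets walk_space" .
  have *: "(\<integral>\<^sup>+ \<tau>. ennreal c \<partial>holding_measure) = ennreal c" for c
    using H.emeasure_space_1 by simp
  have "of_nat (2 * CARD('d)) = (2 * of_nat CARD('d) :: ennreal)" by simp
  then show ?case
    unfolding emeasure_walk_space_shift[OF S] mem_Collect_eq walk_shift Suc.IH * walk_kernel.simps
    using sum_divide_ennreal[of UNIV "\<lambda>u. ennreal (walk_kernel p k (p (x + unit_step u)) y)"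
      "\<lambda>u. walk_kernel p k (p (x + unit_step u)) y" "2 * CARD('d)"]
    using H.emeasure_space_1 by (simp add: walk_kernel_nonneg)
qed

lemma nn_integral_poisson_weight:
  "(\<integral>\<^sup>+ \<tau>. ennreal (poisson_weight (t - \<tau>) k) \<partial>holding_measure) = ennreal (poisson_weight t (Suc k))"
proof (cases "t < 0")
  case True
  have "(\<integral>\<^sup>+ \<tau>. ennreal (poisson_weight (t - \<tau>) k) \<partial>holding_measure)
      = (\<integral>\<^sup>+ \<tau>. ennreal (exponential_density 1 \<tau>) * ennreal (poisson_weight (t - \<tau>) k) \<partial>lborel)"
    by (subst nn_integral_density) (auto simp: poisson_weight_def[abs_def])
  also have "\<dots> = (\<integral>\<^sup>+ \<tau>. 0 \<partial>(lborel :: real measure))"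
    using True by (intro nn_integral_cong) (auto simp: poisson_weight_def exponential_density_def)
  finally show ?thesis using True by (simp add: poisson_weight_def)
next
  case False
  let ?F = "\<lambda>\<tau>. - (exp (- t) * (t - \<tau>) ^ Suc k / fact (Suc k))"
  have "(\<integral>\<^sup>+ \<tau>. ennreal (poisson_weight (t - \<tau>) k) \<partial>holding_measure)
      = (\<integral>\<^sup>+ \<tau>. ennreal (exponential_density 1 \<tau>) * ennreal (poisson_weight (t - \<tau>) k) \<partial>lborel)"
    by (subst nn_integral_density) (auto simp: poisson_weight_def[abs_def])
  also have "\<dots> = (\<integral>\<^sup>+ \<tau>. ennreal (exp (- t) * (t - \<tau>) ^ k / fact k) * indicator {0..t} \<tau> \<partial>lborel)"
    using False by (intro nn_integral_cong)
      (auto simp: poisson_weight_def exponential_density_def indicator_def ennreal_mult[symmetric]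
        exp_diff exp_minus field_simps)
  also have "\<dots> = ennreal (?F t - ?F 0)"
  proof (rule nn_integral_FTC_Icc)
    fix \<tau> assume "\<tau> \<in> {0..t}"
    have "((\<lambda>\<tau>. (t - \<tau>) ^ Suc k) has_real_derivative (1 + real k) * (- 1 * (t - \<tau>) ^ k)) (at \<tau>)"
      by (rule DERIV_power_Suc) (auto intro!: derivative_eq_intros)
    from DERIV_cmult[OF this, of "- (exp (- t) / fact (Suc k))"]
    have "((\<lambda>\<tau>. ?F \<tau>) has_real_derivative
        - (exp (- t) / fact (Suc k)) * ((1 + real k) * (- 1 * (t - \<tau>) ^ k))) (at \<tau>)"
      by simp
    also have "- (exp (- t) / fact (Suc k)) * ((1 + real k) * (- 1 * (t - \<tau>) ^ k)) = exp (- t) * (t - \<tau>) ^ k / fact k"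
      by (simp add: divide_simps del: of_nat_Suc)
    finally show "(?F has_real_derivative exp (- t) * (t - \<tau>) ^ k / fact k) (at \<tau>)" .
  qed (use False in auto)
  also have "?F t - ?F 0 = poisson_weight t (Suc k)"
    using False by (simp add: poisson_weight_def)
  finally show ?thesis .
qed

lemma emeasure_holding_gt:
  assumes "0 \<le> t"
  shows "emeasure holding_measure {t<..} = ennreal (exp (- t))"
proof -
  interpret H: prob_space holding_measure by (rule prob_space_holding)
  have "distributed holding_measure lborel (\<lambda>x. x) (exponential_density 1)"
    by (auto simp: distributed_def distr_id2)
  from H.exponential_distributedD_gt[OF this, of t] assms
  have "measure holding_measure {x. t < x} = exp (- t)" by simp
  then show ?thesis by (simp add: H.emeasure_eq_measure greaterThan_def)
qed

text \<open>
  The event on the left says that the walk has made exactly \<open>k\<close> jumps by time \<open>t\<close> and sits at \<open>y\<close>.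
  Conditioning on the first jump and its time turns both factors into their values for \<open>k + 1\<close>; in
  particular the number of jumps is Poisson distributed and independent of the trajectory.
\<close>

lemma emeasure_walk_at_time:
  fixes x :: "int ^ 'd::finite"
  shows "emeasure walk_space {\<omega>. walk p x \<omega> k = y \<and> jump_time \<omega> k \<le> t \<and> t < jump_time \<omega> (Suc k)}
    = ennreal (walk_kernel p k x y * poisson_weight t k)"
proof (induction k arbitrary: x t)
  case 0
  interpret W: prob_space "walk_space :: 'd walk_sample measure" by (rule prob_space_walk_space)
  show ?case
  proof (cases "x = y \<and> 0 \<le> t")
    case True
    have "{\<omega> :: 'd walk_sample. t < snd (\<omega> 0)} = {\<omega>\<in>space walk_space. t < snd (\<omega> 0)}" by simp
    also have "\<dots> \<in> sets walk_space" by measurable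
    finally have S: "{\<omega> :: 'd walk_sample. t < snd (\<omega> 0)} \<in> sets walk_space" .
    have "emeasure walk_space {\<omega> :: 'd walk_sample. t < (if True then \<tau> else snd (\<omega> 0))}
        = indicator {t<..} \<tau>" for \<tau>
      using W.emeasure_space_1 by (auto simp: indicator_def)
    then have "emeasure walk_space {\<omega> :: 'd walk_sample. t < snd (\<omega> 0)} = (\<Sum>u\<in>(UNIV :: ('d \<times> bool) set). ennreal (exp (- t))) / of_nat (2 * CARD('d))"
      using True by (subst emeasure_walk_space_shift[OF S]) (simp add: emeasure_holding_gt)
    also have "\<dots> = ennreal ((\<Sum>u\<in>(UNIV :: ('d \<times> bool) set). exp (- t)) / real (2 * CARD('d)))"
      by (rule sum_divide_ennreal) auto
    finally show ?thesis using True
      by (simp add: poisson_weight_def jump_time_def card_cartesian_product UNIV_Times_UNIV[symmetric]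
          del: UNIV_Times_UNIV)
  qed (auto simp: poisson_weight_def jump_time_def)
next
  case (Suc k)
  interpret H: prob_space holding_measure by (rule prob_space_holding)
  let ?A = "\<lambda>k x t. {\<omega>. walk p x \<omega> k = y \<and> jump_time \<omega> k \<le> t \<and> t < jump_time \<omega> (Suc k)}"
  have "?A (Suc k) x t = {\<omega>\<in>space walk_space. walk p x \<omega> (Suc k) = y \<and> jump_time \<omega> (Suc k) \<le> t \<and> t < jump_time \<omega> (Suc (Suc k))}" by simp
  also have "\<dots> \<in> sets walk_space" by measurable
  finally have S: "?A (Suc k) x t \<in> sets walk_space" .
  have shift: "{\<omega>. case_nat (u, \<tau>) \<omega> \<in> ?A (Suc k) x t} = ?A k (p (x + unit_step u)) (t - \<tau>)" for u \<tau>
    by (auto simp: walk_shift jump_time_shift simp del: walk.simps)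
  have int: "(\<integral>\<^sup>+ \<tau>. ennreal (c * poisson_weight (t - \<tau>) k) \<partial>holding_measure) = ennreal (c * poisson_weight t (Suc k))"
    if "c \<ge> 0" for c
  proof -
    have "(\<lambda>\<tau>. ennreal (poisson_weight (t - \<tau>) k)) \<in> borel_measurable holding_measure"
      by (auto simp: poisson_weight_def[abs_def])
    then show ?thesis
      using that by (simp add: ennreal_mult poisson_weight_nonneg nn_integral_cmult nn_integral_poisson_weight)
  qed
  have two: "of_nat (2 * CARD('d)) = (2 * of_nat CARD('d) :: ennreal)" by simp
  have "emeasure walk_space (?A (Suc k) x t) = (\<Sum>u\<in>UNIV. ennreal (walk_kernel p k (p (x + unit_step u)) y * poisson_weight t (Suc k))) / of_nat (2 * CARD('d))"
    unfolding emeasure_walk_space_shift[OF S] shift Suc.IH int[OF walk_kernel_nonneg] ..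
  also have "\<dots> = ennreal ((\<Sum>u\<in>UNIV. walk_kernel p k (p (x + unit_step u)) y * poisson_weight t (Suc k)) / real (2 * CARD('d)))"
    by (rule sum_divide_ennreal) (auto simp: walk_kernel_nonneg poisson_weight_nonneg)
  finally show ?case by (simp add: sum_distrib_right)
qed

lemma AE_holding_nonneg: "AE \<omega> in (walk_space :: 'd::finite walk_sample measure). \<forall>k. 0 \<le> snd (\<omega> k)"
  unfolding AE_all_countable
proof
  fix k
  let ?D = "step_measure :: ('d \<times> bool) measure"
  interpret A: prob_space ?D by (rule prob_space_measure_pmf)
  interpret H: prob_space holding_measure by (rule prob_space_holding)
  interpret pair_prob_space ?D holding_measure ..
  have "AE \<tau> in holding_measure. 0 \<le> \<tau>"
    by (subst AE_density) (auto simp: exponential_density_def)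
  then have "AE s in ?D \<Otimes>\<^sub>M holding_measure. 0 \<le> snd s"
    by (intro AE_pair_measure) auto
  then show "AE \<omega> in (walk_space :: 'd walk_sample measure). 0 \<le> snd (\<omega> k)"
    unfolding walk_space_def by (intro AE_PiM_component prob_space_axioms) auto
qed

lemma jump_time_mono:
  assumes "\<forall>k. 0 \<le> snd (\<omega> k)" "i \<le> j"
  shows "jump_time \<omega> i \<le> jump_time \<omega> j"
  unfolding jump_time_def using assms by (intro sum_mono2) auto

text \<open>
  The Poisson weights sum to 1, so almost surely exactly one number of jumps occurs by time \<open>t\<close> and
  the walk does not explode.
\<close>

lemma AE_jump_time_exceeds:
  assumes "0 \<le> t"
  shows "AE \<omega> in (walk_space :: 'd::finite walk_sample measure). \<exists>k. t < jump_time \<omega> (Suc k)"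
proof -
  interpret W: prob_space "walk_space :: 'd walk_sample measure" by (rule prob_space_walk_space)
  define A :: "nat \<Rightarrow> 'd walk_sample set"
    where "A = (\<lambda>k. {\<omega>. (\<forall>k. 0 \<le> snd (\<omega> k)) \<and> jump_time \<omega> k \<le> t \<and> t < jump_time \<omega> (Suc k)})"
  have "A k = {\<omega>\<in>space walk_space. (\<forall>k. 0 \<le> snd (\<omega> k)) \<and> jump_time \<omega> k \<le> t \<and> t < jump_time \<omega> (Suc k)}" for k
    by (simp add: A_def)
  also have "\<dots> k \<in> sets walk_space" for k by measurable
  finally have A: "A k \<in> sets walk_space" for k .
  \<comment> \<open>the walk that is projected to one point exhibits the number of jumps alone\<close>
  have const: "walk (\<lambda>_. 0) 0 \<omega> k = 0" "walk_kernel (\<lambda>_. 0) k 0 (0 :: int ^ 'd) = 1" for \<omega> k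
    by (induction k) (auto simp: card_cartesian_product UNIV_Times_UNIV[symmetric] simp del: UNIV_Times_UNIV)
  have "emeasure walk_space (A k) = emeasure walk_space
      {\<omega> :: 'd walk_sample. walk (\<lambda>_. 0) 0 \<omega> k = 0 \<and> jump_time \<omega> k \<le> t \<and> t < jump_time \<omega> (Suc k)}" for k
  proof (rule emeasure_eq_AE)
    show "AE \<omega> in walk_space. (\<omega> \<in> A k) = (\<omega> \<in> {\<omega> :: 'd walk_sample. walk (\<lambda>_. 0) 0 \<omega> k = 0 \<and> jump_time \<omega> k \<le> t \<and> t < jump_time \<omega> (Suc k)})"
      using AE_holding_nonneg by eventually_elim (simp add: A_def const)
    have "{\<omega> :: 'd walk_sample. jump_time \<omega> k \<le> t \<and> t < jump_time \<omega> (Suc k)} = {\<omega>\<in>space walk_space. jump_time \<omega> k \<le> t \<and> t < jump_time \<omega> (Suc k)}" by simp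
    also have "\<dots> \<in> sets walk_space" by measurable
    finally show "{\<omega> :: 'd walk_sample. walk (\<lambda>_. 0) 0 \<omega> k = 0 \<and> jump_time \<omega> k \<le> t \<and> t < jump_time \<omega> (Suc k)} \<in> sets walk_space"
      by (simp add: const)
  qed (rule A)
  then have prob: "measure walk_space (A k) = poisson_weight t k" for k
    using emeasure_walk_at_time[of "\<lambda>_. 0" "0 :: int ^ 'd" k 0 t]
    by (simp add: const measure_def poisson_weight_nonneg)
  have "disjoint_family A"
  proof -
    have "A i \<inter> A j = {}" if "i < j" for i j
    proof -
      have "False" if \<omega>: "\<omega> \<in> A i" "\<omega> \<in> A j" for \<omega>
        using jump_time_mono[of \<omega> "Suc i" j] \<omega> \<open>i < j\<close> by (auto simp: A_def)
      then show ?thesis by blast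
    qed
    then show ?thesis
      unfolding disjoint_family_on_def by (metis Int_commute linorder_neqE_nat)
  qed
  from W.finite_measure_UNION[OF _ this] A have "poisson_weight t sums measure walk_space (\<Union>k. A k)"
    by (auto simp: prob image_subset_iff)
  with poisson_weight_sums_1[OF assms] have "measure walk_space (\<Union>k. A k) = 1"
    by (rule sums_unique2[symmetric])
  then have "AE \<omega> in walk_space. \<omega> \<in> (\<Union>k. A k)"
    using A by (subst W.AE_in_set_eq_1) auto
  then show ?thesis by eventually_elim (auto simp: A_def)
qed

lemma prob_cts_walk:
  fixes x :: "int ^ 'd::finite"
  assumes t: "0 \<le> t"
  shows "(\<lambda>k. walk_kernel p k x y * poisson_weight t k) sums \<P>(\<omega> in walk_space. cts_walk p x \<omega> t = y)"
proof -
  interpret W: prob_space "walk_space :: 'd walk_sample measure" by (rule prob_space_walk_space)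
  \<comment> \<open>the events \<open>C k\<close> are disjoint everywhere, their analogues with jump times only almost surely\<close>
  define C where "C = (\<lambda>k. {\<omega>\<in>space walk_space. (LEAST k. t < jump_time \<omega> (Suc k)) = k \<and> walk p x \<omega> k = y})"
  have C: "C k \<in> sets walk_space" for k unfolding C_def by measurable
  have "disjoint_family C" by (auto simp: disjoint_family_on_def C_def)
  from W.finite_measure_UNION[OF _ this] C
  have "(\<lambda>k. measure walk_space (C k)) sums measure walk_space (\<Union>k. C k)"
    by (simp add: image_subset_iff)
  moreover have "(\<Union>k. C k) = {\<omega>\<in>space walk_space. cts_walk p x \<omega> t = y}"
    by (auto simp: C_def cts_walk_def)
  moreover have "measure walk_space (C k) = walk_kernel p k x y * poisson_weight t k" for k
  proof -
    let ?A = "{\<omega>\<in>space walk_space. walk p x \<omega> k = y \<and> jump_time \<omega> k \<le> t \<and> t < jump_time \<omega> (Suc k)}"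
    have "emeasure walk_space (C k) = emeasure walk_space ?A"
    proof (rule emeasure_eq_AE)
      show "?A \<in> sets walk_space" by measurable
      show "AE \<omega> in walk_space. (\<omega> \<in> C k) = (\<omega> \<in> ?A)"
        using AE_holding_nonneg AE_jump_time_exceeds[OF t]
      proof eventually_elim
        case (elim \<omega>)
        let ?P = "\<lambda>k. t < jump_time \<omega> (Suc k)"
        have "(LEAST k. ?P k) = k \<longleftrightarrow> jump_time \<omega> k \<le> t \<and> ?P k"
        proof
          assume L: "(LEAST k. ?P k) = k"
          then have "?P k" using LeastI_ex[of ?P] elim(2) by simp
          moreover have "jump_time \<omega> k \<le> t"
          proof (cases k)
            case 0
            then show ?thesis using t by (simp add: jump_time_def)
          next
            case (Suc j)
            then show ?thesis using not_less_Least[of j ?P] L by simp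
          qed
          ultimately show "jump_time \<omega> k \<le> t \<and> ?P k" by simp
        next
          assume R: "jump_time \<omega> k \<le> t \<and> ?P k"
          show "(LEAST k. ?P k) = k"
          proof (rule Least_equality)
            fix j assume "?P j"
            then show "k \<le> j" using R jump_time_mono[OF elim(1), of "Suc j" k] by force
          qed (use R in simp)
        qed
        then show ?case by (auto simp: C_def)
      qed
    qed (rule C)
    then show ?thesis
      using emeasure_walk_at_time[of p x k y t]
      by (simp add: measure_def walk_kernel_nonneg poisson_weight_nonneg)
  qed
  ultimately show ?thesis by simp
qed


section \<open>Fourier series of the torus heat kernel\<close>

lemma proj_eq_iff: "proj N x = proj N y \<longleftrightarrow> (\<forall>i. int N dvd x $ i - y $ i)"
  by (simp add: proj_def vec_eq_iff mod_eq_dvd_iff)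

lemma proj_torus: "x \<in> torus N \<Longrightarrow> proj N x = x"
  by (simp add: proj_def torus_def vec_eq_iff)

lemma proj_in_torus: "N \<ge> 1 \<Longrightarrow> proj N x \<in> torus N"
  by (simp add: proj_def torus_def)

lemma proj_diff_cong: "proj N x = proj N y \<Longrightarrow> proj N (x - z) = proj N (y - z)"
  by (simp add: proj_eq_iff)

lemma proj_proj [simp]: "proj N (proj N x) = proj N x"
  by (simp add: proj_def)

lemma sum_torus_prod:
  fixes f :: "'d::finite \<Rightarrow> int \<Rightarrow> 'a::comm_semiring_1"
  shows "(\<Sum>\<theta>\<in>torus N. \<Prod>i\<in>UNIV. f i (\<theta> $ i)) = (\<Prod>i\<in>UNIV. \<Sum>j\<in>{0..<int N}. f i j)"
proof -
  have "(\<Prod>i\<in>UNIV. \<Sum>j\<in>{0..<int N}. f i j) = (\<Sum>g\<in>PiE UNIV (\<lambda>_. {0..<int N}). \<Prod>i\<in>UNIV. f i (g i))"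
    by (rule prod_sum_PiE) auto
  also have "\<dots> = (\<Sum>\<theta>\<in>torus N. \<Prod>i\<in>UNIV. f i (\<theta> $ i))"
    by (rule sum.reindex_bij_witness[where i = vec_nth and j = vec_lambda]) (auto simp: torus_def PiE_iff)
  finally show ?thesis ..
qed

lemma finite_torus: "finite (torus N :: (int ^ 'd::finite) set)"
proof -
  have "torus N \<subseteq> vec_lambda ` PiE (UNIV :: 'd set) (\<lambda>_. {0..<int N})"
  proof
    fix x :: "int ^ 'd" assume "x \<in> torus N"
    then have "vec_nth x \<in> PiE UNIV (\<lambda>_. {0..<int N})" by (auto simp: torus_def)
    then show "x \<in> vec_lambda ` PiE UNIV (\<lambda>_. {0..<int N})" by (metis image_eqI vec_nth_inverse)
  qed
  moreover have "finite (PiE (UNIV :: 'd set) (\<lambda>_. {0..<int N}))" by (intro finite_PiE) auto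
  ultimately show ?thesis by (meson finite_imageI finite_subset)
qed

lemma card_torus: "card (torus N :: (int ^ 'd::finite) set) = N ^ CARD('d)"
  using sum_torus_prod[where f = "\<lambda>_ :: 'd. \<lambda>_. 1 :: nat" and N = N] by simp

text \<open>
  Frequencies \<open>\<theta>\<close> range over the torus itself. The functions \<open>z \<mapsto> cos (phase N \<theta> z)\<close> are
  eigenfunctions of the torus walk with eigenvalue \<open>symbol N \<theta>\<close>.
\<close>

definition phase :: "nat \<Rightarrow> int ^ 'd \<Rightarrow> int ^ 'd::finite \<Rightarrow> real" where
  "phase N \<theta> z = 2 * pi * (\<Sum>i\<in>UNIV. real_of_int (\<theta> $ i) * real_of_int (z $ i)) / real N"

definition symbol :: "nat \<Rightarrow> int ^ 'd::finite \<Rightarrow> real" where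
  "symbol N \<theta> = (\<Sum>i\<in>UNIV. cos (2 * pi * real_of_int (\<theta> $ i) / real N)) / real CARD('d)"

text \<open>
  The \<open>k\<close>-step transition probability of the torus walk between two points with difference \<open>z\<close>, given
  by its Fourier series. It is defined for all lattice vectors \<open>z\<close> and periodic in them.
\<close>

definition torus_kernel :: "nat \<Rightarrow> nat \<Rightarrow> int ^ 'd::finite \<Rightarrow> real" where
  "torus_kernel N k z = (\<Sum>\<theta>\<in>torus N. symbol N \<theta> ^ k * cos (phase N \<theta> z)) / real N ^ CARD('d)"

primrec lattice_kernel :: "nat \<Rightarrow> int ^ 'd::finite \<Rightarrow> real" where
  "lattice_kernel 0 z = of_bool (z = 0)"
| "lattice_kernel (Suc k) z = (\<Sum>u\<in>UNIV. lattice_kernel k (z + unit_step u)) / (2 * real CARD('d))"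

lemma phase_add: "phase N \<theta> (z + w) = phase N \<theta> z + phase N \<theta> w"
  by (simp add: phase_def sum.distrib distrib_left add_divide_distrib)

lemma phase_minus: "phase N \<theta> (- z) = - phase N \<theta> z"
  by (simp add: phase_def sum_negf)

lemma phase_diff: "phase N \<theta> (z - w) = phase N \<theta> z - phase N \<theta> w"
  by (simp add: phase_def sum_subtractf right_diff_distrib diff_divide_distrib)

lemma phase_axis: "phase N \<theta> (axis i 1) = 2 * pi * real_of_int (\<theta> $ i) / real N"
proof -
  have "(\<Sum>j\<in>UNIV. real_of_int (\<theta> $ j) * real_of_int (axis i 1 $ j)) = (\<Sum>j\<in>UNIV. if j = i then real_of_int (\<theta> $ j) else 0)"
    by (intro sum.cong) (auto simp: axis_def)
  then show ?thesis by (simp add: phase_def)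
qed

lemma cos_phase_periodic:
  assumes "proj N z = proj N w" "N \<ge> 1"
  shows "cos (phase N \<theta> z) = cos (phase N \<theta> w)"
proof -
  from assms have "\<forall>i. \<exists>m. z $ i - w $ i = int N * m" by (auto simp: proj_eq_iff dvd_def)
  then obtain m where m: "\<And>i. z $ i - w $ i = int N * m i" by metis
  have "phase N \<theta> z = phase N \<theta> w + phase N \<theta> (z - w)" by (simp add: phase_diff)
  also have "phase N \<theta> (z - w) = 2 * pi * (real N * (\<Sum>i\<in>UNIV. real_of_int (\<theta> $ i * m i))) / real N"
    unfolding phase_def vector_minus_component m by (simp add: sum_distrib_left mult_ac)
  also have "\<dots> = 2 * pi * real_of_int (\<Sum>i\<in>UNIV. \<theta> $ i * m i)"
    using assms by simp
  finally show ?thesis by (simp add: cos_add cos_int_2pin sin_int_2pin del: of_int_sum of_int_mult)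
qed

lemma torus_kernel_cong:
  "proj N z = proj N w \<Longrightarrow> N \<ge> 1 \<Longrightarrow> torus_kernel N k z = torus_kernel N k w"
  unfolding torus_kernel_def
  by (intro arg_cong2[where f = "(/)"] sum.cong arg_cong2[where f = "(*)"] cos_phase_periodic refl)

lemma torus_kernel_minus: "torus_kernel N k (- z) = torus_kernel N k z"
  by (simp add: torus_kernel_def phase_minus)

lemma torus_kernel_sym: "torus_kernel N k (x - y) = torus_kernel N k (y - x)"
  using torus_kernel_minus[of N k "x - y"] by simp

lemma sum_unit_steps:
  fixes f :: "int ^ 'd::finite \<Rightarrow> real"
  shows "(\<Sum>u\<in>UNIV. f (unit_step u)) = (\<Sum>i\<in>UNIV. f (axis i 1) + f (- axis i 1))"
proof -
  have "(\<Sum>u\<in>UNIV. f (unit_step u)) = (\<Sum>i\<in>(UNIV :: 'd set). \<Sum>b\<in>(UNIV :: bool set). f (unit_step (i, b)))"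
    by (simp only: UNIV_Times_UNIV[symmetric] sum.cartesian_product) (simp add: case_prod_beta)
  then show ?thesis by (simp add: UNIV_bool unit_step_def add.commute)
qed

lemma torus_kernel_Suc:
  fixes z :: "int ^ 'd::finite"
  shows "torus_kernel N (Suc k) z = (\<Sum>u\<in>UNIV. torus_kernel N k (z + unit_step u)) / (2 * real CARD('d))"
proof -
  have "(\<Sum>u\<in>UNIV. cos (phase N \<theta> (z + unit_step u))) = 2 * real CARD('d) * symbol N \<theta> * cos (phase N \<theta> z)" for \<theta>
  proof -
    have "(\<Sum>u\<in>UNIV. cos (phase N \<theta> (z + unit_step u)))
        = (\<Sum>i\<in>UNIV. cos (phase N \<theta> (z + axis i 1)) + cos (phase N \<theta> (z + - axis i 1)))"
      by (rule sum_unit_steps)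
    also have "\<dots> = 2 * (\<Sum>i\<in>UNIV. cos (2 * pi * real_of_int (\<theta> $ i) / real N)) * cos (phase N \<theta> z)"
      unfolding phase_add phase_minus phase_axis cos_add sum_distrib_left sum_distrib_right
      by (intro sum.cong refl) simp
    also have "(\<Sum>i\<in>UNIV. cos (2 * pi * real_of_int (\<theta> $ i) / real N)) = real CARD('d) * symbol N \<theta>"
      by (simp add: symbol_def)
    finally show ?thesis by simp
  qed
  then have "(\<Sum>\<theta>\<in>torus N. symbol N \<theta> ^ k * (\<Sum>u\<in>UNIV. cos (phase N \<theta> (z + unit_step u))))
      = (2 * real CARD('d)) * (\<Sum>\<theta>\<in>torus N. symbol N \<theta> ^ Suc k * cos (phase N \<theta> z))"
    by (simp add: sum_distrib_left mult_ac)
  moreover have "(\<Sum>u\<in>UNIV. torus_kernel N k (z + unit_step u))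
      = (\<Sum>\<theta>\<in>torus N. symbol N \<theta> ^ k * (\<Sum>u\<in>UNIV. cos (phase N \<theta> (z + unit_step u)))) / real N ^ CARD('d)"
    unfolding torus_kernel_def sum_divide_distrib[symmetric] sum_distrib_left by (subst sum.swap) simp
  ultimately show ?thesis by (simp add: torus_kernel_def)
qed

lemma cis_sum: "cis (\<Sum>i\<in>A. f i) = (\<Prod>i\<in>A. cis (f i))"
  by (induction A rule: infinite_finite_induct) (simp_all add: cis_mult[symmetric])

lemma sum_roots_of_unity:
  fixes z :: int
  assumes "N \<ge> 1"
  shows "(\<Sum>j\<in>{0..<int N}. cis (2 * pi * (real_of_int j * real_of_int z) / real N)) = (if int N dvd z then of_nat N else 0)"
proof -
  define w where "w = cis (2 * pi * real_of_int z / real N)"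
  have "(\<Sum>j\<in>{0..<int N}. cis (2 * pi * (real_of_int j * real_of_int z) / real N)) = (\<Sum>j<N. w ^ j)"
  proof (rule sum.reindex_bij_witness[of _ int nat])
    fix j assume "j \<in> {0..<int N}"
    then have j: "real (nat j) = real_of_int j" by simp
    have "w ^ nat j = cis (real (nat j) * (2 * pi * real_of_int z / real N))"
      unfolding w_def by (rule Complex.DeMoivre)
    also have "real (nat j) * (2 * pi * real_of_int z / real N) = 2 * pi * (real_of_int j * real_of_int z) / real N"
      unfolding j by simp
    finally show "w ^ nat j = cis (2 * pi * (real_of_int j * real_of_int z) / real N)" .
  qed auto
  also have "\<dots> = (if int N dvd z then of_nat N else 0)"
  proof (cases "int N dvd z")
    case True
    then obtain m where "z = int N * m" by (auto simp: dvd_def)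
    then have "2 * pi * real_of_int z / real N = 2 * pi * of_int m" using assms by simp
    then have "w = 1" unfolding w_def by (simp only: complex_eq_iff cis.sel cos_int_2pin sin_int_2pin) simp
    then show ?thesis using True by simp
  next
    case False
    have "w \<noteq> 1"
    proof
      assume "w = 1"
      then have "cos (2 * pi * real_of_int z / real N) = 1" by (simp add: w_def complex_eq_iff)
      then obtain n :: int where "2 * pi * real_of_int z / real N = real_of_int n * 2 * pi"
        using cos_one_2pi_int by blast
      then have "real_of_int z = real_of_int (n * int N)" using assms by (simp add: field_simps)
      then have "z = n * int N" using of_int_eq_iff by blast
      then show False using False by simp
    qed
    moreover have "w ^ N = 1"
    proof -
      have "w ^ N = cis (real N * (2 * pi * real_of_int z / real N))"
        unfolding w_def by (rule Complex.DeMoivre)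
      also have "real N * (2 * pi * real_of_int z / real N) = 2 * pi * of_int z" using assms by simp
      finally show ?thesis by (simp only: complex_eq_iff cis.sel cos_int_2pin sin_int_2pin) simp
    qed
    ultimately show ?thesis using False by (simp add: sum_gp_strict)
  qed
  finally show ?thesis .
qed

text \<open>
  Orthogonality of characters: the sum of \<open>cis (phase N \<theta> z)\<close> over all \<open>\<theta>\<close> factorises into geometric sums
  of roots of unity.
\<close>

lemma torus_kernel_0:
  assumes "N \<ge> 1"
  shows "torus_kernel N 0 (z :: int ^ 'd::finite) = of_bool (proj N z = proj N 0)"
proof -
  have "(\<Sum>\<theta>\<in>torus N. cis (phase N \<theta> z)) = (\<Sum>\<theta>\<in>torus N. \<Prod>i\<in>UNIV. cis (2 * pi * (real_of_int (\<theta> $ i) * real_of_int (z $ i)) / real N))"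
    by (simp add: phase_def sum_distrib_left sum_divide_distrib cis_sum)
  also have "\<dots> = (\<Prod>i\<in>UNIV. if int N dvd z $ i then of_nat N else 0)"
    by (subst sum_torus_prod) (simp add: sum_roots_of_unity[OF assms])
  also have "\<dots> = (if \<forall>i. int N dvd z $ i then of_nat N ^ CARD('d) else 0)"
    by (cases "\<forall>i. int N dvd z $ i") auto
  finally have "Re (\<Sum>\<theta>\<in>torus N. cis (phase N \<theta> z)) = (if \<forall>i. int N dvd z $ i then real N ^ CARD('d) else 0)"
    by (simp flip: of_nat_power)
  then show ?thesis using assms by (simp add: torus_kernel_def proj_eq_iff)
qed

lemma abs_unit_step_le: "\<bar>unit_step u $ i\<bar> \<le> 1"
  by (auto simp: unit_step_def axis_def)

text \<open>
  In \<open>k\<close> steps no coordinate moves by more than \<open>k\<close>, so the walk cannot return to its target around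
  the torus. This is how the two fields are compared on the box, and how facts on the lattice kernel
  are obtained from Fourier sums.
\<close>

lemma torus_kernel_eq_lattice_kernel:
  assumes "\<And>i. \<bar>z $ i\<bar> + int k < int N"
  shows "torus_kernel N k z = lattice_kernel k z"
  using assms
proof (induction k arbitrary: z)
  case 0
  have N: "N \<ge> 1" using 0[of undefined] by linarith
  have "z $ i = 0" if "int N dvd z $ i" for i
    using zdvd_imp_le[of "int N" "\<bar>z $ i\<bar>"] 0[of i] that by fastforce
  then have "proj N z = proj N 0 \<longleftrightarrow> z = 0"
    unfolding proj_eq_iff by (auto simp: vec_eq_iff)
  then show ?case by (simp add: torus_kernel_0[OF N])
next
  case (Suc k)
  have "torus_kernel N k (z + unit_step u) = lattice_kernel k (z + unit_step u)" for u
  proof (rule Suc.IH)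
    fix i show "\<bar>(z + unit_step u) $ i\<bar> + int k < int N"
      using Suc.prems[of i] abs_unit_step_le[of u i] by simp
  qed
  then show ?case by (simp add: torus_kernel_Suc)
qed


section \<open>Convolution over a fundamental domain\<close>

definition centered_box :: "nat \<Rightarrow> (int ^ 'd::finite) set" where
  "centered_box N = {z. \<forall>i. - (real N / 2) < real_of_int (z $ i) \<and> real_of_int (z $ i) \<le> real N / 2}"

lemma ex_centered_representative:
  assumes "N \<ge> 1"
  shows "\<exists>z\<in>centered_box N. proj N z = proj N x"
proof -
  \<comment> \<open>rounding \<open>x\<^sub>i / N\<close> to the nearest integer, with ties rounded down to match the half-open interval\<close>
  define z where "z = (\<chi> i. x $ i - int N * \<lceil>real_of_int (x $ i) / real N - 1 / 2\<rceil>)"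
  have "- (real N / 2) < real_of_int (z $ i) \<and> real_of_int (z $ i) \<le> real N / 2" for i
  proof -
    let ?t = "real_of_int (x $ i) / real N - 1 / 2"
    have eq: "real_of_int (z $ i) = real N * (?t + 1 / 2 - of_int \<lceil>?t\<rceil>)"
      using assms by (simp add: z_def algebra_simps)
    have "- (1 / 2) < ?t + 1 / 2 - of_int \<lceil>?t\<rceil>" "?t + 1 / 2 - of_int \<lceil>?t\<rceil> \<le> 1 / 2"
      using ceiling_correct[of ?t] by linarith+
    then have "real N * - (1 / 2) < real_of_int (z $ i)" "real_of_int (z $ i) \<le> real N * (1 / 2)"
      unfolding eq using assms by (intro mult_strict_left_mono mult_left_mono; simp)+
    then show ?thesis by simp
  qed
  then have "z \<in> centered_box N" by (simp add: centered_box_def)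
  moreover have "proj N z = proj N x" by (simp add: proj_eq_iff z_def)
  ultimately show ?thesis by blast
qed

lemma centered_representative_unique:
  assumes "z \<in> centered_box N" "w \<in> centered_box N" "proj N z = proj N w"
  shows "z = w"
proof -
  have "z $ i - w $ i = 0" for i
  proof (rule ccontr)
    assume "z $ i - w $ i \<noteq> 0"
    then have "int N \<le> \<bar>z $ i - w $ i\<bar>"
      using assms(3) by (intro zdvd_imp_le) (auto simp: proj_eq_iff)
    moreover have "\<bar>real_of_int (z $ i) - real_of_int (w $ i)\<bar> < real N"
      using assms(1,2) unfolding centered_box_def mem_Collect_eq abs_less_iff by (smt (verit) field_sum_of_halves)
    then have "\<bar>z $ i - w $ i\<bar> < int N" by linarith
    ultimately show False by linarith
  qed
  then show ?thesis by (simp add: vec_eq_iff)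
qed

lemma bij_betw_proj_centered_box: "N \<ge> 1 \<Longrightarrow> bij_betw (proj N) (centered_box N) (torus N)"
  unfolding bij_betw_def inj_on_def
proof (intro conjI ballI impI subset_antisym subsetI)
  fix y assume "N \<ge> 1" "y \<in> torus N"
  then show "y \<in> proj N ` centered_box N"
    using ex_centered_representative[of N y] by (metis image_eqI proj_torus)
qed (auto simp: proj_in_torus intro: centered_representative_unique)

lemma finite_centered_box: "N \<ge> 1 \<Longrightarrow> finite (centered_box N)"
  using bij_betw_finite[OF bij_betw_proj_centered_box] finite_torus by blast

lemma card_centered_box: "N \<ge> 1 \<Longrightarrow> card (centered_box N :: (int ^ 'd::finite) set) = N ^ CARD('d)"
  using bij_betw_same_card[OF bij_betw_proj_centered_box] card_torus by metis

text \<open>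
  At time 0 the kernel is a periodic delta function, and \<open>x\<close> has exactly one representative in the
  centered box.
\<close>

lemma torus_kernel_0_convolution:
  fixes x :: "int ^ 'd::finite" and g :: "int ^ 'd \<Rightarrow> real"
  assumes N: "N \<ge> 1" and g: "\<And>z w. proj N z = proj N w \<Longrightarrow> g z = g w"
  shows "(\<Sum>z\<in>centered_box N. torus_kernel N 0 (x - z) * g z) = g x"
proof -
  obtain z0 :: "int ^ 'd" where z0: "z0 \<in> centered_box N" "proj N z0 = proj N x"
    using ex_centered_representative[OF N] by blast
  have "(\<Sum>z\<in>centered_box N. torus_kernel N 0 (x - z) * g z) = (\<Sum>z\<in>centered_box N. if z = z0 then g z else 0)"
  proof (intro sum.cong refl)
    fix z :: "int ^ 'd" assume z: "z \<in> centered_box N"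
    have "proj N (x - z) = proj N 0 \<longleftrightarrow> proj N z0 = proj N z"
    proof -
      have "int N dvd x $ i - z $ i \<longleftrightarrow> int N dvd z0 $ i - z $ i" for i
        using dvd_add_right_iff[of "int N" "z0 $ i - x $ i" "x $ i - z $ i"] z0(2)
        by (simp add: proj_eq_iff)
      then show ?thesis by (simp add: proj_eq_iff)
    qed
    also have "\<dots> \<longleftrightarrow> z = z0" using centered_representative_unique[OF z0(1) z] by auto
    finally show "torus_kernel N 0 (x - z) * g z = (if z = z0 then g z else 0)"
      by (simp add: torus_kernel_0[OF N])
  qed
  also have "\<dots> = g x"
  proof -
    have "finite (centered_box N :: (int ^ 'd) set)" by (rule finite_centered_box[OF N])
    then show ?thesis using z0 g[of z0 x] by simp
  qed
  finally show ?thesis .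
qed

lemma torus_kernel_Suc_diff:
  fixes x z :: "int ^ 'd::finite"
  shows "torus_kernel N (Suc k) (x - z) = (\<Sum>u\<in>UNIV. torus_kernel N k (x + unit_step u - z)) / (2 * real CARD('d))"
  unfolding torus_kernel_Suc by (simp add: algebra_simps)

lemma torus_kernel_Chapman_Kolmogorov:
  assumes N: "N \<ge> 1"
  shows "(\<Sum>z\<in>centered_box N. torus_kernel N j (x - z) * torus_kernel N k (z - y)) = torus_kernel N (j + k) (x - y)"
proof (induction j arbitrary: x)
  case 0
  have "torus_kernel N k (z - y) = torus_kernel N k (w - y)" if "proj N z = proj N w" for z w
    by (rule torus_kernel_cong[OF proj_diff_cong[OF that] N])
  from torus_kernel_0_convolution[OF N, of "\<lambda>z. torus_kernel N k (z - y)" x, OF this]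
  show ?case by simp
next
  case (Suc j)
  have "(\<Sum>z\<in>centered_box N. torus_kernel N (Suc j) (x - z) * torus_kernel N k (z - y))
      = (\<Sum>u\<in>UNIV. \<Sum>z\<in>centered_box N. torus_kernel N j (x + unit_step u - z) * torus_kernel N k (z - y)) / (2 * real CARD('a))"
    unfolding torus_kernel_Suc_diff sum_divide_distrib sum_distrib_right
    by (subst sum.swap) (simp add: sum_divide_distrib)
  then show ?case unfolding Suc.IH add_Suc torus_kernel_Suc_diff[symmetric] .
qed

lemma torus_kernel_mass:
  assumes N: "N \<ge> 1"
  shows "(\<Sum>z\<in>centered_box N. torus_kernel N k (x - z)) = 1"
proof (induction k arbitrary: x)
  case 0
  show ?case using torus_kernel_0_convolution[OF N, of "\<lambda>_. 1" x] by simp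
next
  case (Suc k)
  have "(\<Sum>z\<in>centered_box N. torus_kernel N (Suc k) (x - z))
      = (\<Sum>u\<in>UNIV. \<Sum>z\<in>centered_box N. torus_kernel N k (x + unit_step u - z)) / (2 * real CARD('a))"
    unfolding torus_kernel_Suc_diff sum_divide_distrib[symmetric] by (subst sum.swap) simp
  then show ?case unfolding Suc.IH
    by (simp add: card_cartesian_product UNIV_Times_UNIV[symmetric] del: UNIV_Times_UNIV)
qed


section \<open>Edge noise\<close>

text \<open>
  The coefficient at \<open>x\<close> of the noise on the edge from \<open>z\<close> to \<open>z + e\<^sub>i\<close>: the transition probabilities
  to its two endpoints are added, which is \<open>P\<^sup>k\<close> applied to the indicator of the edge. The
  normalization \<open>1 / (2d)\<close> is put into the Gram matrix.
\<close>

definition torus_edge :: "nat \<Rightarrow> nat \<Rightarrow> int ^ 'd \<Rightarrow> int ^ 'd \<Rightarrow> 'd::finite \<Rightarrow> real" where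
  "torus_edge N k x z i = torus_kernel N k (x - z) + torus_kernel N k (x - z - axis i 1)"

definition lattice_edge :: "nat \<Rightarrow> int ^ 'd \<Rightarrow> int ^ 'd \<Rightarrow> 'd::finite \<Rightarrow> real" where
  "lattice_edge k x z i = lattice_kernel k (x - z) + lattice_kernel k (x - z - axis i 1)"

lemma torus_edge_mass: "N \<ge> 1 \<Longrightarrow> (\<Sum>z\<in>centered_box N. torus_edge N k x z i) = 2"
  using torus_kernel_mass[of N k x] torus_kernel_mass[of N k "x - axis i 1"]
  by (simp add: torus_edge_def sum.distrib algebra_simps)

text \<open>
  The identity \<open>P\<^sup>k (I + P) P\<^sup>k = P\<^sup>2\<^sup>k + P\<^sup>2\<^sup>k\<^sup>+\<^sup>1\<close>: expanding the product gives \<open>P\<^sup>2\<^sup>k\<close> at distance 0 twice for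
  each direction, and at distance 1 once for each unit step.
\<close>

lemma torus_edge_gram:
  fixes x y :: "int ^ 'd::finite"
  assumes N: "N \<ge> 1"
  shows "(\<Sum>i\<in>UNIV. \<Sum>z\<in>centered_box N. torus_edge N k x z i * torus_edge N k y z i)
    = 2 * real CARD('d) * (torus_kernel N (2 * k) (x - y) + torus_kernel N (2 * k + 1) (x - y))"
proof -
  let ?t = "torus_kernel N (2 * k)"
  have conv: "(\<Sum>z\<in>centered_box N. torus_kernel N k (a - z) * torus_kernel N k (b - z)) = ?t (a - b)" for a b
    using torus_kernel_Chapman_Kolmogorov[OF N, of k a k b] by (simp add: torus_kernel_sym[of N k b] mult_2)
  have "(\<Sum>z\<in>centered_box N. torus_edge N k x z i * torus_edge N k y z i)
      = 2 * ?t (x - y) + (?t (x - y + axis i 1) + ?t (x - y - axis i 1))" for i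
  proof -
    have "torus_edge N k x z i * torus_edge N k y z i
        = torus_kernel N k (x - z) * torus_kernel N k (y - z)
        + torus_kernel N k (x - z) * torus_kernel N k ((y - axis i 1) - z)
        + torus_kernel N k ((x - axis i 1) - z) * torus_kernel N k (y - z)
        + torus_kernel N k ((x - axis i 1) - z) * torus_kernel N k ((y - axis i 1) - z)" for z
      by (simp add: torus_edge_def algebra_simps)
    then show ?thesis by (simp add: sum.distrib conv) (simp add: algebra_simps)
  qed
  moreover have "(\<Sum>i\<in>UNIV. ?t (x - y + axis i 1) + ?t (x - y - axis i 1)) = 2 * real CARD('d) * torus_kernel N (2 * k + 1) (x - y)"
    using sum_unit_steps[of "\<lambda>w. ?t (x - y + w)"] by (simp add: torus_kernel_Suc)
  ultimately show ?thesis by (simp add: sum.distrib algebra_simps)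
qed

lemma torus_edge_eq_lattice_edge:
  assumes "\<And>i. \<bar>x $ i - z $ i\<bar> + int k + 1 < int N"
  shows "torus_edge N k x z j = lattice_edge k x z j"
proof -
  have "\<bar>axis j (1::int) $ i\<bar> \<le> 1" for i by (simp add: axis_def)
  then have "\<bar>(x - z - axis j 1) $ i\<bar> + int k < int N" for i
    using assms[of i] by (smt (verit) vector_minus_component)
  moreover have "\<bar>(x - z) $ i\<bar> + int k < int N" for i using assms[of i] by simp
  ultimately show ?thesis
    by (simp add: torus_edge_def lattice_edge_def torus_kernel_eq_lattice_kernel)
qed


section \<open>Heat kernel bounds\<close>

lemma sin_pi_fraction_ge:
  fixes r n :: real
  assumes "0 \<le> r" "2 * r \<le> n"
  shows "r / n \<le> sin (pi * r / n)"
proof (cases "r = 0")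
  case False
  then have n: "n > 0" "r > 0" using assms by auto
  define x where "x = pi * r / n"
  have x: "0 \<le> x" "x \<le> 2"
  proof -
    have "x = pi * (r / n)" by (simp add: x_def)
    also have "\<dots> \<le> 4 * (1 / 2)"
      using n assms pi_less_4 by (intro mult_mono) (auto simp: field_simps)
    finally show "x \<le> 2" by simp
  qed (use n in \<open>simp add: x_def\<close>)
  have "\<bar>sin x - x\<bar> \<le> inverse (fact 3) * \<bar>x\<bar> ^ 3"
    using Maclaurin_sin_bound[of x 3] by (simp add: sin_coeff_def numeral_eq_Suc)
  moreover have "inverse (fact 3) * \<bar>x\<bar> ^ 3 = x * x\<^sup>2 / 6"
    using x by (simp add: fact_numeral power3_eq_cube power2_eq_square)
  ultimately have "x - x * x\<^sup>2 / 6 \<le> sin x" by linarith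
  moreover have "x * x\<^sup>2 \<le> x * 2\<^sup>2"
    using x by (intro mult_left_mono power_mono) auto
  ultimately have "x / 3 \<le> sin x" by simp
  moreover have "r / n \<le> x / 3"
    using pi_gt3 n by (simp add: x_def field_simps)
  ultimately show ?thesis by (simp add: x_def)
qed simp

text \<open>
  Comparison with the integral of \<open>1 / (1 + s\<^sup>2 x\<^sup>2)\<close>, whose primitive is \<open>arctan (s x) / s\<close>.
\<close>

lemma sum_inverse_quadratic_le:
  assumes s: "s > 0"
  shows "(\<Sum>n=1..N. 1 / (1 + (s * real n)\<^sup>2)) \<le> pi / (2 * s)"
proof -
  have step: "1 / (1 + (s * real (Suc n))\<^sup>2) \<le> (arctan (s * real (Suc n)) - arctan (s * real n)) / s" for n
  proof -
    have "\<exists>z>s * real n. z < s * real (Suc n) \<and>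
        arctan (s * real (Suc n)) - arctan (s * real n) = (s * real (Suc n) - s * real n) * inverse (1 + z\<^sup>2)"
      using s by (intro MVT2 DERIV_arctan) (simp add: algebra_simps)
    then obtain z where z: "s * real n < z" "z < s * real (Suc n)"
      "arctan (s * real (Suc n)) - arctan (s * real n) = (s * real (Suc n) - s * real n) * inverse (1 + z\<^sup>2)" by blast
    have "0 \<le> s * real n" using s by simp
    then have "z\<^sup>2 \<le> (s * real (Suc n))\<^sup>2" using z by (intro power_mono) linarith+
    then have "1 / (1 + (s * real (Suc n))\<^sup>2) \<le> 1 / (1 + z\<^sup>2)"
      by (intro divide_left_mono) (auto intro!: mult_pos_pos add_pos_nonneg)
    also have "\<dots> = (arctan (s * real (Suc n)) - arctan (s * real n)) / s"
    proof -
      have "s * real (Suc n) - s * real n = s" by (simp add: algebra_simps)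
      then show ?thesis unfolding z(3) using s by (simp add: inverse_eq_divide)
    qed
    finally show ?thesis .
  qed
  have "(\<Sum>n=1..N. 1 / (1 + (s * real n)\<^sup>2)) \<le> arctan (s * real N) / s"
  proof (induction N)
    case (Suc N)
    then show ?case using step[of N] by (simp add: diff_divide_distrib)
  qed simp
  also have "\<dots> \<le> (pi / 2) / s" using s arctan_ubound[of "s * real N"] by (intro divide_right_mono) auto
  finally show ?thesis by simp
qed

lemma sum_gaussian_le:
  assumes "b > 0"
  shows "(\<Sum>n=1..N. exp (- (b * (real n)\<^sup>2))) \<le> pi / (2 * sqrt b)"
proof -
  have "exp (- (b * (real n)\<^sup>2)) \<le> 1 / (1 + (sqrt b * real n)\<^sup>2)" for n
  proof -
    have "1 + b * (real n)\<^sup>2 \<le> exp (b * (real n)\<^sup>2)" by (rule exp_ge_add_one_self)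
    then have "1 / exp (b * (real n)\<^sup>2) \<le> 1 / (1 + b * (real n)\<^sup>2)"
      using assms by (intro divide_left_mono) (auto intro!: mult_pos_pos add_pos_nonneg)
    then show ?thesis using assms by (simp add: exp_minus inverse_eq_divide power_mult_distrib)
  qed
  then have "(\<Sum>n=1..N. exp (- (b * (real n)\<^sup>2))) \<le> (\<Sum>n=1..N. 1 / (1 + (sqrt b * real n)\<^sup>2))"
    by (intro sum_mono)
  also have "\<dots> \<le> pi / (2 * sqrt b)" using assms by (intro sum_inverse_quadratic_le) simp
  finally show ?thesis .
qed

text \<open>
  The summand has period \<open>N/2\<close> in \<open>j\<close>, so for odd \<open>N\<close> its maxima need not be attained at integers.
  Therefore the sum over the numbers \<open>2j\<close> is bounded by the sum over all integers below \<open>2N\<close>, which runs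
  twice through a function of period \<open>N\<close>. This function has its maxima at multiples of \<open>N\<close> and Gaussian
  decay away from them.
\<close>

lemma sum_exp_sin_squared_le:
  assumes N: "N \<ge> 1" and a: "a > 0"
  shows "(\<Sum>j\<in>{0..<int N}. exp (- (a * (sin (2 * pi * real_of_int j / real N))\<^sup>2))) \<le> 4 + 2 * pi * real N / sqrt a"
proof -
  define f where "f = (\<lambda>r::nat. exp (- (a * (sin (pi * real r / real N))\<^sup>2)))"
  define b where "b = a / (real N)\<^sup>2"
  have b: "b > 0" "sqrt b = sqrt a / real N" using a N by (simp_all add: b_def real_sqrt_divide)
  have f_periodic: "f (r + N) = f r" for r
  proof -
    have "pi * real (r + N) / real N = pi * real r / real N + pi" using N by (simp add: field_simps)
    then show ?thesis by (simp add: f_def)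
  qed
  have f_le: "f r \<le> exp (- (b * (real r)\<^sup>2)) + exp (- (b * (real (N - r))\<^sup>2))" if "r < N" for r
  proof -
    have mono: "exp (- (a * (sin (pi * real r / real N))\<^sup>2)) \<le> exp (- (b * q\<^sup>2))"
      if "0 \<le> q" "q / real N \<le> sin (pi * real r / real N)" for q
    proof -
      have "(q / real N)\<^sup>2 \<le> (sin (pi * real r / real N))\<^sup>2" using that by (intro power_mono) auto
      then have "a * (q / real N)\<^sup>2 \<le> a * (sin (pi * real r / real N))\<^sup>2"
        using a by (intro mult_left_mono) auto
      then show ?thesis by (simp add: b_def power_divide)
    qed
    show ?thesis
    proof (cases "2 * r \<le> N")
      case True
      then have "real r / real N \<le> sin (pi * real r / real N)" by (intro sin_pi_fraction_ge) linarith+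
      then show ?thesis using mono[of "real r"] by (simp add: f_def add_increasing2)
    next
      case False
      have "real (N - r) / real N \<le> sin (pi * real (N - r) / real N)"
        using False that by (intro sin_pi_fraction_ge) linarith+
      also have "pi * real (N - r) / real N = pi - pi * real r / real N"
        using that N by (simp add: field_simps)
      finally have "real (N - r) / real N \<le> sin (pi * real r / real N)" by (simp only: sin_pi_minus)
      then show ?thesis using mono[of "real (N - r)"] by (simp add: f_def add_increasing)
    qed
  qed
  have "(\<Sum>j\<in>{0..<int N}. exp (- (a * (sin (2 * pi * real_of_int j / real N))\<^sup>2))) = (\<Sum>j<N. f (2 * j))"
    by (rule sum.reindex_bij_witness[of _ int nat]) (auto simp: f_def mult_ac)
  also have "\<dots> = (\<Sum>r\<in>(\<lambda>j. 2 * j) ` {..<N}. f r)"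
    by (subst sum.reindex) (auto simp: inj_on_def)
  \<comment> \<open>odd arguments are added\<close>
  also have "\<dots> \<le> (\<Sum>r<N + N. f r)"
    by (rule sum_mono2) (auto simp: f_def)
  also have "\<dots> = 2 * (\<Sum>r<N. f r)"
    by (simp add: sum.nat_group[symmetric] lessThan_atLeast0 sum.atLeastLessThan_concat[of 0 N "N + N", symmetric])
       (simp add: sum.shift_bounds_nat_ivl[of f 0 N N, simplified] f_periodic)
  also have "(\<Sum>r<N. f r) \<le> 2 + pi * real N / sqrt a"
  proof -
    have "(\<Sum>r<N. f r) \<le> (\<Sum>r<N. exp (- (b * (real r)\<^sup>2))) + (\<Sum>r<N. exp (- (b * (real (N - r))\<^sup>2)))"
      unfolding sum.distrib[symmetric] by (intro sum_mono f_le) simp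
    also have "(\<Sum>r<N. exp (- (b * (real (N - r))\<^sup>2))) = (\<Sum>r=1..N. exp (- (b * (real r)\<^sup>2)))"
      by (rule sum.reindex_bij_witness[of _ "\<lambda>r. N - r" "\<lambda>r. N - r"]) auto
    also have "(\<Sum>r<N. exp (- (b * (real r)\<^sup>2))) \<le> (\<Sum>r=0..N. exp (- (b * (real r)\<^sup>2)))"
      by (rule sum_mono2) auto
    also have "\<dots> = 1 + (\<Sum>r=1..N. exp (- (b * (real r)\<^sup>2)))"
      by (subst sum.atLeast_Suc_atMost) auto
    also have "1 + (\<Sum>r=1..N. exp (- (b * (real r)\<^sup>2))) + (\<Sum>r=1..N. exp (- (b * (real r)\<^sup>2))) \<le> 1 + pi / (2 * sqrt b) + pi / (2 * sqrt b)"
      by (intro add_mono sum_gaussian_le b order_refl)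
    also have "\<dots> \<le> 2 + pi * real N / sqrt a" using a N by (simp add: b(2) field_simps)
    finally show ?thesis by simp
  qed
  finally show ?thesis by simp
qed

text \<open>
  The exponential of a sum factorises over the coordinates, which reduces sums over the torus to one
  dimension. The absolute value of the cosine is controlled by \<open>sin\<^sup>2\<close>, which also vanishes at the
  angle \<open>\<pi>\<close>; the walk is not lazy and the symbol may be close to \<open>-1\<close>.
\<close>

lemma abs_symbol_le_exp:
  fixes \<theta> :: "int ^ 'd::finite"
  shows "\<bar>symbol N \<theta>\<bar> \<le> exp (- ((\<Sum>i\<in>UNIV. (sin (2 * pi * real_of_int (\<theta> $ i) / real N))\<^sup>2) / (2 * real CARD('d))))"
proof -
  let ?\<phi> = "\<lambda>i. 2 * pi * real_of_int (\<theta> $ i) / real N"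
  have cos_le: "\<bar>cos x\<bar> \<le> 1 - (sin x)\<^sup>2 / 2" for x :: real
  proof -
    have "(sin x)\<^sup>2 = (1 - \<bar>cos x\<bar>) * (1 + \<bar>cos x\<bar>)" by (simp add: sin_squared_eq power2_eq_square algebra_simps)
    also have "\<dots> \<le> (1 - \<bar>cos x\<bar>) * 2" by (intro mult_left_mono) auto
    finally show ?thesis by simp
  qed
  have "\<bar>symbol N \<theta>\<bar> \<le> (\<Sum>i\<in>UNIV. \<bar>cos (?\<phi> i)\<bar>) / real CARD('d)"
    unfolding symbol_def by (simp add: divide_right_mono)
  also have "\<dots> \<le> (\<Sum>i\<in>(UNIV :: 'd set). 1 - (sin (?\<phi> i))\<^sup>2 / 2) / real CARD('d)"
    by (intro divide_right_mono sum_mono cos_le) simp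
  also have "\<dots> = 1 + - ((\<Sum>i\<in>UNIV. (sin (?\<phi> i))\<^sup>2) / (2 * real CARD('d)))"
    by (simp add: sum_subtractf diff_divide_distrib sum_divide_distrib[symmetric])
  also have "\<dots> \<le> exp (- ((\<Sum>i\<in>UNIV. (sin (?\<phi> i))\<^sup>2) / (2 * real CARD('d))))"
    by (rule exp_ge_add_one_self)
  finally show ?thesis .
qed

lemma sum_abs_symbol_power_le:
  assumes "N \<ge> 1" "m \<ge> 1"
  shows "(\<Sum>\<theta>\<in>torus N. \<bar>symbol N (\<theta> :: int ^ 'd::finite)\<bar> ^ m)
    \<le> (4 + 2 * pi * real N / sqrt (real m / (2 * real CARD('d)))) ^ CARD('d)"
proof -
  let ?a = "real m / (2 * real CARD('d))"
  let ?e = "\<lambda>j. exp (- (?a * (sin (2 * pi * real_of_int j / real N))\<^sup>2))"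
  have "\<bar>symbol N \<theta>\<bar> ^ m \<le> (\<Prod>i\<in>UNIV. ?e (\<theta> $ i))" for \<theta> :: "int ^ 'd"
  proof -
    have "\<bar>symbol N \<theta>\<bar> ^ m \<le> exp (- ((\<Sum>i\<in>UNIV. (sin (2 * pi * real_of_int (\<theta> $ i) / real N))\<^sup>2) / (2 * real CARD('d)))) ^ m"
      by (intro power_mono abs_symbol_le_exp) simp
    also have "\<dots> = exp (\<Sum>i\<in>UNIV. - (?a * (sin (2 * pi * real_of_int (\<theta> $ i) / real N))\<^sup>2))"
      by (simp add: exp_of_nat_mult[symmetric] sum_negf sum_distrib_left sum_divide_distrib)
    finally show ?thesis by (simp add: exp_sum)
  qed
  then have "(\<Sum>\<theta>\<in>torus N. \<bar>symbol N (\<theta> :: int ^ 'd)\<bar> ^ m) \<le> (\<Sum>\<theta>\<in>torus N. \<Prod>i\<in>(UNIV :: 'd set). ?e (\<theta> $ i))"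
    by (intro sum_mono)
  also have "\<dots> = (\<Sum>j\<in>{0..<int N}. ?e j) ^ CARD('d)"
    by (subst sum_torus_prod) simp
  also have "\<dots> \<le> (4 + 2 * pi * real N / sqrt ?a) ^ CARD('d)"
    using assms by (intro power_mono sum_exp_sin_squared_le sum_nonneg) auto
  finally show ?thesis .
qed

text \<open>
  The constant in the bound \<open>heat_const d / m\<^sup>3\<^sup>/\<^sup>2\<close> for the heat kernel after \<open>m\<close> steps. In the base of
  the power, 4 accounts for the maxima of the one-dimensional sum over frequencies and the rest for the
  Gaussian decay around them.
\<close>

definition heat_const :: "nat \<Rightarrow> real" where
  "heat_const d = (4 + 2 * pi * sqrt (2 * real d)) ^ d"

lemma heat_const_nonneg: "0 \<le> heat_const d"
  by (simp add: heat_const_def)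

text \<open>
  Up to time \<open>N\<^sup>2\<close> the torus does not feel its finite size, and the average is of order \<open>m\<^sup>-\<^sup>d\<^sup>/\<^sup>2\<close>. As
  \<open>d \<ge> 3\<close>, the exponent can be replaced by \<open>3/2\<close>, which is enough for summability.
\<close>

lemma average_symbol_power_le:
  assumes d: "CARD('d::finite) \<ge> 3" and N: "N \<ge> 1" and m: "m \<ge> 1" "m \<le> N\<^sup>2"
  shows "(\<Sum>\<theta>\<in>torus N. \<bar>symbol N (\<theta> :: int ^ 'd)\<bar> ^ m) / real N ^ CARD('d)
    \<le> heat_const CARD('d) / (real m * sqrt (real m))"
proof -
  have "real m \<le> (real N)\<^sup>2" using m(2) by (metis of_nat_le_iff of_nat_power)
  then have sm: "sqrt (real m) \<le> real N" by (simp add: real_le_lsqrt)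
  have pos: "0 < real m" "0 < sqrt (real m)" "1 \<le> sqrt (real m)" "0 < real N" using m N by auto
  have "(\<Sum>\<theta>\<in>torus N. \<bar>symbol N (\<theta> :: int ^ 'd)\<bar> ^ m) / real N ^ CARD('d)
      \<le> (4 + 2 * pi * real N / sqrt (real m / (2 * real CARD('d)))) ^ CARD('d) / real N ^ CARD('d)"
    using sum_abs_symbol_power_le[OF N m(1), where 'd = 'd] by (simp add: divide_right_mono)
  also have "\<dots> = ((4 + 2 * pi * real N / sqrt (real m / (2 * real CARD('d)))) / real N) ^ CARD('d)"
    by (simp add: power_divide)
  also have "\<dots> \<le> ((4 + 2 * pi * sqrt (2 * real CARD('d))) / sqrt (real m)) ^ CARD('d)"
  proof (rule power_mono)
    have "4 / real N \<le> 4 / sqrt (real m)" using sm pos by (intro divide_left_mono) auto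
    then show "(4 + 2 * pi * real N / sqrt (real m / (2 * real CARD('d)))) / real N
        \<le> (4 + 2 * pi * sqrt (2 * real CARD('d))) / sqrt (real m)"
      using pos by (simp add: add_divide_distrib real_sqrt_divide)
  qed simp
  also have "\<dots> = heat_const CARD('d) * (1 / sqrt (real m)) ^ CARD('d)"
    by (simp add: heat_const_def power_divide)
  also have "\<dots> \<le> heat_const CARD('d) * (1 / sqrt (real m)) ^ 3"
    using pos d by (intro mult_left_mono power_decreasing heat_const_nonneg) auto
  also have "(1 / sqrt (real m)) ^ 3 = 1 / (real m * sqrt (real m))"
    by (simp add: power_divide power3_eq_cube)
  finally show ?thesis by simp
qed

lemma abs_torus_kernel_le:
  "\<bar>torus_kernel N k (z :: int ^ 'd::finite)\<bar> \<le> (\<Sum>\<theta>\<in>torus N. \<bar>symbol N (\<theta> :: int ^ 'd)\<bar> ^ k) / real N ^ CARD('d)"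
proof -
  have "\<bar>\<Sum>\<theta>\<in>torus N. symbol N \<theta> ^ k * cos (phase N \<theta> z)\<bar> \<le> (\<Sum>\<theta>\<in>torus N. \<bar>symbol N \<theta> ^ k * cos (phase N \<theta> z)\<bar>)"
    by (rule sum_abs)
  also have "\<dots> \<le> (\<Sum>\<theta>\<in>torus N. \<bar>symbol N (\<theta> :: int ^ 'd)\<bar> ^ k)"
    by (intro sum_mono) (simp add: abs_mult power_abs mult_left_le)
  finally show ?thesis unfolding torus_kernel_def by (simp add: divide_right_mono)
qed

text \<open>
  The bound for the torus is uniform in \<open>N\<close>, and the lattice kernel agrees with that of a large torus.
\<close>

lemma abs_lattice_kernel_le:
  assumes d: "CARD('d::finite) \<ge> 3" and m: "m \<ge> 1"
  shows "\<bar>lattice_kernel m (z :: int ^ 'd)\<bar> \<le> heat_const CARD('d) / (real m * sqrt (real m))"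
proof -
  define N where "N = m + nat (\<Sum>i\<in>UNIV. \<bar>z $ i\<bar>) + 1"
  have "\<bar>z $ i\<bar> + int m < int N" for i
  proof -
    have "\<bar>z $ i\<bar> \<le> (\<Sum>i\<in>UNIV. \<bar>z $ i\<bar>)" by (rule member_le_sum) auto
    then show ?thesis by (simp add: N_def sum_nonneg)
  qed
  then have "lattice_kernel m z = torus_kernel N m z" by (simp add: torus_kernel_eq_lattice_kernel)
  moreover have "m \<le> N * 1" "N * 1 \<le> N * N" by (simp_all add: N_def)
  then have "m \<le> N\<^sup>2" by (simp add: power2_eq_square) (meson le_square le_trans)
  ultimately show ?thesis
    using abs_torus_kernel_le[of N m z] average_symbol_power_le[OF d _ m, of N] by (simp add: N_def)
qed

lemma inverse_three_halves_le:
  assumes "m \<ge> 1"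
  shows "1 / (real m * sqrt (real m)) \<le> 4 * (1 / sqrt (real m)) - 4 * (1 / sqrt (real (Suc m)))"
proof -
  define s t where "s = sqrt (real m)" and "t = sqrt (real (Suc m))"
  have s: "s \<ge> 1" "s\<^sup>2 = real m" using assms by (auto simp: s_def)
  have t: "t > 0" "t\<^sup>2 = s\<^sup>2 + 1" using assms by (auto simp: t_def s_def)
  have "1 \<le> s\<^sup>2" using s(1) by (rule one_le_power)
  then have st: "t\<^sup>2 \<le> 2 * s\<^sup>2" using t by simp
  have "t \<le> 3 / 2 * s"
  proof (rule power2_le_imp_le)
    show "t\<^sup>2 \<le> (3 / 2 * s)\<^sup>2" using st s by (simp add: power_mult_distrib power2_eq_square)
  qed (use s in simp)
  then have "t * (s + t) \<le> (3 / 2 * s) * (s + 3 / 2 * s)"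
    using s t by (intro mult_mono) auto
  then have "t * (s + t) \<le> 4 * s\<^sup>2" using s by (simp add: power2_eq_square algebra_simps)
  have "t - s = 1 / (t + s)"
    using t s by (simp add: field_simps power2_eq_square)
  moreover have "1 / s - 1 / t = (t - s) / (s * t)"
    using t(1) s(1) by (simp add: field_simps)
  ultimately have "1 / s - 1 / t = 1 / (s * (t * (s + t)))"
    by (simp add: mult_ac add.commute)
  also have "\<dots> \<ge> 1 / (s * (4 * s\<^sup>2))"
    using t(1) s(1) \<open>t * (s + t) \<le> 4 * s\<^sup>2\<close> by (intro divide_left_mono mult_left_mono mult_pos_pos) auto
  also have "1 / (s * (4 * s\<^sup>2)) = 1 / (s\<^sup>2 * s) / 4" by simp
  finally have "1 / (s\<^sup>2 * s) \<le> (1 / s - 1 / t) * 4"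
    by (simp only: pos_divide_le_eq[OF zero_less_numeral])
  then show ?thesis unfolding s(2) by (simp add: s_def t_def algebra_simps)
qed

lemma three_halves_telescope:
  assumes L: "L \<ge> 1"
  shows "(\<lambda>n. 4 * (1 / sqrt (real (n + L))) - 4 * (1 / sqrt (real (Suc (n + L))))) sums (4 / sqrt (real L))"
proof -
  have "(\<lambda>n. 4 * (1 / sqrt (real n))) \<longlonglongrightarrow> 0" by real_asymp
  then have "(\<lambda>n. 4 * (1 / sqrt (real (n + L)))) \<longlonglongrightarrow> 0" by (rule LIMSEQ_ignore_initial_segment)
  from telescope_sums'[OF this] show ?thesis by simp
qed

lemma sum_three_halves_le:
  assumes L: "L \<ge> 1"
  shows "(\<Sum>m\<in>{L..<K}. 1 / (real m * sqrt (real m))) \<le> 4 / sqrt (real L)"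
proof -
  let ?g = "\<lambda>n. 4 * (1 / sqrt (real (n + L))) - 4 * (1 / sqrt (real (Suc (n + L))))"
  have le: "1 / (real (n + L) * sqrt (real (n + L))) \<le> ?g n" for n
    by (rule inverse_three_halves_le) (use L in simp)
  have "(\<Sum>m\<in>{L..<K}. 1 / (real m * sqrt (real m))) = (\<Sum>n<K - L. 1 / (real (n + L) * sqrt (real (n + L))))"
    by (rule sum.reindex_bij_witness[of _ "\<lambda>n. n + L" "\<lambda>m. m - L"]) auto
  also have "\<dots> \<le> (\<Sum>n<K - L. ?g n)" by (intro sum_mono le)
  also have "\<dots> \<le> (\<Sum>n. ?g n)"
  proof (rule sum_le_suminf)
    show "0 \<le> ?g n" for n by (rule order_trans[OF _ le]) simp
  qed (use three_halves_telescope[OF L] in \<open>auto simp: sums_iff\<close>)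
  also have "\<dots> = 4 / sqrt (real L)" using three_halves_telescope[OF L] by (simp add: sums_iff)
  finally show ?thesis .
qed

lemma lattice_kernel_nonneg: "0 \<le> lattice_kernel k z"
  by (induction k arbitrary: z) (auto intro!: divide_nonneg_nonneg sum_nonneg)

lemma lattice_kernel_summable:
  assumes d: "CARD('d::finite) \<ge> 3"
  shows "summable (\<lambda>m. lattice_kernel m (z :: int ^ 'd))"
    and "L \<ge> 1 \<Longrightarrow> (\<Sum>m. lattice_kernel (m + L) z) \<le> heat_const CARD('d) * (4 / sqrt (real L))"
proof -
  have le: "lattice_kernel (m + L) z \<le> heat_const CARD('d) * (4 * (1 / sqrt (real (m + L))) - 4 * (1 / sqrt (real (Suc (m + L)))))"
    if L: "L \<ge> 1" for m L
  proof -
    have "lattice_kernel (m + L) z \<le> heat_const CARD('d) * (1 / (real (m + L) * sqrt (real (m + L))))"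
      using abs_lattice_kernel_le[OF d, of "m + L" z] L by simp
    also have "\<dots> \<le> heat_const CARD('d) * (4 * (1 / sqrt (real (m + L))) - 4 * (1 / sqrt (real (Suc (m + L)))))"
      using L by (intro mult_left_mono inverse_three_halves_le heat_const_nonneg) simp
    finally show ?thesis .
  qed
  have sums: "(\<lambda>m. heat_const CARD('d) * (4 * (1 / sqrt (real (m + L))) - 4 * (1 / sqrt (real (Suc (m + L))))))
      sums (heat_const CARD('d) * (4 / sqrt (real L)))" if "L \<ge> 1" for L
    by (rule sums_mult[OF three_halves_telescope[OF that]])
  have summable: "summable (\<lambda>m. lattice_kernel (m + L) z)" if "L \<ge> 1" for L
    by (rule summable_comparison_test'[OF sums_summable[OF sums[OF that]], of 0])
       (use le[OF that] in \<open>simp only: real_norm_def abs_of_nonneg[OF lattice_kernel_nonneg]\<close>)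
  show "summable (\<lambda>m. lattice_kernel m z)"
    using summable[of 1] summable_iff_shift[of "\<lambda>m. lattice_kernel m z" 1] by simp
  assume L: "L \<ge> 1"
  show "(\<Sum>m. lattice_kernel (m + L) z) \<le> heat_const CARD('d) * (4 / sqrt (real L))"
    using suminf_le[OF le[OF L] summable[OF L] sums_summable[OF sums[OF L]]] sums_unique[OF sums[OF L]] by simp
qed

text \<open>
  A nonzero frequency has a coordinate at distance at least 1 from the multiples of \<open>N\<close>, and this
  coordinate alone makes the symbol smaller than 1 by an amount of order \<open>N\<^sup>-\<^sup>2\<close>.
\<close>

lemma symbol_gap:
  fixes \<theta> :: "int ^ 'd::finite"
  assumes "\<theta> \<in> torus N" "\<theta> \<noteq> 0"
  shows "2 / (real CARD('d) * (real N)\<^sup>2) \<le> 1 - symbol N \<theta>"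
proof -
  obtain i where i: "\<theta> $ i \<noteq> 0" using assms(2) by (auto simp: vec_eq_iff)
  define r where "r = real_of_int (\<theta> $ i)"
  have r: "1 \<le> r" "r \<le> real N - 1"
    using assms(1) i by (auto simp: r_def torus_def) (smt (verit) of_int_le_iff of_int_of_nat_eq of_int_1 of_int_diff)+
  have "1 / real N \<le> sin (pi * r / real N)"
  proof (cases "2 * r \<le> real N")
    case True
    then have "r / real N \<le> sin (pi * r / real N)" using r by (intro sin_pi_fraction_ge) auto
    then show ?thesis using r by (smt (verit) divide_right_mono)
  next
    case False
    then have "(real N - r) / real N \<le> sin (pi * (real N - r) / real N)" using r by (intro sin_pi_fraction_ge) auto
    also have "pi * (real N - r) / real N = pi - pi * r / real N" using r by (simp add: field_simps)
    finally have "(real N - r) / real N \<le> sin (pi * r / real N)" by (simp only: sin_pi_minus)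
    then show ?thesis using r by (smt (verit) divide_right_mono)
  qed
  then have "(1 / real N)\<^sup>2 \<le> (sin (pi * r / real N))\<^sup>2" by (intro power_mono) auto
  then have "2 / (real N)\<^sup>2 \<le> 1 - cos (2 * (pi * r / real N))"
    unfolding cos_double_sin by (simp add: power_divide)
  also have "\<dots> = 1 - cos (2 * pi * real_of_int (\<theta> $ i) / real N)" by (simp add: r_def mult_ac)
  also have "\<dots> \<le> (\<Sum>i\<in>UNIV. 1 - cos (2 * pi * real_of_int (\<theta> $ i) / real N))"
    by (rule member_le_sum) auto
  also have "\<dots> = real CARD('d) * (1 - symbol N \<theta>)"
    by (simp add: symbol_def sum_subtractf algebra_simps)
  finally have "2 / (real N)\<^sup>2 / real CARD('d) \<le> real CARD('d) * (1 - symbol N \<theta>) / real CARD('d)"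
    by (rule divide_right_mono) simp
  then show ?thesis by (simp add: mult.commute)
qed

lemma symbol_less_1:
  assumes "\<theta> \<in> torus N" "\<theta> \<noteq> 0"
  shows "symbol N (\<theta> :: int ^ 'd::finite) < 1"
proof -
  have "N \<noteq> 0" using assms(1) by (auto simp: torus_def intro!: ccontr[of "_ \<noteq> 0"]) 
  then have "0 < 2 / (real CARD('d) * (real N)\<^sup>2)" by simp
  with symbol_gap[OF assms] show ?thesis by linarith
qed

lemma power_eq_geometric_block:
  fixes s :: real
  assumes "k \<le> L"
  shows "s ^ k = (1 - s) * (\<Sum>m\<in>{k..<L}. s ^ m) + s ^ L"
  using assms by (induction L rule: dec_induct) (simp_all add: algebra_simps)

text \<open>
  The kernel of \<open>P\<^sup>2\<^sup>R (I - P)\<^sup>-\<^sup>1\<close> on functions of mean zero. For \<open>R = 0\<close> this is the zero-average Green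
  function. The even power keeps the Fourier coefficients nonnegative, hence the kernel positive
  semidefinite.
\<close>

definition torus_tail :: "nat \<Rightarrow> nat \<Rightarrow> int ^ 'd::finite \<Rightarrow> real" where
  "torus_tail N R z = (\<Sum>\<theta>\<in>torus N - {0}. symbol N \<theta> ^ (2 * R) / (1 - symbol N \<theta>) * cos (phase N \<theta> z)) / real N ^ CARD('d)"

text \<open>
  The geometric series of each frequency is cut at time \<open>N\<^sup>2\<close>: before that time the heat kernel bound is
  summed, after it the spectral gap applies. For negative symbols the factor \<open>1 / (1 - symbol)\<close> is at
  most 1, so the first term of the series is enough; this covers the eigenvalue \<open>-1\<close> of even \<open>N\<close>.
\<close>

lemma torus_tail_0_le:
  assumes d: "CARD('d::finite) \<ge> 3" and N: "N \<ge> 1" and R: "R \<ge> 1" "2 * R < N\<^sup>2"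
  shows "torus_tail N R (0 :: int ^ 'd) \<le> heat_const CARD('d) * (4 / sqrt (real (2 * R)) + real CARD('d) / real N)"
proof -
  let ?S = "\<lambda>m. \<Sum>\<theta>\<in>torus N. \<bar>symbol N (\<theta> :: int ^ 'd)\<bar> ^ m"
  let ?c = "real CARD('d) * (real N)\<^sup>2"
  have summand: "symbol N \<theta> ^ (2 * R) / (1 - symbol N \<theta>) \<le> (\<Sum>m\<in>{2 * R..<N\<^sup>2}. \<bar>symbol N \<theta>\<bar> ^ m) + ?c * \<bar>symbol N \<theta>\<bar> ^ N\<^sup>2"
    if \<theta>: "\<theta> \<in> torus N - {0}" for \<theta> :: "int ^ 'd"
  proof -
    let ?s = "symbol N \<theta>"
    have gap: "2 / ?c \<le> 1 - ?s" using symbol_gap[of \<theta> N] \<theta> by simp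
    have pos: "0 < 1 - ?s" using symbol_less_1[of \<theta> N] \<theta> by simp
    have c: "0 < ?c" using N by simp
    show ?thesis
    proof (cases "?s < 0")
      case True
      have "?s ^ (2 * R) / (1 - ?s) \<le> ?s ^ (2 * R) / 1"
        using True pos by (intro divide_left_mono) (auto simp: power_mult)
      also have "\<dots> = \<bar>?s\<bar> ^ (2 * R)" by (simp add: power_mult)
      also have "\<dots> \<le> (\<Sum>m\<in>{2 * R..<N\<^sup>2}. \<bar>?s\<bar> ^ m)"
        using R by (intro member_le_sum) auto
      finally show ?thesis using c by (simp add: add_increasing2)
    next
      case False
      have "?s ^ (2 * R) / (1 - ?s) = (\<Sum>m\<in>{2 * R..<N\<^sup>2}. ?s ^ m) + ?s ^ N\<^sup>2 / (1 - ?s)"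
        using power_eq_geometric_block[of "2 * R" "N\<^sup>2" ?s] R pos by (simp add: field_simps)
      also have "?s ^ N\<^sup>2 / (1 - ?s) \<le> ?s ^ N\<^sup>2 / (2 / ?c)"
        using False gap pos c by (intro divide_left_mono) (auto intro!: mult_pos_pos)
      also have "\<dots> \<le> ?c * ?s ^ N\<^sup>2" using c False by (simp add: field_simps)
      finally show ?thesis using False by simp
    qed
  qed
  have "(\<Sum>\<theta>\<in>torus N - {0 :: int ^ 'd}. symbol N \<theta> ^ (2 * R) / (1 - symbol N \<theta>))
      \<le> (\<Sum>\<theta>\<in>torus N - {0 :: int ^ 'd}. (\<Sum>m\<in>{2 * R..<N\<^sup>2}. \<bar>symbol N \<theta>\<bar> ^ m) + ?c * \<bar>symbol N \<theta>\<bar> ^ N\<^sup>2)"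
    by (intro sum_mono summand)
  also have "\<dots> \<le> (\<Sum>\<theta>\<in>(torus N :: (int ^ 'd) set). (\<Sum>m\<in>{2 * R..<N\<^sup>2}. \<bar>symbol N \<theta>\<bar> ^ m) + ?c * \<bar>symbol N \<theta>\<bar> ^ N\<^sup>2)"
    by (intro sum_mono2 finite_torus) (auto intro!: add_nonneg_nonneg sum_nonneg)
  also have "\<dots> = (\<Sum>m\<in>{2 * R..<N\<^sup>2}. ?S m) + ?c * ?S (N\<^sup>2)"
    by (simp add: sum.distrib sum_distrib_left sum.swap[of _ "torus N"])
  finally have "torus_tail N R (0 :: int ^ 'd) \<le> ((\<Sum>m\<in>{2 * R..<N\<^sup>2}. ?S m) + ?c * ?S (N\<^sup>2)) / real N ^ CARD('d)"
    by (simp add: torus_tail_def phase_def divide_right_mono)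
  also have "\<dots> = (\<Sum>m\<in>{2 * R..<N\<^sup>2}. ?S m / real N ^ CARD('d)) + ?c * (?S (N\<^sup>2) / real N ^ CARD('d))"
    by (simp only: add_divide_distrib sum_divide_distrib[where f = ?S] times_divide_eq_right)
  also have "\<dots> \<le> (\<Sum>m\<in>{2 * R..<N\<^sup>2}. heat_const CARD('d) * (1 / (real m * sqrt (real m))))
      + ?c * (heat_const CARD('d) / (real (N\<^sup>2) * sqrt (real (N\<^sup>2))))"
  proof (intro add_mono sum_mono mult_left_mono)
    fix m assume "m \<in> {2 * R..<N\<^sup>2}"
    then show "?S m / real N ^ CARD('d) \<le> heat_const CARD('d) * (1 / (real m * sqrt (real m)))"
      using average_symbol_power_le[OF d N, of m] R by simp
  next
    show "?S (N\<^sup>2) / real N ^ CARD('d) \<le> heat_const CARD('d) / (real (N\<^sup>2) * sqrt (real (N\<^sup>2)))"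
      using N by (intro average_symbol_power_le[OF d N]) auto
  qed simp
  also have "\<dots> = heat_const CARD('d) * (\<Sum>m\<in>{2 * R..<N\<^sup>2}. 1 / (real m * sqrt (real m)))
      + heat_const CARD('d) * (real CARD('d) / real N)"
    using N by (simp add: sum_distrib_left real_sqrt_power)
  also have "\<dots> \<le> heat_const CARD('d) * (4 / sqrt (real (2 * R))) + heat_const CARD('d) * (real CARD('d) / real N)"
    using R by (intro add_mono mult_left_mono sum_three_halves_le heat_const_nonneg order_refl) simp
  finally show ?thesis by (simp add: algebra_simps)
qed


section \<open>Green functions\<close>

lemma walk_kernel_lattice: "walk_kernel id k x y = lattice_kernel k (x - y)"
  by (induction k arbitrary: x) (simp_all add: algebra_simps)

lemma walk_kernel_torus:
  assumes "N \<ge> 1" "x \<in> torus N" "y \<in> torus N"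
  shows "walk_kernel (proj N) k x y = torus_kernel N k (x - y)"
  using assms(2)
proof (induction k arbitrary: x)
  case 0
  have "proj N (x - y) = proj N 0 \<longleftrightarrow> proj N x = proj N y" by (simp add: proj_eq_iff)
  also have "\<dots> \<longleftrightarrow> x = y" using 0 assms(3) by (simp add: proj_torus)
  finally show ?case by (simp add: torus_kernel_0[OF assms(1)])
next
  case (Suc k)
  have "torus_kernel N k (proj N (x + unit_step u) - y) = torus_kernel N k (x + unit_step u - y)" for u
    by (rule torus_kernel_cong[OF proj_diff_cong assms(1)]) simp
  then show ?case
    using Suc.IH[OF proj_in_torus[OF assms(1)]] by (simp add: torus_kernel_Suc_diff)
qed

lemma green_lattice_eq: "green_lattice x y = (\<Sum>k. lattice_kernel k (x - y))"
  using emeasure_walk[of id x _ y]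
  by (simp add: green_lattice_def measure_def walk_kernel_lattice lattice_kernel_nonneg)

lemma zero_in_torus: "N \<ge> 1 \<Longrightarrow> 0 \<in> torus N"
  by (simp add: torus_def)

lemma sum_torus_split:
  fixes f :: "int ^ 'd::finite \<Rightarrow> real"
  shows "N \<ge> 1 \<Longrightarrow> (\<Sum>\<theta>\<in>torus N. f \<theta>) = f 0 + (\<Sum>\<theta>\<in>torus N - {0}. f \<theta>)"
  by (rule sum.remove[OF finite_torus zero_in_torus])

lemma symbol_0 [simp]: "symbol N 0 = 1" and phase_0 [simp]: "phase N 0 z = 0"
  by (simp_all add: symbol_def phase_def)

lemma torus_kernel_split:
  fixes z :: "int ^ 'd::finite"
  assumes "N \<ge> 1"
  shows "torus_kernel N k z = 1 / real N ^ CARD('d) +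
    (\<Sum>\<theta>\<in>torus N - {0}. symbol N \<theta> ^ k * cos (phase N \<theta> z)) / real N ^ CARD('d)"
  by (simp add: torus_kernel_def sum_torus_split[OF assms] add_divide_distrib)

text \<open>
  Averaging the \<open>k\<close>-th power of a symbol over the Poisson number of jumps gives an exponential in \<open>t\<close>.
  The frequency 0 contributes exactly the subtracted constant.
\<close>

lemma prob_cts_walk_torus:
  fixes x y :: "int ^ 'd::finite"
  assumes N: "N \<ge> 1" and xy: "x \<in> torus N" "y \<in> torus N" and t: "t \<ge> 0"
  shows "\<P>(\<omega> in walk_space. cts_walk (proj N) x \<omega> t = y) - 1 / real N ^ CARD('d)
    = (\<Sum>\<theta>\<in>torus N - {0}. cos (phase N \<theta> (x - y)) * exp (- (t * (1 - symbol N \<theta>)))) / real N ^ CARD('d)"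
proof -
  have "(\<lambda>k. symbol N \<theta> ^ k * poisson_weight t k) sums exp (- (t * (1 - symbol N \<theta>)))" for \<theta> :: "int ^ 'd"
  proof -
    have "(\<lambda>k. exp (- t) * ((t * symbol N \<theta>) ^ k /\<^sub>R fact k)) sums (exp (- t) * exp (t * symbol N \<theta>))"
      by (intro sums_mult exp_converges)
    moreover have "exp (- t) * exp (t * symbol N \<theta>) = exp (- (t * (1 - symbol N \<theta>)))"
      by (simp add: exp_add[symmetric] algebra_simps)
    ultimately show ?thesis
      using t by (simp add: poisson_weight_def power_mult_distrib divide_inverse mult_ac)
  qed
  then have "(\<lambda>k. (\<Sum>\<theta>\<in>torus N. cos (phase N \<theta> (x - y)) * (symbol N \<theta> ^ k * poisson_weight t k)) / real N ^ CARD('d))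
      sums ((\<Sum>\<theta>\<in>torus N. cos (phase N \<theta> (x - y)) * exp (- (t * (1 - symbol N \<theta>)))) / real N ^ CARD('d))"
    by (intro sums_divide sums_sum sums_mult)
  moreover have "(\<lambda>k. (\<Sum>\<theta>\<in>torus N. cos (phase N \<theta> (x - y)) * (symbol N \<theta> ^ k * poisson_weight t k)) / real N ^ CARD('d))
      = (\<lambda>k. walk_kernel (proj N) k x y * poisson_weight t k)"
    by (simp add: walk_kernel_torus[OF N xy] torus_kernel_def sum_distrib_left sum_distrib_right mult_ac)
  ultimately have "\<P>(\<omega> in walk_space. cts_walk (proj N) x \<omega> t = y)
      = (\<Sum>\<theta>\<in>torus N. cos (phase N \<theta> (x - y)) * exp (- (t * (1 - symbol N \<theta>)))) / real N ^ CARD('d)"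
    using sums_unique2[OF prob_cts_walk[OF t, of "proj N" x y]] by simp
  then show ?thesis by (simp add: sum_torus_split[OF N] add_divide_distrib)
qed

lemma has_bochner_integral_exp:
  fixes c :: real
  assumes c: "c > 0"
  shows "has_bochner_integral lborel (\<lambda>t. indicator {0..} t *\<^sub>R exp (- (t * c))) (1 / c)"
proof -
  have "(\<integral>\<^sup>+ t. ennreal (exp (- (t * c))) * indicator {0..} t \<partial>lborel) = ennreal (0 - - (exp (- (0 * c)) / c))"
  proof (rule nn_integral_FTC_atLeast)
    show "((\<lambda>t. - (exp (- (t * c)) / c)) has_real_derivative exp (- (t * c))) (at t)" for t
      using c by (auto intro!: derivative_eq_intros)
    show "((\<lambda>t. - (exp (- (t * c)) / c)) \<longlongrightarrow> 0) at_top" using c by real_asymp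
  qed auto
  moreover have "(\<integral>\<^sup>+ t. ennreal (exp (- (t * c))) * indicator {0..} t \<partial>lborel)
      = (\<integral>\<^sup>+ t. ennreal (indicator {0..} t *\<^sub>R exp (- (t * c))) \<partial>lborel)"
    by (intro nn_integral_cong) (auto simp: indicator_def)
  ultimately show ?thesis
    using c by (intro has_bochner_integral_nn_integral) auto
qed

lemma green_torus_eq:
  fixes x y :: "int ^ 'd::finite"
  assumes N: "N \<ge> 1" and xy: "x \<in> torus N" "y \<in> torus N"
  shows "green_torus N x y = torus_tail N 0 (x - y)"
proof -
  have "green_torus N x y = (LINT t:{0..}|lborel.
      (\<Sum>\<theta>\<in>torus N - {0}. cos (phase N \<theta> (x - y)) * exp (- (t * (1 - symbol N \<theta>)))) / real N ^ CARD('d))"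
    unfolding green_torus_def
    by (rule set_lebesgue_integral_cong) (use prob_cts_walk_torus[OF N xy] in auto)
  also have "\<dots> = (LINT t|lborel. (\<Sum>\<theta>\<in>torus N - {0}. cos (phase N \<theta> (x - y)) *
      (indicator {0..} t *\<^sub>R exp (- (t * (1 - symbol N \<theta>))))) / real N ^ CARD('d))"
    unfolding set_lebesgue_integral_def by (simp add: sum_distrib_left mult_ac)
  also have "\<dots> = (\<Sum>\<theta>\<in>torus N - {0}. cos (phase N \<theta> (x - y)) * (1 / (1 - symbol N \<theta>))) / real N ^ CARD('d)"
    by (intro has_bochner_integral_integral_eq has_bochner_integral_divide_zero has_bochner_integral_sum
        has_bochner_integral_mult_right has_bochner_integral_exp) (auto simp: symbol_less_1)
  finally show ?thesis by (simp add: torus_tail_def)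
qed

lemma torus_tail_Suc:
  fixes z :: "int ^ 'd::finite"
  assumes N: "N \<ge> 1"
  shows "torus_tail N R z = torus_kernel N (2 * R) z + torus_kernel N (2 * R + 1) z - 2 / real N ^ CARD('d)
    + torus_tail N (Suc R) z"
proof -
  have "symbol N \<theta> ^ (2 * R) / (1 - symbol N \<theta>) * c = symbol N \<theta> ^ (2 * R) * c + symbol N \<theta> ^ (2 * R + 1) * c
      + symbol N \<theta> ^ (2 * Suc R) / (1 - symbol N \<theta>) * c"
    if "\<theta> \<in> torus N - {0}" for \<theta> :: "int ^ 'd" and c
  proof -
    have "1 - symbol N \<theta> \<noteq> 0" using symbol_less_1[of \<theta> N] that by simp
    then show ?thesis by (simp add: field_simps)
  qed
  then have "(\<Sum>\<theta>\<in>torus N - {0}. symbol N \<theta> ^ (2 * R) / (1 - symbol N \<theta>) * cos (phase N \<theta> z))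
      = (\<Sum>\<theta>\<in>torus N - {0}. symbol N \<theta> ^ (2 * R) * cos (phase N \<theta> z) + symbol N \<theta> ^ (2 * R + 1) * cos (phase N \<theta> z)
        + symbol N \<theta> ^ (2 * Suc R) / (1 - symbol N \<theta>) * cos (phase N \<theta> z))"
    by (intro sum.cong refl) blast
  then show ?thesis unfolding torus_tail_def torus_kernel_split[OF N]
    by (simp add: sum.distrib add_divide_distrib del: mult_Suc_right power_Suc)
qed

text \<open>
  The decomposition of the Green function into short-range terms and a tail. The constants
  \<open>2 / N\<^sup>d\<close> remove the frequency 0 from the short-range terms.
\<close>

lemma torus_tail_0_eq:
  fixes z :: "int ^ 'd::finite"
  assumes N: "N \<ge> 1"
  shows "torus_tail N 0 z = (\<Sum>k<R. torus_kernel N (2 * k) z + torus_kernel N (2 * k + 1) z - 2 / real N ^ CARD('d))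
    + torus_tail N R z"
proof (induction R)
  case (Suc R)
  then show ?case using torus_tail_Suc[OF N, of R z] by simp
qed simp

lemma psd_torus_tail:
  "psd (\<lambda>x y. torus_tail N R (x - y :: int ^ 'd::finite))"
proof -
  have "psd (\<lambda>x y. symbol N \<theta> ^ (2 * R) / (1 - symbol N \<theta>) / real N ^ CARD('d) *
      (cos (phase N \<theta> x) * cos (phase N \<theta> y) + sin (phase N \<theta> x) * sin (phase N \<theta> y)))"
    if "\<theta> \<in> torus N - {0}" for \<theta> :: "int ^ 'd"
    using symbol_less_1[of \<theta> N] that
    by (intro psd_scale psd_add psd_product divide_nonneg_nonneg) (auto simp: power_mult)
  then have "psd (\<lambda>x y. \<Sum>\<theta>\<in>torus N - {0 :: int ^ 'd}. symbol N \<theta> ^ (2 * R) / (1 - symbol N \<theta>) / real N ^ CARD('d) *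
      (cos (phase N \<theta> x) * cos (phase N \<theta> y) + sin (phase N \<theta> x) * sin (phase N \<theta> y)))"
    by (intro psd_sum) (auto simp: finite_torus)
  then show ?thesis
    by (simp add: torus_tail_def phase_diff cos_diff sum_divide_distrib)
qed


section \<open>The joint covariance kernel\<close>

text \<open>
  The covariance of two variables that have coefficients \<open>v\<close> and \<open>w\<close> with respect to independent noise
  of variance \<open>1 / (2d)\<close> on the edges that start in \<open>F\<close>.
\<close>

definition edge_gram :: "(int ^ 'd::finite) set \<Rightarrow> (int ^ 'd \<Rightarrow> 'd \<Rightarrow> real) \<Rightarrow> (int ^ 'd \<Rightarrow> 'd \<Rightarrow> real) \<Rightarrow> real" where
  "edge_gram F v w = (\<Sum>i\<in>UNIV. \<Sum>z\<in>F. v z i * w z i) / (2 * real CARD('d))"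

lemma edge_gram_sym: "edge_gram F v w = edge_gram F w v"
  by (simp add: edge_gram_def mult.commute)

lemma psd_edge_gram: "finite F \<Longrightarrow> psd (\<lambda>s t. edge_gram F (v s) (v t))"
  unfolding edge_gram_def sum_divide_distrib
proof (intro psd_sum)
  fix i z
  have "psd (\<lambda>s t. 1 / (2 * real CARD('a)) * (v s z i * v t z i))"
    by (intro psd_scale psd_product) simp
  then show "psd (\<lambda>s t. v s z i * v t z i / (2 * real CARD('a)))" by simp
qed auto

lemma edge_gram_cong:
  "(\<And>z i. z \<in> F \<Longrightarrow> v z i = v' z i) \<Longrightarrow> (\<And>z i. z \<in> F \<Longrightarrow> w z i = w' z i) \<Longrightarrow> edge_gram F v w = edge_gram F v' w'"
  by (simp add: edge_gram_def)

lemma edge_gram_torus: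
  "N \<ge> 1 \<Longrightarrow> edge_gram (centered_box N) (torus_edge N k x) (torus_edge N k y)
    = torus_kernel N (2 * k) (x - y) + torus_kernel N (2 * k + 1) (x - y)"
  by (simp add: edge_gram_def torus_edge_gram)

text \<open>
  Every edge carries total mass 2 under \<open>torus_edge\<close>, so \<open>2 / N\<^sup>d\<close> is the spatial mean of the
  coefficients. Subtracting it projects the field onto the fields of mean zero.
\<close>

lemma edge_gram_centered:
  fixes x y :: "int ^ 'd::finite"
  assumes N: "N \<ge> 1"
  shows "edge_gram (centered_box N) (\<lambda>z i. torus_edge N k x z i - 2 / real N ^ CARD('d))
      (\<lambda>z i. torus_edge N k y z i - 2 / real N ^ CARD('d))
    = torus_kernel N (2 * k) (x - y) + torus_kernel N (2 * k + 1) (x - y) - 2 / real N ^ CARD('d)"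
proof -
  let ?c = "2 / real N ^ CARD('d)"
  have "(\<Sum>z\<in>centered_box N. (torus_edge N k x z i - ?c) * (torus_edge N k y z i - ?c))
      = (\<Sum>z\<in>centered_box N. torus_edge N k x z i * torus_edge N k y z i) - 2 * ?c" for i
  proof -
    have "(torus_edge N k x z i - ?c) * (torus_edge N k y z i - ?c)
        = torus_edge N k x z i * torus_edge N k y z i - ?c * torus_edge N k x z i - ?c * torus_edge N k y z i + ?c * ?c" for z
      by (simp add: algebra_simps)
    then have "(\<Sum>z\<in>centered_box N. (torus_edge N k x z i - ?c) * (torus_edge N k y z i - ?c))
      = (\<Sum>z\<in>centered_box N. torus_edge N k x z i * torus_edge N k y z i)
        - ?c * (\<Sum>z\<in>centered_box N. torus_edge N k x z i) - ?c * (\<Sum>z\<in>centered_box N. torus_edge N k y z i)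
        + real (card (centered_box N :: (int ^ 'd) set)) * (?c * ?c)"
      by (simp only: sum.distrib sum_subtractf sum_distrib_left sum_constant)
    also have "real (card (centered_box N :: (int ^ 'd) set)) * (?c * ?c) = 2 * ?c"
      using N by (simp add: card_centered_box)
    finally show ?thesis unfolding torus_edge_mass[OF N] by simp
  qed
  then have "edge_gram (centered_box N) (\<lambda>z i. torus_edge N k x z i - ?c) (\<lambda>z i. torus_edge N k y z i - ?c)
      = edge_gram (centered_box N) (torus_edge N k x) (torus_edge N k y) - ?c"
    by (simp add: edge_gram_def sum_subtractf diff_divide_distrib)
  then show ?thesis by (simp add: edge_gram_torus[OF N])
qed

lemma finite_imp_bounded_entries:
  assumes "finite (S :: (int ^ 'd::finite) set)"
  obtains B :: nat where "\<And>y i. y \<in> S \<Longrightarrow> \<bar>y $ i\<bar> \<le> int B"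
proof
  fix y i assume y: "y \<in> S"
  have "\<bar>y $ i\<bar> \<le> (\<Sum>i\<in>UNIV. \<bar>y $ i\<bar>)" by (rule member_le_sum) auto
  also have "\<dots> \<le> (\<Sum>y\<in>S. \<Sum>i\<in>UNIV. \<bar>y $ i\<bar>)"
    using assms y by (intro member_le_sum[of y S]) (auto simp: sum_nonneg)
  finally show "\<bar>y $ i\<bar> \<le> int (nat (\<Sum>y\<in>S. \<Sum>i\<in>UNIV. \<bar>y $ i\<bar>))" by linarith
qed

lemma centered_box_abs_le:
  assumes "z \<in> centered_box N"
  shows "\<bar>real_of_int (z $ i)\<bar> \<le> real N / 2"
proof -
  have "- (real N / 2) < real_of_int (z $ i)" "real_of_int (z $ i) \<le> real N / 2"
    using assms by (auto simp: centered_box_def)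
  then show ?thesis by linarith
qed

text \<open>
  On the whole lattice the Gram matrix of the edge coefficients is \<open>P\<^sup>2\<^sup>k + P\<^sup>2\<^sup>k\<^sup>+\<^sup>1\<close>, and the difference is
  the contribution of the edges that do not start in \<open>F\<close>. For finitely many points the lattice can be
  replaced by a torus of side \<open>M\<close> on which neither the kernels between these points nor the edge
  coefficients wrap around.
\<close>

lemma psd_lattice_outside:
  assumes F: "finite F"
  shows "psd (\<lambda>x y. lattice_kernel (2 * k) (x - y) + lattice_kernel (2 * k + 1) (x - y)
    - edge_gram F (lattice_edge k x) (lattice_edge k (y :: int ^ 'd::finite)))"
proof (rule psdI)
  fix J :: "(int ^ 'd) set" and a assume J: "finite J"
  obtain B where B: "\<And>y i. y \<in> J \<union> F \<Longrightarrow> \<bar>y $ i\<bar> \<le> int B"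
    using finite_imp_bounded_entries[of "J \<union> F"] J F by auto
  \<comment> \<open>edge coefficients need \<open>B + M/2 + 1 + k < M\<close>, the kernel of order \<open>2k + 1\<close> needs \<open>2B + 2k + 1 < M\<close>\<close>
  define M where "M = 2 * B + 2 * k + 4"
  have M: "M \<ge> 1" by (simp add: M_def)
  have FM: "F \<subseteq> centered_box M"
  proof
    fix z assume "z \<in> F"
    then have "\<bar>real_of_int (z $ i)\<bar> \<le> real B" for i
      using B[of z i] by (metis UnCI of_int_abs of_int_le_iff of_int_of_nat_eq)
    then have "- (real M / 2) < real_of_int (z $ i) \<and> real_of_int (z $ i) \<le> real M / 2" for i
      using abs_le_D1[of "real_of_int (z $ i)" "real B"] abs_le_D2[of "real_of_int (z $ i)" "real B"]
      unfolding M_def by (simp add: field_simps)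
    then show "z \<in> centered_box M" by (simp add: centered_box_def)
  qed
  let ?v = "\<lambda>x. lattice_edge k x"
  have "lattice_kernel (2 * k) (x - y) + lattice_kernel (2 * k + 1) (x - y) - edge_gram F (?v x) (?v y)
      = edge_gram (centered_box M - F) (?v x) (?v y)" if "x \<in> J" "y \<in> J" for x y
  proof -
    have edge: "torus_edge M k x z i = lattice_edge k x z i" if "z \<in> centered_box M" "x \<in> J" for x z i
    proof (rule torus_edge_eq_lattice_edge)
      fix j
      have "\<bar>real_of_int (z $ j)\<bar> \<le> real M / 2" using that by (intro centered_box_abs_le)
      then have "\<bar>z $ j\<bar> \<le> int (B + k + 2)" by (simp add: M_def)
      then show "\<bar>x $ j - z $ j\<bar> + int k + 1 < int M"
        using B[of x j] that by (simp add: M_def)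
    qed
    have "\<bar>(x - y) $ i\<bar> + int (2 * k + 1) < int M" "\<bar>(x - y) $ i\<bar> + int (2 * k) < int M" for i
      using B[of x i] B[of y i] that by (simp_all add: M_def)
    then have "lattice_kernel (2 * k) (x - y) + lattice_kernel (2 * k + 1) (x - y)
        = torus_kernel M (2 * k) (x - y) + torus_kernel M (2 * k + 1) (x - y)"
      by (simp only: torus_kernel_eq_lattice_kernel)
    also have "\<dots> = edge_gram (centered_box M) (torus_edge M k x) (torus_edge M k y)"
      by (simp add: edge_gram_torus[OF M])
    also have "\<dots> = edge_gram (centered_box M) (?v x) (?v y)"
      using that by (intro edge_gram_cong edge)
    also have "\<dots> = edge_gram (centered_box M - F) (?v x) (?v y) + edge_gram F (?v x) (?v y)"
      unfolding edge_gram_def sum.subset_diff[OF FM finite_centered_box[OF M]]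
      by (simp add: sum.distrib add_divide_distrib)
    finally show ?thesis by simp
  qed
  then have "(\<Sum>x\<in>J. \<Sum>y\<in>J. a x * a y * (lattice_kernel (2 * k) (x - y) + lattice_kernel (2 * k + 1) (x - y) - edge_gram F (?v x) (?v y)))
      = (\<Sum>x\<in>J. \<Sum>y\<in>J. a x * a y * edge_gram (centered_box M - F) (?v x) (?v y))"
    by (intro sum.cong refl) simp
  also have "\<dots> \<ge> 0"
    using psd_edge_gram[of "centered_box M - F" ?v] finite_centered_box[OF M] J by (intro psdD) auto
  finally show "0 \<le> (\<Sum>x\<in>J. \<Sum>y\<in>J. a x * a y * (lattice_kernel (2 * k) (x - y) + lattice_kernel (2 * k + 1) (x - y) - edge_gram F (?v x) (?v y)))" .
qed

lemma lattice_kernel_pair_sums: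
  assumes "CARD('d::finite) \<ge> 3"
  shows "(\<lambda>k. lattice_kernel (2 * k) (x - y) + lattice_kernel (2 * k + 1) (x - y)) sums green_lattice x (y :: int ^ 'd)"
proof -
  have "(\<lambda>k. lattice_kernel k (x - y)) sums green_lattice x y"
    unfolding green_lattice_eq by (rule summable_sums[OF lattice_kernel_summable(1)[OF assms]])
  from sums_group[OF this, of 2] show ?thesis by (simp add: numeral_2_eq_2 mult.commute)
qed

text \<open>
  What the lattice field still needs besides the edge noise of the centered box: the noise outside of
  the box for times below \<open>R\<close>, and all the noise for later times.
\<close>

definition lattice_rest :: "nat \<Rightarrow> nat \<Rightarrow> int ^ 'd::finite \<Rightarrow> int ^ 'd \<Rightarrow> real" where
  "lattice_rest N R x y = green_lattice x y - (\<Sum>k<R. edge_gram (centered_box N) (lattice_edge k x) (lattice_edge k y))"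

text \<open>
  For times \<open>k \<ge> R\<close> the set of edges to be removed is empty, so the kernel is a limit of sums of the
  kernels of lemma \<open>psd_lattice_outside\<close>.
\<close>

lemma psd_lattice_rest:
  assumes d: "CARD('d::finite) \<ge> 3" and N: "N \<ge> 1"
  shows "psd (lattice_rest N R :: int ^ 'd \<Rightarrow> int ^ 'd \<Rightarrow> real)"
proof (rule psd_limit)
  define F :: "nat \<Rightarrow> (int ^ 'd) set" where "F k = (if k < R then centered_box N else {})" for k
  show "psd (\<lambda>x y. \<Sum>k<K. lattice_kernel (2 * k) (x - y) + lattice_kernel (2 * k + 1) (x - y)
    - edge_gram (F k) (lattice_edge k x) (lattice_edge k (y :: int ^ 'd)))" for K
    by (intro psd_sum psd_lattice_outside) (auto simp: F_def finite_centered_box[OF N])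
  fix x y :: "int ^ 'd"
  have "(\<lambda>k. edge_gram (F k) (lattice_edge k x) (lattice_edge k y)) sums (\<Sum>k<R. edge_gram (F k) (lattice_edge k x) (lattice_edge k y))"
    by (rule sums_finite) (auto simp: F_def edge_gram_def)
  also have "(\<Sum>k<R. edge_gram (F k) (lattice_edge k x) (lattice_edge k y))
      = (\<Sum>k<R. edge_gram (centered_box N) (lattice_edge k x) (lattice_edge k y))"
    by (simp add: F_def)
  finally have "(\<lambda>k. lattice_kernel (2 * k) (x - y) + lattice_kernel (2 * k + 1) (x - y)
      - edge_gram (F k) (lattice_edge k x) (lattice_edge k y)) sums lattice_rest N R x y"
    unfolding lattice_rest_def by (intro sums_diff lattice_kernel_pair_sums[OF d])
  then show "(\<lambda>K. \<Sum>k<K. lattice_kernel (2 * k) (x - y) + lattice_kernel (2 * k + 1) (x - y)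
      - edge_gram (F k) (lattice_edge k x) (lattice_edge k y)) \<longlonglongrightarrow> lattice_rest N R x y"
    by (simp add: sums_def)
qed

text \<open>
  The left summand of the index type stands for the torus, the right one for the lattice. Torus points
  are arbitrary lattice vectors here; all torus kernels are periodic.
\<close>

definition coupled_edge :: "nat \<Rightarrow> nat \<Rightarrow> int ^ 'd + int ^ 'd \<Rightarrow> int ^ 'd \<Rightarrow> 'd::finite \<Rightarrow> real" where
  "coupled_edge N k s z i = (case s of
     Inl x \<Rightarrow> torus_edge N k x z i - 2 / real N ^ CARD('d)
   | Inr y \<Rightarrow> lattice_edge k y z i)"

lemma coupled_edge_simps:
  "coupled_edge N k (Inl x) = (\<lambda>z i. torus_edge N k x z i - 2 / real N ^ CARD('d::finite))"
  "coupled_edge N k (Inr y) = (lattice_edge k y :: int ^ 'd \<Rightarrow> 'd \<Rightarrow> real)"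
  for x y :: "int ^ 'd"
  by (simp_all add: coupled_edge_def fun_eq_iff)

definition torus_part :: "nat \<Rightarrow> nat \<Rightarrow> int ^ 'd + int ^ 'd \<Rightarrow> int ^ 'd + int ^ 'd::finite \<Rightarrow> real" where
  "torus_part N R s t = (case (s, t) of (Inl x, Inl y) \<Rightarrow> torus_tail N R (x - y) | _ \<Rightarrow> 0)"

definition lattice_part :: "nat \<Rightarrow> nat \<Rightarrow> int ^ 'd + int ^ 'd \<Rightarrow> int ^ 'd + int ^ 'd::finite \<Rightarrow> real" where
  "lattice_part N R s t = (case (s, t) of (Inr x, Inr y) \<Rightarrow> lattice_rest N R x y | _ \<Rightarrow> 0)"

text \<open>
  The edge noise of the centered box is shared, the two remainders are independent of it and of each
  other.
\<close>

definition coupling_kernel :: "nat \<Rightarrow> nat \<Rightarrow> int ^ 'd + int ^ 'd \<Rightarrow> int ^ 'd + int ^ 'd::finite \<Rightarrow> real" where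
  "coupling_kernel N R s t = (\<Sum>k<R. edge_gram (centered_box N) (coupled_edge N k s) (coupled_edge N k t))
     + (torus_part N R s t + lattice_part N R s t)"

lemma psd_coupling_kernel:
  assumes d: "CARD('d::finite) \<ge> 3" and N: "N \<ge> 1"
  shows "psd (coupling_kernel N R :: int ^ 'd + int ^ 'd \<Rightarrow> _)"
proof -
  have "psd (torus_part N R :: int ^ 'd + int ^ 'd \<Rightarrow> _)"
    by (rule psd_extend[of _ Inl]) (auto simp: torus_part_def psd_torus_tail split: sum.split)
  moreover have "psd (lattice_part N R :: int ^ 'd + int ^ 'd \<Rightarrow> _)"
    using psd_lattice_rest[OF d N, of R]
    by (intro psd_extend[of _ Inr]) (auto simp: lattice_part_def split: sum.split)
  ultimately have "psd (\<lambda>s t :: int ^ 'd + int ^ 'd. coupling_kernel N R s t)"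
    unfolding coupling_kernel_def
    by (intro psd_add psd_sum psd_edge_gram finite_centered_box[OF N]) auto
  then show ?thesis .
qed

lemma torus_tail_minus: "torus_tail N R (x - y) = torus_tail N R (y - x)"
  by (simp add: torus_tail_def phase_diff cos_diff mult_ac)

lemma lattice_kernel_minus: "lattice_kernel k (x - y) = lattice_kernel k (y - x)"
proof -
  obtain B where B: "\<And>z i. z \<in> {x, y} \<Longrightarrow> \<bar>z $ i\<bar> \<le> int B"
    using finite_imp_bounded_entries[of "{x, y}"] by auto
  have "\<bar>(x - y) $ i\<bar> + int k < int (2 * B + k + 1)" "\<bar>(y - x) $ i\<bar> + int k < int (2 * B + k + 1)" for i
    using B[of x i] B[of y i] by auto
  then show ?thesis
    using torus_kernel_eq_lattice_kernel[of "x - y" k] torus_kernel_eq_lattice_kernel[of "y - x" k]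
      torus_kernel_sym[of "2 * B + k + 1" k x y] by metis
qed

lemma coupling_kernel_sym: "coupling_kernel N R s t = coupling_kernel N R t s"
proof -
  have "green_lattice x y = green_lattice y x" for x y :: "int ^ 'a"
    by (simp add: green_lattice_eq lattice_kernel_minus[of _ x y])
  then have "lattice_rest N R x y = lattice_rest N R y x" for x y :: "int ^ 'a"
    unfolding lattice_rest_def by (intro arg_cong2[where f = "(-)"] sum.cong edge_gram_sym refl)
  then have "lattice_part N R s t = lattice_part N R t s"
    by (auto simp: lattice_part_def split: sum.split)
  moreover have "torus_part N R s t = torus_part N R t s"
    by (auto simp: torus_part_def intro: torus_tail_minus split: sum.split)
  ultimately show ?thesis
    unfolding coupling_kernel_def by (intro arg_cong2[where f = "(+)"] sum.cong edge_gram_sym refl)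
qed

lemma coupling_kernel_torus:
  assumes "N \<ge> 1" "x \<in> torus N" "y \<in> torus N"
  shows "coupling_kernel N R (Inl x) (Inl y) = green_torus N x y"
  unfolding green_torus_eq[OF assms] torus_tail_0_eq[OF assms(1), of _ R]
  by (simp add: coupling_kernel_def torus_part_def lattice_part_def coupled_edge_simps edge_gram_centered[OF assms(1)])

lemma coupling_kernel_lattice: "coupling_kernel N R (Inr x) (Inr y) = green_lattice x y"
  by (simp add: coupling_kernel_def torus_part_def lattice_part_def coupled_edge_simps lattice_rest_def)


section \<open>Variance of the difference of the fields\<close>

text \<open>
  Short-range terms of order below \<open>\<surd>N / 2\<close> do not wrap around from the boxes of any \<open>\<delta> > 1/2\<close>, so
  this choice makes the coupling independent of \<open>\<delta>\<close>.
\<close>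

definition coupling_range :: "nat \<Rightarrow> nat" where
  "coupling_range N = nat \<lceil>sqrt (real N) / 2\<rceil>"

lemma coupling_range_bounds:
  assumes "N \<ge> 1"
  shows "k < coupling_range N \<Longrightarrow> real k < sqrt (real N) / 2"
    and "sqrt (real N) \<le> real (2 * coupling_range N)"
    and "real (2 * coupling_range N) < sqrt (real N) + 2"
    and "coupling_range N \<ge> 1"
proof -
  have pos: "sqrt (real N) / 2 > 0" using assms by simp
  then have c: "\<lceil>sqrt (real N) / 2\<rceil> \<ge> 1" by linarith
  have "real (coupling_range N) = of_int \<lceil>sqrt (real N) / 2\<rceil>"
    using c by (simp add: coupling_range_def)
  then have b: "sqrt (real N) / 2 \<le> real (coupling_range N)" "real (coupling_range N) < sqrt (real N) / 2 + 1"
    using ceiling_correct[of "sqrt (real N) / 2"] by linarith+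
  show "sqrt (real N) \<le> real (2 * coupling_range N)" "real (2 * coupling_range N) < sqrt (real N) + 2"
    using b by simp_all
  have "0 < real (coupling_range N)" using b pos by linarith
  then show "coupling_range N \<ge> 1" by simp
  assume "k < coupling_range N"
  then have "real k \<le> real (coupling_range N) - 1" by linarith
  then show "real k < sqrt (real N) / 2" using b by linarith
qed

lemma lattice_box_bounds:
  fixes y :: "int ^ 'd::finite"
  assumes "y \<in> lattice_box N \<delta>" "1 / 2 < \<delta>" "N \<ge> 1"
  shows "\<bar>real_of_int (y $ i)\<bar> \<le> real N / 2 - sqrt (real N) / 2 - 1"
    and "sqrt (real N) + 2 < real N"
proof -
  have y: "- ((real N - real N powr \<delta> - 2) / 2) < real_of_int (y $ i)"
    "real_of_int (y $ i) \<le> (real N - real N powr \<delta> - 2) / 2" for i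
    using assms(1) by (auto simp: lattice_box_def)
  have "real N powr (1 / 2) \<le> real N powr \<delta>" using assms by (intro powr_mono) auto
  then have p: "sqrt (real N) \<le> real N powr \<delta>" by (simp add: powr_half_sqrt)
  show "\<bar>real_of_int (y $ i)\<bar> \<le> real N / 2 - sqrt (real N) / 2 - 1"
    using y[of i] p by (simp add: abs_le_iff field_simps)
  show "sqrt (real N) + 2 < real N" using y[of i] p by (simp add: field_simps)
qed

lemma lattice_box_subset_centered_box:
  assumes "y \<in> lattice_box N \<delta>" "1 / 2 < \<delta>" "N \<ge> 1"
  shows "y \<in> centered_box N"
proof -
  have "- (real N / 2) < real_of_int (y $ i) \<and> real_of_int (y $ i) \<le> real N / 2" for i
    using lattice_box_bounds(1)[OF assms, of i] real_sqrt_ge_zero[of "real N"] by linarith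
  then show ?thesis by (simp add: centered_box_def)
qed

lemma lift_proj:
  assumes "y \<in> centered_box N"
  shows "lift N (proj N y) = y"
  unfolding lift_def
proof (rule the_equality)
  show "proj N y = proj N y \<and> (\<forall>i. - (real N / 2) < real_of_int (y $ i) \<and> real_of_int (y $ i) \<le> real N / 2)"
    using assms by (simp add: centered_box_def)
  fix z assume "proj N z = proj N y \<and> (\<forall>i. - (real N / 2) < real_of_int (z $ i) \<and> real_of_int (z $ i) \<le> real N / 2)"
  then show "z = y" using assms by (intro centered_representative_unique[of z N y]) (auto simp: centered_box_def)
qed

text \<open>
  A box point and a point of the centered box differ by at most \<open>N - \<surd>N / 2 - 1\<close> in each coordinate, and
  \<open>k < \<surd>N / 2\<close>, so neither the kernel to \<open>z\<close> nor that to \<open>z + e\<^sub>i\<close> wraps around.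
\<close>

lemma torus_edge_eq_lattice_edge_box:
  fixes y :: "int ^ 'd::finite"
  assumes y: "y \<in> lattice_box N \<delta>" and \<delta>: "1 / 2 < \<delta>" and N: "N \<ge> 1"
    and k: "k < coupling_range N" and z: "z \<in> centered_box N"
  shows "torus_edge N k (proj N y) z i = lattice_edge k y z i"
proof -
  have "torus_kernel N k (proj N y - w) = torus_kernel N k (y - w)" for w
    by (rule torus_kernel_cong[OF proj_diff_cong N]) simp
  from this[of z] this[of "z + axis i 1"]
  have "torus_edge N k (proj N y) z i = torus_edge N k y z i"
    by (simp add: torus_edge_def diff_diff_eq)
  also have "\<dots> = lattice_edge k y z i"
  proof (rule torus_edge_eq_lattice_edge)
    fix j
    have "\<bar>real_of_int (z $ j)\<bar> \<le> real N / 2"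
      by (rule centered_box_abs_le[OF z])
    then have "\<bar>real_of_int (y $ j) - real_of_int (z $ j)\<bar> + real k + 1 < real N"
      using lattice_box_bounds(1)[OF y \<delta> N, of j] coupling_range_bounds(1)[OF N k] by linarith
    then show "\<bar>y $ j - z $ j\<bar> + int k + 1 < int N" by linarith
  qed
  finally show ?thesis .
qed

text \<open>
  The variance of \<open>\<Psi> - \<phi>\<close> at the box point \<open>y\<close>.
\<close>

definition field_error :: "nat \<Rightarrow> int ^ 'd::finite \<Rightarrow> real" where
  "field_error N y = (let K = coupling_kernel N (coupling_range N) in
     K (Inl (proj N y)) (Inl (proj N y)) - 2 * K (Inl (proj N y)) (Inr y) + K (Inr y) (Inr y))"

text \<open>
  On the centered box the coefficients of the two short-range fields differ by the constant \<open>2 / N\<^sup>d\<close>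
  only, which leaves a variance \<open>2 / N\<^sup>d\<close> for each time. The edges starting outside of the box carry
  no coefficient of \<open>y\<close> for times below \<open>R\<close>, so the lattice remainder at \<open>y\<close> is the tail of the Green
  series.
\<close>

lemma field_error_eq:
  fixes y :: "int ^ 'd::finite"
  assumes d: "CARD('d) \<ge> 3" and y: "y \<in> lattice_box N \<delta>" and \<delta>: "1 / 2 < \<delta>" and N: "N \<ge> 1"
  shows "field_error N y = 2 * real (coupling_range N) / real N ^ CARD('d)
    + torus_tail N (coupling_range N) (0 :: int ^ 'd)
    + (\<Sum>m. lattice_kernel (m + 2 * coupling_range N) (0 :: int ^ 'd))"
proof -
  let ?R = "coupling_range N"
  let ?c = "2 / real N ^ CARD('d)"
  let ?x = "proj N y"
  let ?F = "centered_box N :: (int ^ 'd) set"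
  let ?q = "\<lambda>k. lattice_kernel (2 * k) (0 :: int ^ 'd) + lattice_kernel (2 * k + 1) (0 :: int ^ 'd)"
  have edge: "torus_edge N k ?x z i = lattice_edge k y z i" if "k < ?R" "z \<in> ?F" for k z i
    by (rule torus_edge_eq_lattice_edge_box[OF y \<delta> N that])
  have q: "torus_kernel N (2 * k) (0 :: int ^ 'd) + torus_kernel N (2 * k + 1) (0 :: int ^ 'd) = ?q k" if "k < ?R" for k
  proof -
    have "real (2 * k + 1) < real N"
      using coupling_range_bounds(1)[OF N that] lattice_box_bounds(2)[OF y \<delta> N] by simp
    then have "2 * k + 1 < N" by linarith
    then show ?thesis by (simp add: torus_kernel_eq_lattice_kernel)
  qed
  have LL: "edge_gram ?F (lattice_edge k y) (lattice_edge k y) = ?q k" if "k < ?R" for k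
  proof -
    have "edge_gram ?F (lattice_edge k y) (lattice_edge k y) = edge_gram ?F (torus_edge N k ?x) (torus_edge N k ?x)"
      using edge[OF that] by (intro edge_gram_cong) auto
    then show ?thesis using q[OF that] by (simp add: edge_gram_torus[OF N])
  qed
  have TT: "edge_gram ?F (coupled_edge N k (Inl ?x)) (coupled_edge N k (Inl ?x)) = ?q k - ?c" if "k < ?R" for k
    using q[OF that] by (simp add: coupled_edge_simps edge_gram_centered[OF N])
  have TL: "edge_gram ?F (coupled_edge N k (Inl ?x)) (coupled_edge N k (Inr y)) = ?q k - ?c" if "k < ?R" for k
  proof -
    have "edge_gram ?F (coupled_edge N k (Inl ?x)) (coupled_edge N k (Inr y))
        = edge_gram ?F (\<lambda>z i. torus_edge N k ?x z i - ?c) (torus_edge N k ?x)"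
      using edge[OF that] by (intro edge_gram_cong) (auto simp: coupled_edge_simps)
    also have "\<dots> = edge_gram ?F (torus_edge N k ?x) (torus_edge N k ?x)
        - ?c * (\<Sum>i\<in>(UNIV :: 'd set). \<Sum>z\<in>?F. torus_edge N k ?x z i) / (2 * real CARD('d))"
      by (simp add: edge_gram_def left_diff_distrib sum_subtractf sum_distrib_left diff_divide_distrib)
    also have "\<dots> = ?q k - ?c"
      using q[OF that] by (simp add: edge_gram_torus[OF N] torus_edge_mass[OF N])
    finally show ?thesis .
  qed
  have rest: "lattice_rest N ?R y y = (\<Sum>m. lattice_kernel (m + 2 * ?R) (0 :: int ^ 'd))"
  proof -
    have "(\<Sum>k<?R. ?q k) = (\<Sum>m<2 * ?R. lattice_kernel m (0 :: int ^ 'd))"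
      using sum.nat_group[of "\<lambda>m. lattice_kernel m (0 :: int ^ 'd)" 2 ?R]
      by (simp add: numeral_2_eq_2 mult.commute)
    then show ?thesis
      using suminf_minus_initial_segment[OF lattice_kernel_summable(1)[OF d, of 0], of "2 * ?R"]
      by (simp add: lattice_rest_def LL green_lattice_eq)
  qed
  have "field_error N y = (\<Sum>k<?R. ?q k - ?c) + torus_tail N ?R (0 :: int ^ 'd)
      - 2 * (\<Sum>k<?R. ?q k - ?c) + ((\<Sum>k<?R. ?q k) + lattice_rest N ?R y y)"
    by (simp add: field_error_def coupling_kernel_def torus_part_def lattice_part_def TT TL LL[unfolded coupled_edge_simps(2)[symmetric]])
       (simp add: coupled_edge_simps LL)
  then show ?thesis by (simp add: rest sum_subtractf)
qed

text \<open>
  The summand 1 bounds the variance of the spatial mean. The factor \<open>8 + d\<close> collects \<open>4\<close> for the lattice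
  tail, \<open>4\<close> for the torus tail up to time \<open>N\<^sup>2\<close> and \<open>d\<close> for the torus tail after that time.
\<close>

definition error_const :: "nat \<Rightarrow> real" where
  "error_const d = 1 + heat_const d * (8 + real d)"

lemma error_const_pos: "error_const d > 0"
  by (simp add: error_const_def heat_const_nonneg add_pos_nonneg)

lemma field_error_le:
  fixes y :: "int ^ 'd::finite"
  assumes d: "CARD('d) \<ge> 3" and y: "y \<in> lattice_box N \<delta>" and \<delta>: "1 / 2 < \<delta>" and N: "N \<ge> 1"
  shows "field_error N y \<le> error_const CARD('d) * real N powr (- (1 / 4))"
proof -
  let ?R = "coupling_range N"
  let ?H = "heat_const CARD('d)"
  let ?r = "real N powr (- (1 / 4))"
  note R = coupling_range_bounds[OF N]
  have big: "sqrt (real N) + 2 < real N" by (rule lattice_box_bounds(2)[OF y \<delta> N])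
  have inv: "1 / real N \<le> ?r"
  proof -
    have "real N powr (- 1) \<le> ?r" using N by (intro powr_mono) auto
    then show ?thesis using N by (simp add: powr_minus_divide)
  qed
  have root: "4 / sqrt (real (2 * ?R)) \<le> 4 * ?r"
  proof -
    have "sqrt (sqrt (real N)) \<le> sqrt (real (2 * ?R))" using R(2) by simp
    then have "4 / sqrt (real (2 * ?R)) \<le> 4 / sqrt (sqrt (real N))"
      using N R(4) by (intro divide_left_mono) auto
    also have "sqrt (sqrt (real N)) = real N powr (1 / 4)"
      using N by (simp add: powr_half_sqrt[symmetric] powr_powr)
    finally show ?thesis by (simp add: powr_minus_divide)
  qed
  have "2 * real ?R / real N ^ CARD('d) \<le> 1 / real N"
  proof -
    have "real N ^ 2 \<le> real N ^ CARD('d)" using N d by (intro power_increasing) auto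
    moreover have "2 * real ?R \<le> real N" using R(3) big by simp
    ultimately have "2 * real ?R / real N ^ CARD('d) \<le> real N / real N ^ 2"
      using N by (intro frac_le) auto
    then show ?thesis using N by (simp add: power2_eq_square)
  qed
  then have zero_mode: "2 * real ?R / real N ^ CARD('d) \<le> ?r" using inv by linarith
  have "2 * ?R < N\<^sup>2"
  proof -
    have "real (2 * ?R) < real N" using R(3) big by linarith
    then have "2 * ?R < N" by linarith
    also have "N \<le> N\<^sup>2" by (simp add: power2_eq_square)
    finally show ?thesis .
  qed
  then have "torus_tail N ?R (0 :: int ^ 'd) \<le> ?H * (4 / sqrt (real (2 * ?R)) + real CARD('d) / real N)"
    using torus_tail_0_le[OF d N R(4)] by blast
  also have "\<dots> \<le> ?H * (4 * ?r + real CARD('d) * ?r)"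
    using root mult_left_mono[OF inv, of "real CARD('d)"]
    by (intro mult_left_mono add_mono heat_const_nonneg) auto
  finally have torus: "torus_tail N ?R (0 :: int ^ 'd) \<le> ?H * (4 * ?r + real CARD('d) * ?r)" .
  have "(\<Sum>m. lattice_kernel (m + 2 * ?R) (0 :: int ^ 'd)) \<le> ?H * (4 / sqrt (real (2 * ?R)))"
    using R(4) by (intro lattice_kernel_summable(2)[OF d]) auto
  also have "\<dots> \<le> ?H * (4 * ?r)" by (intro mult_left_mono root heat_const_nonneg)
  finally have lattice: "(\<Sum>m. lattice_kernel (m + 2 * ?R) (0 :: int ^ 'd)) \<le> ?H * (4 * ?r)" .
  have "field_error N y \<le> ?r + ?H * (4 * ?r + real CARD('d) * ?r) + ?H * (4 * ?r)"
    unfolding field_error_eq[OF d y \<delta> N] using zero_mode torus lattice by linarith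
  then show ?thesis by (simp add: error_const_def algebra_simps)
qed


section \<open>The coupling\<close>

lemma gaussian_second_moment:
  fixes K :: "'i \<Rightarrow> 'i \<Rightarrow> real"
  assumes psd: "psd K" and J: "finite J" and X: "\<And>i. X i \<in> borel_measurable M"
    and law: "distr M borel (\<lambda>\<omega>. \<Sum>i\<in>J. a i * X i \<omega>) = centered_normal (sqrt (\<Sum>i\<in>J. \<Sum>j\<in>J. a i * a j * K i j))"
  shows "has_bochner_integral M (\<lambda>\<omega>. (\<Sum>i\<in>J. a i * X i \<omega>)\<^sup>2) (\<Sum>i\<in>J. \<Sum>j\<in>J. a i * a j * K i j)"
proof -
  let ?v = "\<Sum>i\<in>J. \<Sum>j\<in>J. a i * a j * K i j"
  have v: "?v \<ge> 0" by (rule psdD[OF psd J])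
  have "has_bochner_integral (distr M borel (\<lambda>\<omega>. \<Sum>i\<in>J. a i * X i \<omega>)) (\<lambda>x. x\<^sup>2) ?v"
    unfolding law using centered_normal_second_moment[of "sqrt ?v"] v by simp
  moreover have "(\<lambda>\<omega>. \<Sum>i\<in>J. a i * X i \<omega>) \<in> borel_measurable M" using X by measurable
  ultimately show ?thesis
    by (simp add: has_bochner_integral_iff integrable_distr_eq integral_distr)
qed

text \<open>
  Polarization: the one-dimensional laws determine second moments of sums and differences.
\<close>

lemma gaussian_covariance:
  fixes K :: "'i \<Rightarrow> 'i \<Rightarrow> real"
  assumes psd: "psd K" and sym: "\<And>i j. K i j = K j i" and X: "\<And>i. X i \<in> borel_measurable M"
    and law: "\<And>J a. finite J \<Longrightarrow> distr M borel (\<lambda>\<omega>. \<Sum>i\<in>J. a i * X i \<omega>)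
      = centered_normal (sqrt (\<Sum>i\<in>J. \<Sum>j\<in>J. a i * a j * K i j))"
  shows "(LINT \<omega>|M. X s \<omega> * X t \<omega>) = K s t"
proof (cases "s = t")
  case True
  show ?thesis
    using gaussian_second_moment[OF psd _ X law, of "{s}" "\<lambda>_. 1"] True
    by (simp add: has_bochner_integral_iff power2_eq_square)
next
  case False
  have "has_bochner_integral M (\<lambda>\<omega>. (X s \<omega> + c * X t \<omega>)\<^sup>2) (K s s + 2 * c * K s t + c\<^sup>2 * K t t)" for c
    using gaussian_second_moment[OF psd _ X law, of "{s, t}" "\<lambda>i. if i = s then 1 else c"] False
    by (simp add: sym[of t s] power2_eq_square algebra_simps)
  from has_bochner_integral_diff[OF this[of 1] this[of "- 1"]]
  have "has_bochner_integral M (\<lambda>\<omega>. 4 * (X s \<omega> * X t \<omega>)) (4 * K s t)"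
    by (simp add: power2_eq_square algebra_simps)
  then show ?thesis by (simp add: has_bochner_integral_iff)
qed

lemma ex_coupling:
  fixes N :: nat
  assumes d: "CARD('d::finite) \<ge> 3" and N: "N \<ge> 1"
  shows "\<exists>Q :: 'd field_pair measure. gff_coupling N Q \<and>
    (\<forall>\<delta> y \<epsilon>. 1 / 2 < \<delta> \<longrightarrow> y \<in> lattice_box N \<delta> \<longrightarrow> 0 < \<epsilon> \<longrightarrow>
      \<P>(\<omega> in Q. \<epsilon> < \<bar>fst \<omega> (proj N y) - snd \<omega> y\<bar>)
        \<le> 2 * exp (- (1 / (2 * error_const CARD('d)) * \<epsilon>\<^sup>2 * real N powr (1 / 4))))"
proof -
  define K where "K = (coupling_kernel N (coupling_range N) :: int ^ 'd + int ^ 'd \<Rightarrow> _)"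
  have psd: "psd K" unfolding K_def by (rule psd_coupling_kernel[OF d N])
  have sym: "K s t = K t s" for s t unfolding K_def by (rule coupling_kernel_sym)
  obtain X :: "int ^ 'd + int ^ 'd \<Rightarrow> (nat \<Rightarrow> real) \<Rightarrow> real"
    where X: "\<And>s. X s \<in> borel_measurable white_noise"
      and law: "\<And>J a. finite J \<Longrightarrow> distr white_noise borel (\<lambda>\<omega>. \<Sum>s\<in>J. a s * X s \<omega>)
        = centered_normal (sqrt (\<Sum>s\<in>J. \<Sum>t\<in>J. a s * a t * K s t))"
    using ex_gaussian_field[OF psd sym] by blast
  note [measurable] = X
  have cov: "(LINT \<omega>|white_noise. X s \<omega> * X t \<omega>) = K s t" for s t
    by (rule gaussian_covariance[OF psd sym X law])
  let ?S = "PiM (torus N :: (int ^ 'd) set) (\<lambda>_. borel :: real measure) \<Otimes>\<^sub>M PiM (UNIV :: (int ^ 'd) set) (\<lambda>_. borel :: real measure)"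
  define \<Phi> where "\<Phi> = (\<lambda>\<omega>. (\<lambda>x\<in>torus N. X (Inl x) \<omega>, \<lambda>y. X (Inr y) \<omega>))"
  have \<Phi> [measurable]: "\<Phi> \<in> measurable white_noise ?S"
    unfolding \<Phi>_def by (intro measurable_Pair measurable_restrict measurable_PiM_single') auto
  define Q where "Q = distr white_noise ?S \<Phi>"
  interpret W: prob_space white_noise by (rule prob_space_white_noise)
  have sets_Q: "sets Q = sets ?S" by (simp add: Q_def)
  have fst_comp [measurable]: "(\<lambda>\<omega>. fst \<omega> x) \<in> borel_measurable ?S" if "x \<in> torus N" for x
    using that by measurable
  have snd_comp [measurable]: "(\<lambda>\<omega>. snd \<omega> y) \<in> borel_measurable ?S" for y
    by measurable
  have fst_\<Phi>: "fst (\<Phi> \<omega>) x = X (Inl x) \<omega>" if "x \<in> torus N" for x \<omega>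
    using that by (simp add: \<Phi>_def)
  have snd_\<Phi>: "snd (\<Phi> \<omega>) y = X (Inr y) \<omega>" for y \<omega> by (simp add: \<Phi>_def)
  have distr_Q: "distr Q borel f = distr white_noise borel (\<lambda>\<omega>. f (\<Phi> \<omega>))" if "f \<in> borel_measurable ?S" for f :: "_ \<Rightarrow> real"
    unfolding Q_def using that by (subst distr_distr) (auto simp: comp_def)
  have Q_borel: "f \<in> borel_measurable Q" if "f \<in> borel_measurable ?S" for f :: "_ \<Rightarrow> real"
    using that by (simp add: measurable_cong_sets[OF sets_Q refl])
  have "centered_gaussian_field Q (torus N) (\<lambda>x \<omega>. fst \<omega> x) (green_torus N)"
    unfolding centered_gaussian_field_def
  proof (intro conjI ballI allI impI)
    show "(\<lambda>\<omega>. fst \<omega> x) \<in> borel_measurable Q" if "x \<in> torus N" for x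
      using that by (intro Q_borel fst_comp)
    fix J :: "(int ^ 'd) set" and a assume J: "finite J" "J \<subseteq> torus N"
    let ?v = "\<Sum>s\<in>Inl ` J. \<Sum>t\<in>Inl ` J. case_sum a (\<lambda>_. 0) s * case_sum a (\<lambda>_. 0) t * K s t"
    have "(\<lambda>\<omega>. \<Sum>x\<in>J. a x * fst \<omega> x) \<in> borel_measurable ?S"
      using J(2) by (intro borel_measurable_sum borel_measurable_times fst_comp) auto
    then have "distr Q borel (\<lambda>\<omega>. \<Sum>x\<in>J. a x * fst \<omega> x) = distr white_noise borel (\<lambda>\<omega>. \<Sum>x\<in>J. a x * X (Inl x) \<omega>)"
      using J(2) by (subst distr_Q) (auto intro!: distr_cong sum.cong simp: fst_\<Phi> subset_iff)
    also have "\<dots> = distr white_noise borel (\<lambda>\<omega>. \<Sum>s\<in>Inl ` J. case_sum a (\<lambda>_. 0) s * X s \<omega>)"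
      by (simp add: sum.reindex)
    also have "\<dots> = centered_normal (sqrt ?v)"
      using J(1) by (intro law) auto
    finally have "distr Q borel (\<lambda>\<omega>. \<Sum>x\<in>J. a x * fst \<omega> x) = centered_normal (sqrt ?v)" .
    moreover have "0 \<le> sqrt ?v"
      using J by (intro real_sqrt_ge_zero psdD[OF psd]) auto
    ultimately show "\<exists>\<sigma>\<ge>0. distr Q borel (\<lambda>\<omega>. \<Sum>x\<in>J. a x * fst \<omega> x) = centered_normal \<sigma>"
      by blast
  next
    fix x y :: "int ^ 'd" assume xy: "x \<in> torus N" "y \<in> torus N"
    then have "(LINT \<omega>|Q. fst \<omega> x * fst \<omega> y) = (LINT \<omega>|white_noise. X (Inl x) \<omega> * X (Inl y) \<omega>)"
      unfolding Q_def by (subst integral_distr) (auto simp: fst_\<Phi> intro!: borel_measurable_times fst_comp)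
    then show "(LINT \<omega>|Q. fst \<omega> x * fst \<omega> y) = green_torus N x y"
      unfolding cov K_def coupling_kernel_torus[OF N xy] .
  qed
  moreover have "centered_gaussian_field Q UNIV (\<lambda>x \<omega>. snd \<omega> x) green_lattice"
    unfolding centered_gaussian_field_def
  proof (intro conjI ballI allI impI)
    show "(\<lambda>\<omega>. snd \<omega> x) \<in> borel_measurable Q" for x
      by (intro Q_borel snd_comp)
    fix J :: "(int ^ 'd) set" and a assume J: "finite J"
    let ?v = "\<Sum>s\<in>Inr ` J. \<Sum>t\<in>Inr ` J. case_sum (\<lambda>_. 0) a s * case_sum (\<lambda>_. 0) a t * K s t"
    have "distr Q borel (\<lambda>\<omega>. \<Sum>x\<in>J. a x * snd \<omega> x) = distr white_noise borel (\<lambda>\<omega>. \<Sum>x\<in>J. a x * X (Inr x) \<omega>)"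
      by (subst distr_Q) (auto simp: snd_\<Phi> intro!: borel_measurable_sum borel_measurable_times snd_comp)
    also have "\<dots> = distr white_noise borel (\<lambda>\<omega>. \<Sum>s\<in>Inr ` J. case_sum (\<lambda>_. 0) a s * X s \<omega>)"
      by (simp add: sum.reindex)
    also have "\<dots> = centered_normal (sqrt ?v)"
      using J by (intro law) auto
    finally have "distr Q borel (\<lambda>\<omega>. \<Sum>x\<in>J. a x * snd \<omega> x) = centered_normal (sqrt ?v)" .
    moreover have "0 \<le> sqrt ?v"
      using J by (intro real_sqrt_ge_zero psdD[OF psd]) auto
    ultimately show "\<exists>\<sigma>\<ge>0. distr Q borel (\<lambda>\<omega>. \<Sum>x\<in>J. a x * snd \<omega> x) = centered_normal \<sigma>"
      by blast
  next
    fix x y :: "int ^ 'd"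
    have "(LINT \<omega>|Q. snd \<omega> x * snd \<omega> y) = (LINT \<omega>|white_noise. X (Inr x) \<omega> * X (Inr y) \<omega>)"
      unfolding Q_def by (subst integral_distr) (auto simp: snd_\<Phi> intro!: borel_measurable_times snd_comp)
    then show "(LINT \<omega>|Q. snd \<omega> x * snd \<omega> y) = green_lattice x y"
      unfolding cov K_def coupling_kernel_lattice .
  qed
  moreover have "prob_space Q" unfolding Q_def by (rule W.prob_space_distr[OF \<Phi>])
  ultimately have coupling: "gff_coupling N Q" by (simp add: gff_coupling_def sets_Q)
  have "\<P>(\<omega> in Q. \<epsilon> < \<bar>fst \<omega> (proj N y) - snd \<omega> y\<bar>)
      \<le> 2 * exp (- (1 / (2 * error_const CARD('d)) * \<epsilon>\<^sup>2 * real N powr (1 / 4)))"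
    if \<delta>: "1 / 2 < \<delta>" and y: "y \<in> lattice_box N \<delta>" and \<epsilon>: "0 < \<epsilon>" for \<delta> y \<epsilon>
  proof -
    let ?D = "\<lambda>\<omega>. fst \<omega> (proj N y) - snd \<omega> y"
    let ?a = "case_sum (\<lambda>_. 1) (\<lambda>_. - 1) :: int ^ 'd + int ^ 'd \<Rightarrow> real"
    have D: "?D \<in> borel_measurable ?S"
      by (intro borel_measurable_diff fst_comp snd_comp proj_in_torus[OF N])
    have v: "(\<Sum>s\<in>{Inl (proj N y), Inr y}. \<Sum>t\<in>{Inl (proj N y), Inr y}. ?a s * ?a t * K s t) = field_error N y"
      using sym[of "Inr y" "Inl (proj N y)"] by (simp add: field_error_def K_def Let_def)
    have "distr Q borel ?D = distr white_noise borel (\<lambda>\<omega>. \<Sum>s\<in>{Inl (proj N y), Inr y}. ?a s * X s \<omega>)"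
      by (subst distr_Q[OF D]) (simp add: fst_\<Phi>[OF proj_in_torus[OF N]] snd_\<Phi>)
    also have "\<dots> = centered_normal (sqrt (field_error N y))"
      unfolding v[symmetric] by (rule law) simp
    finally have law_D: "distr Q borel ?D = centered_normal (sqrt (field_error N y))" .
    have nonneg: "0 \<le> field_error N y"
      unfolding v[symmetric] by (rule psdD[OF psd]) simp
    let ?v = "error_const CARD('d) * real N powr (- (1 / 4))"
    have "\<P>(\<omega> in Q. \<epsilon> < \<bar>?D \<omega>\<bar>) = measure (distr Q borel ?D) {x. \<epsilon> < \<bar>x\<bar>}"
      by (subst measure_distr[OF Q_borel[OF D]]) (auto intro!: arg_cong[where f = "measure Q"])
    also have "\<dots> \<le> 2 * exp (- (\<epsilon>\<^sup>2 / (2 * ?v)))"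
      unfolding law_D using nonneg \<epsilon> field_error_le[OF d y \<delta> N]
      by (intro centered_normal_tail) auto
    also have "\<epsilon>\<^sup>2 / (2 * ?v) = 1 / (2 * error_const CARD('d)) * \<epsilon>\<^sup>2 * real N powr (1 / 4)"
      by (simp add: powr_minus_divide)
    finally show ?thesis .
  qed
  with coupling show ?thesis by blast
qed

lemma prob_sup_deviation_le:
  fixes Q :: "'d::finite field_pair measure"
  assumes Q: "gff_coupling N Q" and N: "N \<ge> 1" and \<delta>: "1 / 2 < \<delta>" and \<epsilon>: "0 < \<epsilon>" and b: "0 \<le> b"
    and point: "\<And>y. y \<in> lattice_box N \<delta> \<Longrightarrow> \<P>(\<omega> in Q. \<epsilon> < \<bar>fst \<omega> (proj N y) - snd \<omega> y\<bar>) \<le> b"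
  shows "\<P>(\<omega> in Q. sup_deviation N \<delta> \<omega> > \<epsilon>) \<le> real N ^ CARD('d) * b"
proof -
  let ?B = "torus_box N \<delta> :: (int ^ 'd) set"
  let ?A = "\<lambda>x. {\<omega>\<in>space Q. \<epsilon> < \<bar>fst \<omega> x - snd \<omega> (lift N x)\<bar>}"
  interpret prob_space Q using Q by (simp add: gff_coupling_def)
  have sub: "?B \<subseteq> torus N" by (auto simp: torus_box_def intro: proj_in_torus[OF N])
  then have fin: "finite ?B" using finite_torus finite_subset by blast
  have meas: "(\<lambda>\<omega>. fst \<omega> x - snd \<omega> (lift N x)) \<in> borel_measurable Q" if "x \<in> ?B" for x
    using Q that sub unfolding gff_coupling_def centered_gaussian_field_def
    by (intro borel_measurable_diff) auto
  have A: "?A x \<in> sets Q" if "x \<in> ?B" for x using meas[OF that] by measurable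
  have prob_A: "prob (?A x) \<le> b" if x: "x \<in> ?B" for x
  proof -
    obtain y where y: "y \<in> lattice_box N \<delta>" "x = proj N y" using x by (auto simp: torus_box_def)
    have "lift N x = y" unfolding y(2) by (rule lift_proj[OF lattice_box_subset_centered_box[OF y(1) \<delta> N]])
    then show ?thesis using point[OF y(1)] y(2) by simp
  qed
  have "{\<omega>\<in>space Q. sup_deviation N \<delta> \<omega> > \<epsilon>} \<subseteq> (\<Union>x\<in>?B. ?A x)"
  proof
    fix \<omega> assume \<omega>: "\<omega> \<in> {\<omega>\<in>space Q. sup_deviation N \<delta> \<omega> > \<epsilon>}"
    then have ne: "?B \<noteq> {}" using \<epsilon> by (auto simp: sup_deviation_def)
    then have "\<epsilon> < (SUP x\<in>?B. \<bar>fst \<omega> x - snd \<omega> (lift N x)\<bar>)" using \<omega> by (simp add: sup_deviation_def)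
    then obtain x where "x \<in> ?B" "\<epsilon> < \<bar>fst \<omega> x - snd \<omega> (lift N x)\<bar>"
      using fin ne by (subst (asm) less_cSUP_iff) auto
    then show "\<omega> \<in> (\<Union>x\<in>?B. ?A x)" using \<omega> by auto
  qed
  then have "prob {\<omega>\<in>space Q. sup_deviation N \<delta> \<omega> > \<epsilon>} \<le> prob (\<Union>x\<in>?B. ?A x)"
    using A fin by (intro finite_measure_mono) auto
  also have "\<dots> \<le> (\<Sum>x\<in>?B. prob (?A x))"
    using A fin by (intro measure_UNION_le) auto
  also have "\<dots> \<le> real (card ?B) * b"
    using prob_A by (intro sum_bounded_above) auto
  also have "\<dots> \<le> real N ^ CARD('d) * b"
    using card_mono[OF finite_torus sub] b by (intro mult_right_mono) (auto simp: card_torus simp flip: of_nat_power)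
  finally show ?thesis .
qed

theorem theorem3p3:
  assumes "CARD('d::finite) \<ge> 3"
  shows "\<exists>Q :: nat \<Rightarrow> 'd field_pair measure.
    (\<forall>N\<ge>1. gff_coupling N (Q N)) \<and>
    (\<forall>\<delta>::real. 1/2 < \<delta> \<and> \<delta> < 1 \<longrightarrow>
       (\<exists>c>0. \<exists>c'>0. \<forall>\<epsilon>>0. \<forall>N\<ge>1.
          \<P>(\<omega> in Q N. sup_deviation N \<delta> \<omega> > \<epsilon>)
            \<le> 4 * real N ^ CARD('d) * exp (- (c * \<epsilon>\<^sup>2 * real N powr c')))) \<and>
    (\<forall>(\<delta>::real) \<epsilon>. 1/2 < \<delta> \<and> \<delta> < 1 \<and> \<epsilon> > 0 \<longrightarrow>
       (\<lambda>N. \<P>(\<omega> in Q N. sup_deviation N \<delta> \<omega> > \<epsilon>)) \<longlonglongrightarrow> 0)"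
proof -
  define c where "c = 1 / (2 * error_const CARD('d))"
  have c: "c > 0" using error_const_pos[of "CARD('d)"] by (simp add: c_def)
  obtain Q :: "nat \<Rightarrow> 'd field_pair measure" where Q: "\<And>N. N \<ge> 1 \<Longrightarrow> gff_coupling N (Q N)"
    and point: "\<And>N \<delta> y \<epsilon>. N \<ge> 1 \<Longrightarrow> 1 / 2 < \<delta> \<Longrightarrow> y \<in> lattice_box N \<delta> \<Longrightarrow> 0 < \<epsilon> \<Longrightarrow>
      \<P>(\<omega> in Q N. \<epsilon> < \<bar>fst \<omega> (proj N y) - snd \<omega> y\<bar>) \<le> 2 * exp (- (c * \<epsilon>\<^sup>2 * real N powr (1 / 4)))"
  proof -
    from ex_coupling[OF assms] have "\<forall>N. \<exists>Q :: 'd field_pair measure. N \<ge> 1 \<longrightarrow> gff_coupling N Q \<and>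
      (\<forall>\<delta> y \<epsilon>. 1 / 2 < \<delta> \<longrightarrow> y \<in> lattice_box N \<delta> \<longrightarrow> 0 < \<epsilon> \<longrightarrow>
        \<P>(\<omega> in Q. \<epsilon> < \<bar>fst \<omega> (proj N y) - snd \<omega> y\<bar>) \<le> 2 * exp (- (c * \<epsilon>\<^sup>2 * real N powr (1 / 4))))"
      unfolding c_def by blast
    from choice[OF this] that show ?thesis by blast
  qed
  have bound: "\<P>(\<omega> in Q N. sup_deviation N \<delta> \<omega> > \<epsilon>) \<le> 4 * real N ^ CARD('d) * exp (- (c * \<epsilon>\<^sup>2 * real N powr (1 / 4)))"
    if "1 / 2 < \<delta>" "\<epsilon> > 0" "N \<ge> 1" for \<delta> \<epsilon> N
  proof -
    have "\<P>(\<omega> in Q N. sup_deviation N \<delta> \<omega> > \<epsilon>) \<le> real N ^ CARD('d) * (2 * exp (- (c * \<epsilon>\<^sup>2 * real N powr (1 / 4))))"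
      using that by (intro prob_sup_deviation_le Q point) auto
    also have "\<dots> \<le> 4 * real N ^ CARD('d) * exp (- (c * \<epsilon>\<^sup>2 * real N powr (1 / 4)))"
      by simp
    finally show ?thesis .
  qed
  have limit: "(\<lambda>N. \<P>(\<omega> in Q N. sup_deviation N \<delta> \<omega> > \<epsilon>)) \<longlonglongrightarrow> 0" if "1 / 2 < \<delta>" "\<epsilon> > 0" for \<delta> \<epsilon>
  proof (rule tendsto_sandwich[OF _ _ tendsto_const])
    show "\<forall>\<^sub>F N in sequentially. 0 \<le> \<P>(\<omega> in Q N. sup_deviation N \<delta> \<omega> > \<epsilon>)" by simp
    show "\<forall>\<^sub>F N in sequentially. \<P>(\<omega> in Q N. sup_deviation N \<delta> \<omega> > \<epsilon>)
        \<le> 4 * real N ^ CARD('d) * exp (- (c * \<epsilon>\<^sup>2 * real N powr (1 / 4)))"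
      using eventually_ge_at_top[of 1] by eventually_elim (rule bound[OF that])
    define a where "a = c * \<epsilon>\<^sup>2"
    have "a > 0" using c that by (simp add: a_def)
    then have "(\<lambda>N. 4 * real N ^ CARD('d) * exp (- (a * real N powr (1 / 4)))) \<longlonglongrightarrow> 0"
      by real_asymp
    then show "(\<lambda>N. 4 * real N ^ CARD('d) * exp (- (c * \<epsilon>\<^sup>2 * real N powr (1 / 4)))) \<longlonglongrightarrow> 0"
      by (simp add: a_def)
  qed
  have exponent: "(0 :: real) < 1 / 4" by simp
  show ?thesis
    using Q bound limit c exponent by blast
qed

end
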